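(* Let $\mathcal H$ be a homogeneous foliation of degree $d\ge3$ on $\mathbb P^2_{\mathbb C}$, of type $\mathcal T_{\mathcal H}$. (i) If $\mathcal T_{\mathcal H}=1\cdot\mathrm R_{d-2}+1\cdot\mathrm T_1+1\cdot\mathrm R_{d-1}$, then the $d$-web $\mathrm{Leg}\,\mathcal H$ is flat if and only if $\mathcal H$ is linearly conjugate to the foliation $\mathcal H_5^d$ described by $$\omega_5^d=2y^d\mathrm dx+x^{d-1}\big(yd-(d-1)x\big)\mathrm dy.$$ (ii) If $\mathcal T_{\mathcal H}=1\cdot\mathrm R_{d-2}+1\cdot\mathrm T_1+1\cdot\mathrm T_{d-1}$, then the $d$-web $\mathrm{Leg}\,\mathcal H$ is flat if and only if $\mathcal H$ is linearly conjugate to the foliation $\mathcal H_6^d$ described by $$\omega_6^d=\big((d-1)^2x^d-d(d-1)x^{d-1}y+(d+1)y^d\big)\mathrm dx+x^{d-1}\big(yd-(d-1)x\big)\mathrm dy.$$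
   Context: Foliations. A foliation of degree $d$ on $\mathbb P^2_{\mathbb C}$ is given in homogeneous coordinates $[x:y:z]$, up to a nonzero scalar, by a $1$-form $\alpha\,\mathrm dx+\beta\,\mathrm dy+\gamma\,\mathrm dz$ with homogeneous coefficients of degree $d+1$ without common factor satisfying $x\alpha+y\beta+z\gamma=0$; in the affine chart $z=1$ it is described by a polynomial $1$-form with coprime coefficients. It is homogeneous if in some affine chart $(x,y)$ it is invariant under all homotheties $(x,y)\mapsto\lambda(x,y)$; it is then described by $\omega=A\,\mathrm dx+B\,\mathrm dy$ with $A,B$ homogeneous of degree $d$ without common factor. Linearly conjugate means conjugate under $\mathrm{PGL}_3(\mathbb C)=\mathrm{Aut}(\mathbb P^2_{\mathbb C})$. Radial singularities. Let $s$ be a singular point of a foliation $\mathcal F$ defined near $s$ by a vector field $\mathrm X$ with isolated zeros. $\nu(\mathcal F,s)$ is the vanishing order of $\mathrm X$ at $s$. For a line $\ell=\{f=0\}$ through $s$ not $\mathcal F$-invariant, $\mathrm{Tang}(\mathcal F,\ell,s)=\dim_{\mathbb C}\mathcal O_s/\langle f,\mathrm X(f)\rangle$; $\tau(\mathcal F,s)$ is the minimum of these numbers over all such lines. The point $s$ is radial of order $\tau(\mathcal F,s)-1$ if $\nu(\mathcal F,s)=1$ and $\tau(\mathcal F,s)\ge2$. Type. For $\mathcal H$ a homogeneous foliation of degree $d$ described in an affine chart $(x,y)$ by $\omega=A\,\mathrm dx+B\,\mathrm dy$, with $A,B$ homogeneous polynomials of degree $d$ without common factor, put $\mathrm D_{\mathcal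 H}=A_xB_y-A_yB_x$. A transverse inflection line of order $m\geq 1$ is a line through the origin, not $\mathcal H$-invariant, dividing $\mathrm D_{\mathcal H}$ with multiplicity exactly $m$. If $r_k$ is the number of radial singularities of order $k$ of $\mathcal H$ and $t_k$ the number of its transverse inflection lines of order $k$, the type of $\mathcal H$ is the formal sum $\mathcal T_{\mathcal H}=\sum_{k=1}^{d-1}(r_k\cdot\mathrm R_k+t_k\cdot\mathrm T_k)$ in formal variables $\mathrm R_k,\mathrm T_k$. Webs and Legendre transform. A $k$-web on a complex surface is given locally by a $k$-symmetric holomorphic $1$-form with isolated zeros (well defined up to units, compatible on overlaps) which at a generic point factors as a product of $k$ pairwise non-collinear linear forms. The set where this fails is the discriminant $\Delta(\mathcal W)$. The Legendre transform $\mathrm{Leg}\,\mathcal H$ is the $d$-web on the dual plane $\check{\mathbb P}^2_{\mathbb C}$ whose leaves are the families of tangent lines to the leaves of $\mathcal H$. In the affine chart $(p,q)$ of $\check{\mathbb P}^2_{\mathbb C}$ corresponding to the line $\{y=px-q\}$ it is given by $A(x,px-q)+pB(x,px-q)=0$ with $x=\frac{\mathrm dq}{\mathrm dp}$. Curvature. For a germ of web $\mathcal W=\mathcal F_1\boxtimes\cdots\boxtimes\mathcal F_k$ superposed from foliations defined by $1$-forms $\theta_i$ in coordinates $(u,v)$, write $\theta_i\wedge\theta_j=\delta_{ij}\,\mathrm du\wedge\mathrm dv$. For $r<s<t$ let $\eta_{rst}$ be the unique meromorphic $1$-form with $\mathrm d(\delta_{st}\theta_r)=\eta_{rst}\wedge\delta_{st}\theta_r$,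 $\mathrm d(\delta_{tr}\theta_s)=\eta_{rst}\wedge\delta_{tr}\theta_s$, $\mathrm d(\delta_{rs}\theta_t)=\eta_{rst}\wedge\delta_{rs}\theta_t$. The curvature $K(\mathcal W)=\mathrm d(\sum_{r<s<t}\eta_{rst})$ does not depend on choices. For a general web these local forms glue to a global meromorphic $2$-form with poles in $\Delta(\mathcal W)$. The web is flat if $K(\mathcal W)\equiv0$. *)

theory Defs
  imports
    "HOL-Analysis.Analysis"
    "HOL-Computational_Algebra.Polynomial"
    "HOL-Library.Poly_Mapping"
    "HOL-Library.Extended_Nat"
begin

section \<open>Polynomials in two and three variables\<close>

text \<open>
  \<open>\<complex>[x,y]\<close> is \<^typ>\<open>complex poly poly\<close> and \<open>\<complex>[x,y,z]\<close> is \<^typ>\<open>complex poly poly poly\<close>. The innermost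
  variable is \<open>x\<close>; the outermost one is \<open>y\<close>, respectively \<open>z\<close>.
\<close>

type_synonym poly2 = "complex poly poly"
type_synonym poly3 = "complex poly poly poly"

definition X2 :: poly2 where "X2 = [:[:0, 1:]:]"
definition Y2 :: poly2 where "Y2 = [:0, 1:]"

definition X3 :: poly3 where "X3 = [:X2:]"
definition Y3 :: poly3 where "Y3 = [:Y2:]"
definition Z3 :: poly3 where "Z3 = [:0, 1:]"

definition eval2 :: "poly2 \<Rightarrow> complex \<Rightarrow> complex \<Rightarrow> complex" where
  "eval2 P x y = poly (poly P [:y:]) x"

definition eval3 :: "poly3 \<Rightarrow> complex^3 \<Rightarrow> complex" where
  "eval3 P v = eval2 (poly P [:[:v$3:]:]) (v$1) (v$2)"

definition homogeneous2 :: "nat \<Rightarrow> poly2 \<Rightarrow> bool" where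
  "homogeneous2 n P \<longleftrightarrow> (\<forall>i j. coeff (coeff P j) i \<noteq> 0 \<longrightarrow> i + j = n)"

definition homogeneous3 :: "nat \<Rightarrow> poly3 \<Rightarrow> bool" where
  "homogeneous3 n P \<longleftrightarrow> (\<forall>i j k. coeff (coeff (coeff P k) j) i \<noteq> 0 \<longrightarrow> i + j + k = n)"

definition poly_dx :: "poly2 \<Rightarrow> poly2" where "poly_dx P = map_poly pderiv P"
definition poly_dy :: "poly2 \<Rightarrow> poly2" where "poly_dy P = pderiv P"


section \<open>Functions, vector fields and 1-forms in two complex variables\<close>

type_synonym c2 = "complex \<times> complex"

text \<open>Vector fields and 1-forms are given by the pair of their coefficients in the coordinates
  \<open>(u,v)\<close>; a 2-form is given by its coefficient with respect to \<open>du \<and> dv\<close>.\<close>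

definition holomorphic2 :: "(c2 \<Rightarrow> complex) \<Rightarrow> c2 set \<Rightarrow> bool" where
  "holomorphic2 f U \<longleftrightarrow>
     (\<forall>z\<in>U. \<exists>a b. (f has_derivative (\<lambda>(h, k). a * h + b * k)) (at z))"

definition deriv_u :: "(c2 \<Rightarrow> complex) \<Rightarrow> c2 \<Rightarrow> complex" where
  "deriv_u f = (\<lambda>(u, v). deriv (\<lambda>t. f (t, v)) u)"

definition deriv_v :: "(c2 \<Rightarrow> complex) \<Rightarrow> c2 \<Rightarrow> complex" where
  "deriv_v f = (\<lambda>(u, v). deriv (\<lambda>t. f (u, t)) v)"

definition derivation :: "(c2 \<Rightarrow> c2) \<Rightarrow> (c2 \<Rightarrow> complex) \<Rightarrow> c2 \<Rightarrow> complex" where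
  "derivation X f z = fst (X z) * deriv_u f z + snd (X z) * deriv_v f z"

definition line_fun :: "complex \<Rightarrow> complex \<Rightarrow> c2 \<Rightarrow> complex" where
  "line_fun l m = (\<lambda>(u, v). l * u + m * v)"

definition invariant_line :: "(c2 \<Rightarrow> c2) \<Rightarrow> (c2 \<Rightarrow> complex) \<Rightarrow> bool" where
  "invariant_line X f \<longleftrightarrow> (\<forall>z. f z = 0 \<longrightarrow> derivation X f z = 0)"


section \<open>Foliations on the projective plane\<close>

text \<open>A homogeneous 1-form \<open>\<alpha> dx + \<beta> dy + \<gamma> dz\<close> is the vector of its three coefficients;
  \<open>form_at \<Omega> p w\<close> is its value at the point \<open>p\<close> on the tangent vector \<open>w\<close>.\<close>

type_synonym form3 = "poly3^3"

definition form_at :: "form3 \<Rightarrow> complex^3 \<Rightarrow> complex^3 \<Rightarrow> complex" where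
  "form_at \<Omega> p w = (\<Sum>i\<in>UNIV. eval3 (\<Omega>$i) p * w$i)"

definition foliation :: "nat \<Rightarrow> form3 \<Rightarrow> bool" where
  "foliation d \<Omega> \<longleftrightarrow>
     (\<forall>i. homogeneous3 (d + 1) (\<Omega>$i)) \<and>
     (\<forall>c. (\<forall>i. c dvd \<Omega>$i) \<longrightarrow> is_unit c) \<and>
     X3 * \<Omega>$1 + Y3 * \<Omega>$2 + Z3 * \<Omega>$3 = 0"

definition lin_conj :: "form3 \<Rightarrow> form3 \<Rightarrow> bool" where
  "lin_conj \<Omega> \<Omega>' \<longleftrightarrow>
     (\<exists>M :: complex^3^3. \<exists>c. invertible M \<and> c \<noteq> 0 \<and>
        (\<forall>p w. form_at \<Omega>' (M *v p) (M *v w) = c * form_at \<Omega> p w))"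

text \<open>An invertible matrix \<open>M\<close> determines the affine chart \<open>(x,y) \<mapsto> [M (x,y,1)]\<close>, and every affine
  chart is of this form. \<open>chart_form \<Omega> M\<close> is the 1-form describing the foliation in that chart.\<close>

definition chart_form :: "form3 \<Rightarrow> complex^3^3 \<Rightarrow> c2 \<Rightarrow> c2" where
  "chart_form \<Omega> M = (\<lambda>(x, y).
     (form_at \<Omega> (M *v vector [x, y, 1]) (M *v vector [1, 0, 0]),
      form_at \<Omega> (M *v vector [x, y, 1]) (M *v vector [0, 1, 0])))"

text \<open>The foliation \<open>a du + b dv = 0\<close> is defined by the vector field \<open>b \<partial>/\<partial>u - a \<partial>/\<partial>v\<close>.\<close>

definition form_field :: "(c2 \<Rightarrow> c2) \<Rightarrow> c2 \<Rightarrow> c2" where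
  "form_field \<theta> z = (snd (\<theta> z), - fst (\<theta> z))"

text \<open>Invariance under the homotheties \<open>(x,y) \<mapsto> (tx,ty)\<close>: the pull-back of the form, which has
  coefficients \<open>t a(tx,ty)\<close> and \<open>t b(tx,ty)\<close>, is a nonzero multiple of the form.\<close>

definition homogeneous_foliation :: "nat \<Rightarrow> form3 \<Rightarrow> bool" where
  "homogeneous_foliation d \<Omega> \<longleftrightarrow> foliation d \<Omega> \<and>
     (\<exists>M. invertible M \<and>
        (\<forall>t. t \<noteq> 0 \<longrightarrow> (\<exists>c. c \<noteq> 0 \<and> (\<forall>x y.
           t * fst (chart_form \<Omega> M (t * x, t * y)) = c * fst (chart_form \<Omega> M (x, y)) \<and>
           t * snd (chart_form \<Omega> M (t * x, t * y)) = c * snd (chart_form \<Omega> M (x, y))))))"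

definition form2 :: "poly2 \<Rightarrow> poly2 \<Rightarrow> c2 \<Rightarrow> c2" where
  "form2 A B = (\<lambda>(x, y). (eval2 A x y, eval2 B x y))"

definition described_by :: "nat \<Rightarrow> form3 \<Rightarrow> complex^3^3 \<Rightarrow> poly2 \<Rightarrow> poly2 \<Rightarrow> bool" where
  "described_by d \<Omega> M A B \<longleftrightarrow>
     invertible M \<and> homogeneous2 d A \<and> homogeneous2 d B \<and> coprime A B \<and>
     chart_form \<Omega> M = form2 A B"

text \<open>For \<open>A\<close>, \<open>B\<close> homogeneous of the same degree, the projective foliation described by
  \<open>A dx + B dy\<close> in the chart \<open>z = 1\<close> is given by \<open>z A dx + z B dy - (x A + y B) dz\<close>.\<close>

definition homog_form :: "poly2 \<Rightarrow> poly2 \<Rightarrow> form3" where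
  "homog_form A B = vector [Z3 * [:A:], Z3 * [:B:], - (X3 * [:A:] + Y3 * [:B:])]"

definition H5 :: "nat \<Rightarrow> form3" where
  "H5 d = homog_form
     (2 * Y2 ^ d)
     (X2 ^ (d - 1) * (of_nat d * Y2 - of_nat (d - 1) * X2))"

definition H6 :: "nat \<Rightarrow> form3" where
  "H6 d = homog_form
     (of_nat ((d - 1)\<^sup>2) * X2 ^ d - of_nat (d * (d - 1)) * X2 ^ (d - 1) * Y2
        + of_nat (d + 1) * Y2 ^ d)
     (X2 ^ (d - 1) * (of_nat d * Y2 - of_nat (d - 1) * X2))"


section \<open>Radial singularities\<close>

text \<open>Elements of \<open>\<O>\<close> represent germs at the origin of \<open>\<complex>\<^sup>2\<close>. Two of them represent the same germ if
  they agree near the origin; \<open>germ_ideal\<close> is closed under this identification, so quotients by it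
  are quotients of the ring of germs.\<close>

definition \<O> :: "(c2 \<Rightarrow> complex) set" where
  "\<O> = {h. \<exists>U. open U \<and> (0, 0) \<in> U \<and> holomorphic2 h U}"

definition germ_ideal :: "(c2 \<Rightarrow> complex) \<Rightarrow> (c2 \<Rightarrow> complex) \<Rightarrow> (c2 \<Rightarrow> complex) set" where
  "germ_ideal f g =
     {h \<in> \<O>. \<exists>a\<in>\<O>. \<exists>b\<in>\<O>. \<forall>\<^sub>F z in nhds (0, 0). h z = a z * f z + b z * g z}"

text \<open>\<open>quot_dim V W\<close> is the complex dimension of \<open>V/W\<close>: the supremum of the lengths of families in
  \<open>V\<close> that are linearly independent modulo \<open>W\<close>.\<close>

definition quot_dim :: "(c2 \<Rightarrow> complex) set \<Rightarrow> (c2 \<Rightarrow> complex) set \<Rightarrow> enat" where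
  "quot_dim V W = Sup {enat n | n. \<exists>b :: nat \<Rightarrow> c2 \<Rightarrow> complex. (\<forall>i<n. b i \<in> V) \<and>
     (\<forall>c :: nat \<Rightarrow> complex. (\<lambda>z. \<Sum>i<n. c i * b i z) \<in> W \<longrightarrow> (\<forall>i<n. c i = 0))}"

definition tang_order :: "(c2 \<Rightarrow> c2) \<Rightarrow> (c2 \<Rightarrow> complex) \<Rightarrow> enat" where
  "tang_order X f = quot_dim \<O> (germ_ideal f (derivation X f))"

definition tau_order :: "(c2 \<Rightarrow> c2) \<Rightarrow> enat" where
  "tau_order X = Inf {tang_order X (line_fun l m) | l m.
     (l, m) \<noteq> (0, 0) \<and> \<not> invariant_line X (line_fun l m)}"

definition vanishing_order :: "(c2 \<Rightarrow> c2) \<Rightarrow> nat" where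
  "vanishing_order X = (LEAST n. \<exists>i j. i + j = n \<and>
     ((deriv_u ^^ i) ((deriv_v ^^ j) (\<lambda>z. fst (X z))) (0, 0) \<noteq> 0 \<or>
      (deriv_u ^^ i) ((deriv_v ^^ j) (\<lambda>z. snd (X z))) (0, 0) \<noteq> 0))"

text \<open>Points of the projective plane are the lines through the origin of \<open>\<complex>\<^sup>3\<close>.\<close>

definition proj_points :: "(complex^3) set set" where
  "proj_points = {range (\<lambda>c. c *s p) | p. p \<noteq> 0}"

definition singular_point :: "form3 \<Rightarrow> (complex^3) set \<Rightarrow> bool" where
  "singular_point \<Omega> s \<longleftrightarrow> s \<in> proj_points \<and> (\<forall>p\<in>s. \<forall>w. form_at \<Omega> p w = 0)"

text \<open>The orders at \<open>s\<close> are computed in an affine chart with origin \<open>s\<close>; they do not depend on the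
  chart.\<close>

definition radial_of_order :: "form3 \<Rightarrow> (complex^3) set \<Rightarrow> nat \<Rightarrow> bool" where
  "radial_of_order \<Omega> s k \<longleftrightarrow> singular_point \<Omega> s \<and>
     (\<exists>M. invertible M \<and> M *v vector [0, 0, 1] \<in> s \<and>
        vanishing_order (form_field (chart_form \<Omega> M)) = 1 \<and>
        tau_order (form_field (chart_form \<Omega> M)) \<ge> 2 \<and>
        tau_order (form_field (chart_form \<Omega> M)) = enat (k + 1))"


section \<open>The type of a homogeneous foliation\<close>

definition D_poly :: "poly2 \<Rightarrow> poly2 \<Rightarrow> poly2" where
  "D_poly A B = poly_dx A * poly_dy B - poly_dy A * poly_dx B"

definition line_poly :: "complex \<Rightarrow> complex \<Rightarrow> poly2" where
  "line_poly l m = [:[:l:]:] * X2 + [:[:m:]:] * Y2"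

definition transverse_inflection_line :: "poly2 \<Rightarrow> poly2 \<Rightarrow> nat \<Rightarrow> c2 set \<Rightarrow> bool" where
  "transverse_inflection_line A B k L \<longleftrightarrow>
     (\<exists>l m. (l, m) \<noteq> (0, 0) \<and> L = {z. line_fun l m z = 0} \<and>
        \<not> invariant_line (form_field (form2 A B)) (line_fun l m) \<and>
        line_poly l m ^ k dvd D_poly A B \<and> \<not> line_poly l m ^ (k + 1) dvd D_poly A B)"

datatype type_var = RVar nat | TVar nat

text \<open>Formal sums in the variables \<open>R\<^sub>k\<close>, \<open>T\<^sub>k\<close> are finitely supported functions to \<^typ>\<open>nat\<close>;
  \<open>n \<cdot> R\<^sub>k\<close> is \<open>Poly_Mapping.single (RVar k) n\<close>.\<close>

definition has_type :: "nat \<Rightarrow> form3 \<Rightarrow> (type_var \<Rightarrow>\<^sub>0 nat) \<Rightarrow> bool" where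
  "has_type d \<Omega> \<T> \<longleftrightarrow> (\<exists>M A B. described_by d \<Omega> M A B \<and>
     \<T> = (\<Sum>k=1..d-1.
        Poly_Mapping.single (RVar k) (card {s. radial_of_order \<Omega> s k}) +
        Poly_Mapping.single (TVar k) (card {L. transverse_inflection_line A B k L})))"


section \<open>Webs and their curvature\<close>

definition form_apply :: "c2 \<Rightarrow> c2 \<Rightarrow> complex" where
  "form_apply \<theta> \<xi> = fst \<theta> * fst \<xi> + snd \<theta> * snd \<xi>"

definition wedge :: "c2 \<Rightarrow> c2 \<Rightarrow> complex" where
  "wedge \<theta> \<theta>' = fst \<theta> * snd \<theta>' - snd \<theta> * fst \<theta>'"

definition cscale :: "complex \<Rightarrow> c2 \<Rightarrow> c2" where
  "cscale c \<theta> = (c * fst \<theta>, c * snd \<theta>)"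

definition ext_d :: "(c2 \<Rightarrow> c2) \<Rightarrow> c2 \<Rightarrow> complex" where
  "ext_d \<theta> z = deriv_u (\<lambda>z. snd (\<theta> z)) z - deriv_v (\<lambda>z. fst (\<theta> z)) z"

text \<open>\<open>wform \<theta> \<theta>' \<theta>''\<close> is the 1-form \<open>\<delta> \<theta>''\<close>, where \<open>\<theta> \<and> \<theta>' = \<delta> du \<and> dv\<close>.\<close>

definition wform :: "(c2 \<Rightarrow> c2) \<Rightarrow> (c2 \<Rightarrow> c2) \<Rightarrow> (c2 \<Rightarrow> c2) \<Rightarrow> c2 \<Rightarrow> c2" where
  "wform \<theta> \<theta>' \<theta>'' z = cscale (wedge (\<theta> z) (\<theta>' z)) (\<theta>'' z)"

definition web_eta :: "(c2 \<Rightarrow> c2) \<Rightarrow> (c2 \<Rightarrow> c2) \<Rightarrow> (c2 \<Rightarrow> c2) \<Rightarrow> c2 \<Rightarrow> c2" where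
  "web_eta \<theta>r \<theta>s \<theta>t z = (THE e.
     ext_d (wform \<theta>s \<theta>t \<theta>r) z = wedge e (wform \<theta>s \<theta>t \<theta>r z) \<and>
     ext_d (wform \<theta>t \<theta>r \<theta>s) z = wedge e (wform \<theta>t \<theta>r \<theta>s z) \<and>
     ext_d (wform \<theta>r \<theta>s \<theta>t) z = wedge e (wform \<theta>r \<theta>s \<theta>t z))"

definition curvature :: "nat \<Rightarrow> (nat \<Rightarrow> c2 \<Rightarrow> c2) \<Rightarrow> c2 \<Rightarrow> complex" where
  "curvature k \<theta> = ext_d (\<lambda>z.
     \<Sum>(r, s, t) \<in> {(r, s, t). r < s \<and> s < t \<and> t < k}. web_eta (\<theta> r) (\<theta> s) (\<theta> t) z)"

text \<open>A \<open>k\<close>-symmetric 1-form is given as a function of the base point and the tangent vector.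
  \<open>web_splits k W U \<theta>\<close> says that, on the open set \<open>U\<close> disjoint from the discriminant, the web of \<open>W\<close>
  is the superposition of the foliations of \<open>\<theta> 0, \<dots>, \<theta> (k - 1)\<close>; a unit factor can be absorbed in
  one of the \<open>\<theta> i\<close>.\<close>

definition web_splits ::
    "nat \<Rightarrow> (c2 \<Rightarrow> c2 \<Rightarrow> complex) \<Rightarrow> c2 set \<Rightarrow> (nat \<Rightarrow> c2 \<Rightarrow> c2) \<Rightarrow> bool" where
  "web_splits k W U \<theta> \<longleftrightarrow> open U \<and>
     (\<forall>i<k. holomorphic2 (\<lambda>z. fst (\<theta> i z)) U \<and> holomorphic2 (\<lambda>z. snd (\<theta> i z)) U) \<and>
     (\<forall>z\<in>U. \<forall>i<k. \<forall>j<k. i \<noteq> j \<longrightarrow> wedge (\<theta> i z) (\<theta> j z) \<noteq> 0) \<and>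
     (\<forall>z\<in>U. \<forall>\<xi>. W z \<xi> = (\<Prod>i<k. form_apply (\<theta> i z) \<xi>))"

text \<open>A global web on the (dual) projective plane is given in homogeneous coordinates by a function
  of a point \<open>l\<close> and a tangent vector \<open>\<xi>\<close> of \<open>\<complex>\<^sup>3\<close>, which is restricted to affine charts. The
  curvature is a meromorphic 2-form with poles in the discriminant, so it vanishes identically iff
  it vanishes off the discriminant.\<close>

definition chart_web ::
    "(complex^3 \<Rightarrow> complex^3 \<Rightarrow> complex) \<Rightarrow> complex^3^3 \<Rightarrow> c2 \<Rightarrow> c2 \<Rightarrow> complex" where
  "chart_web W N = (\<lambda>(u, v) (a, b). W (N *v vector [u, v, 1]) (N *v vector [a, b, 0]))"

definition flat_web :: "nat \<Rightarrow> (complex^3 \<Rightarrow> complex^3 \<Rightarrow> complex) \<Rightarrow> bool" where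
  "flat_web k W \<longleftrightarrow> (\<forall>N U \<theta>. invertible N \<longrightarrow> web_splits k (chart_web W N) U \<theta> \<longrightarrow>
     (\<forall>z\<in>U. curvature k \<theta> z = 0))"


section \<open>The Legendre transform\<close>

definition cross :: "complex^3 \<Rightarrow> complex^3 \<Rightarrow> complex^3" where
  "cross a b = vector [a$2 * b$3 - a$3 * b$2, a$3 * b$1 - a$1 * b$3, a$1 * b$2 - a$2 * b$1]"

text \<open>
  A point of the dual plane is a line \<open>{p. l\<^sub>1 p\<^sub>1 + l\<^sub>2 p\<^sub>2 + l\<^sub>3 p\<^sub>3 = 0}\<close>, and a curve through it with
  velocity \<open>\<xi>\<close> is a moving line which turns about the point \<open>p = l \<times> \<xi>\<close> of \<open>l\<close>. The curve is tangent
  to a leaf of the web iff \<open>l\<close> is tangent at \<open>p\<close> to the foliation, i.e. iff the covector \<open>\<Omega>(p)\<close> is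
  proportional to \<open>l\<close>. As \<open>\<Omega>(p)\<close> annihilates \<open>p\<close>, it is of the form \<open>c \<xi> + e l\<close>, and the equation of
  the web is \<open>c = 0\<close>. The lemma below recovers the usual equation in the chart \<open>(p,q)\<close> of the lines
  \<open>y = p x - q\<close>.
\<close>

definition leg_web :: "form3 \<Rightarrow> complex^3 \<Rightarrow> complex^3 \<Rightarrow> complex" where
  "leg_web \<Omega> l \<xi> = (if cross l \<xi> = 0 then 0
     else THE c. \<exists>e. \<forall>w. form_at \<Omega> (cross l \<xi>) w = (\<Sum>i\<in>UNIV. (c * \<xi>$i + e * l$i) * w$i))"

lemma leg_web_chart:
  assumes "(a, b) \<noteq> (0, 0)"
  shows "leg_web (homog_form A B) (vector [p, -1, -q]) (vector [a, 0, -b]) =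
         eval2 A b (p * b - q * a) + p * eval2 B b (p * b - q * a)"
proof -
  let ?l = "vector [p, -1, -q] :: complex^3" and ?x = "vector [a, 0, -b] :: complex^3"
  let ?y = "p * b - q * a"
  let ?c = "eval2 A b ?y + p * eval2 B b ?y"
  have cr: "cross ?l ?x = vector [b, ?y, a]"
    by (simp add: cross_def vec_eq_iff forall_3 algebra_simps)
  have ne: "cross ?l ?x \<noteq> 0"
    using assms by (auto simp: cr vec_eq_iff forall_3)
  have form: "form_at (homog_form A B) (cross ?l ?x) w =
      a * eval2 A b ?y * w$1 + a * eval2 B b ?y * w$2
        - (b * eval2 A b ?y + ?y * eval2 B b ?y) * w$3" for w
    by (simp add: cr form_at_def homog_form_def sum_3 eval3_def eval2_def X3_def Y3_def Z3_def
        X2_def Y2_def algebra_simps)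
  have "(THE c. \<exists>e. \<forall>w. form_at (homog_form A B) (cross ?l ?x) w
      = (\<Sum>i\<in>UNIV. (c * ?x$i + e * ?l$i) * w$i)) = ?c"
  proof (rule the_equality)
    show "\<exists>e. \<forall>w. form_at (homog_form A B) (cross ?l ?x) w
        = (\<Sum>i\<in>UNIV. (?c * ?x$i + e * ?l$i) * w$i)"
      unfolding form
      by (rule exI[of _ "- a * eval2 B b ?y"]) (simp add: sum_3 algebra_simps)
  next
    fix c
    assume "\<exists>e. \<forall>w. form_at (homog_form A B) (cross ?l ?x) w
        = (\<Sum>i\<in>UNIV. (c * ?x$i + e * ?l$i) * w$i)"
    then obtain e where e: "\<And>w. form_at (homog_form A B) (cross ?l ?x) w
        = (\<Sum>i\<in>UNIV. (c * ?x$i + e * ?l$i) * w$i)" by blast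
    have 1: "a * eval2 A b ?y = c * a + e * p"
      using e[of "vector [1, 0, 0]"] unfolding form by (simp add: sum_3)
    have 2: "a * eval2 B b ?y = - e"
      using e[of "vector [0, 1, 0]"] unfolding form by (simp add: sum_3)
    have 3: "b * eval2 A b ?y + ?y * eval2 B b ?y = c * b + e * q"
      using e[of "vector [0, 0, 1]"] unfolding form by (simp add: sum_3 algebra_simps)
    have e': "e = - (a * eval2 B b ?y)" using 2 by simp
    have "a * ?c = a * c" using 1 unfolding e' by (simp add: algebra_simps)
    moreover have "b * ?c = b * c" using 3 unfolding e' by (simp add: algebra_simps)
    ultimately show "c = ?c" using assms by auto
  qed
  then show ?thesis using ne by (simp add: leg_web_def)
qed

end

theory Submission
  imports Defs "HOL-Complex_Analysis.Conformal_Mappings"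
    "HOL-Computational_Algebra.Fundamental_Theorem_Algebra"
begin

text \<open>
  \<^bold>\<open>Symmetry.\<close> A homogeneous foliation is invariant under the homotheties of its chart, which act on
  the lines \<open>y = p x - q\<close> by \<open>(p, q) \<mapsto> (p, \<lambda> q)\<close>. The leaves of its Legendre web therefore satisfy
  \<open>dq/q = dp/(p - t\<^sub>i(p))\<close>, where \<open>t\<^sub>1, \<dots>, t\<^sub>d\<close> are the preimages of \<open>p\<close> under the Gauss map
  \<open>t \<mapsto> - A(1,t)/B(1,t)\<close>, which sends the direction \<open>y = t x\<close> to the slope of the leaves along it.
  For three forms \<open>F\<^sub>i (y\<^sub>i dq/q - dp)\<close> with coefficients \<open>y\<^sub>i\<close> depending on \<open>p\<close> only, one finds
  \<open>\<eta> = dlog G + \<alpha> dp + \<beta> dq/q\<close>, where \<open>\<alpha>\<close> and \<open>\<beta>\<close> depend on \<open>p\<close> only. All terms but the last are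
  closed, so the curvature is \<open>dS \<and> dq/q\<close> with \<open>S\<close> the sum of all \<open>\<beta>\<close> (\<open>curvature_eq\<close>), and the web
  is flat iff the function \<open>S\<close> of \<open>p\<close> is constant.

  \<^bold>\<open>Normal form.\<close> For both types the three branch directions of the Gauss map can be moved
  to \<open>x = 0\<close>, \<open>y = 0\<close> and \<open>y = x\<close>, and the foliation becomes
  \<open>B = x\<^bsup>d-1\<^esup> (d y - (d-1) x)\<close>, \<open>A = \<rho> B + c y\<^bsup>d\<^esup>\<close> with \<open>c \<noteq> 0\<close> (\<open>normal_form_two_radial\<close>,
  \<open>normal_form_two_transverse\<close>). The direction \<open>x = 0\<close> comes from \<open>R\<^bsub>d-2\<^esub>\<close>, the direction \<open>y = 0\<close>
  from \<open>R\<^bsub>d-1\<^esub>\<close> or \<open>T\<^bsub>d-1\<^esub>\<close>, and \<open>y = x\<close> from \<open>T\<^sub>1\<close>. To read this off the definition of a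
  radial singularity one has to compute intersection numbers with lines: the tangency order with a
  line is the vanishing order of the restriction to that line (\<open>quot_dim_line\<close>), so that a
  radial singularity of order \<open>k\<close> in the direction \<open>(v\<^sub>1, v\<^sub>2)\<close> is a zero of order exactly \<open>k + 1\<close> of
  \<open>v\<^sub>1 A + v\<^sub>2 B\<close> (\<open>radial_point\<close>). A direction is an invariant line iff it is a fixed point of the Gauss map. Hence
  \<open>R\<^bsub>d-1\<^esub>\<close> means \<open>\<rho> = 0\<close>, \<open>T\<^bsub>d-1\<^esub>\<close> means \<open>\<rho> \<noteq> 0\<close>, and \<open>T\<^sub>1\<close> implies \<open>\<rho> + c + 1 \<noteq> 0\<close>.

  \<^bold>\<open>Flatness of the normal form.\<close> Here the \<open>t\<^sub>i\<close> are the roots of the trinomial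
  \<open>c t\<^bsup>d\<^esup> + (p + \<rho>) (d t - (d-1))\<close>, and partial fractions reduce \<open>S\<close> to the power sums of
  \<open>t\<^sub>i\<close>, \<open>1/t\<^sub>i\<close> and \<open>1/(t\<^sub>i - 1)\<close> (\<open>sum_eta_dq\<close>). The result is a rational function of \<open>p\<close> with at most
  simple poles at the two finite critical values \<open>- \<rho>\<close> and \<open>- \<rho> - c\<close> of the Gauss map, and with
  residues proportional to \<open>\<rho> (\<rho> + d - 1)\<close> and \<open>(\<rho> + c - 2) (\<rho> + c + 1)\<close>; the web is flat iff both
  vanish (\<open>curvature_family\<close>, \<open>flat_leg_family\<close>). Together with the constraints from the type this
  leaves \<open>(\<rho>, c) = (0, 2)\<close> in the first case, which is \<open>\<H>\<^sub>5\<close>, and \<open>(\<rho>, c) = (1 - d, d + 1)\<close> in the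
  second, which is \<open>\<H>\<^sub>6\<close>.
\<close>

section \<open>Holomorphic functions of two variables\<close>

text \<open>This is the property to which the one-variable theory applies slice by slice. Over open sets it is
  equivalent to complex differentiability (Osgood's lemma, \<open>holomorphic2_iff_separately\<close>), and it is the
  form in which partial derivatives are seen to be holomorphic again.\<close>

definition separately_holomorphic :: "(c2 \<Rightarrow> complex) \<Rightarrow> c2 set \<Rightarrow> bool" where
  "separately_holomorphic f U \<longleftrightarrow> continuous_on U f \<and>
     (\<forall>u v. (u, v) \<in> U \<longrightarrow> (\<lambda>t. f (t, v)) field_differentiable (at u) \<and>
        (\<lambda>t. f (u, t)) field_differentiable (at v))"

lemma separately_holomorphic_swap:
  assumes "separately_holomorphic f U"
  shows "separately_holomorphic (f \<circ> prod.swap) (prod.swap ` U)"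
proof -
  have "continuous_on (prod.swap ` U) (f \<circ> prod.swap)"
    by (rule continuous_on_compose[OF continuous_on_swap])
       (use assms in \<open>auto simp: separately_holomorphic_def image_image\<close>)
  then show ?thesis using assms unfolding separately_holomorphic_def by auto
qed

lemma deriv_v_swap: "deriv_v f = deriv_u (f \<circ> prod.swap) \<circ> prod.swap"
  by (auto simp: deriv_v_def deriv_u_def fun_eq_iff)

lemma open_swap_image: "open U \<Longrightarrow> open (prod.swap ` U)" for U :: "c2 set"
proof -
  have "prod.swap ` U = prod.swap -` U" by force
  then show "open U \<Longrightarrow> open (prod.swap ` U)"
    by (metis continuous_on_swap open_vimage)
qed

lemma cball_polydisc:
  fixes z :: c2
  assumes "open U" "(a, b) \<in> U"
  obtains r where "r > 0" "cball a r \<times> cball b r \<subseteq> U"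
proof -
  obtain A B where AB: "open A" "open B" "a \<in> A" "b \<in> B" "A \<times> B \<subseteq> U"
    by (rule open_prod_elim[OF assms]) auto
  obtain r1 where r1: "r1 > 0" "cball a r1 \<subseteq> A" using AB open_contains_cball by blast
  obtain r2 where r2: "r2 > 0" "cball b r2 \<subseteq> B" using AB open_contains_cball by blast
  have "cball a (min r1 r2) \<times> cball b (min r1 r2) \<subseteq> U" "min r1 r2 > 0"
    using r1 r2 AB(5) by (auto simp: subset_iff)
  then show ?thesis using that by blast
qed

text \<open>The circle is parametrized over \<open>[0, 1]\<close> as in \<open>circlepath\<close>. Cauchy's formula then becomes an
  ordinary integral over an interval, for which continuity in parameters and the Leibniz rule are
  available.\<close>

definition circle_pt :: "complex \<Rightarrow> real \<Rightarrow> real \<Rightarrow> complex" where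
  "circle_pt a r x = a + of_real r * exp (2 * of_real pi * \<i> * of_real x)"

lemma circle_pt_dist: "r > 0 \<Longrightarrow> dist a (circle_pt a r x) = r"
proof -
  have "norm (exp (2 * of_real pi * \<i> * of_real x) :: complex) = 1"
    using norm_exp_i_times[of "2 * pi * x"] by (simp add: mult_ac)
  then show "r > 0 \<Longrightarrow> dist a (circle_pt a r x) = r"
    by (simp add: circle_pt_def dist_norm norm_mult)
qed

lemma circle_pt_ne: "r > 0 \<Longrightarrow> w \<in> ball a r \<Longrightarrow> circle_pt a r x \<noteq> w"
  using circle_pt_dist[of r a x] by auto

lemma continuous_circle_pt [continuous_intros]:
  "continuous_on S h \<Longrightarrow> continuous_on S (\<lambda>z. circle_pt a r (h z))"
  unfolding circle_pt_def by (intro continuous_intros)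

text \<open>The kernel of Cauchy's formula for the first derivative, with the factor
  \<open>d\<zeta> = 2 \<pi> i (\<zeta> - a) dx\<close> of the parametrization absorbed.\<close>

definition cauchy_ker :: "complex \<Rightarrow> real \<Rightarrow> complex \<Rightarrow> real \<Rightarrow> complex" where
  "cauchy_ker a r w x = (circle_pt a r x - a) / (circle_pt a r x - w)\<^sup>2"

lemma deriv_u_Cauchy:
  assumes "separately_holomorphic f U" "r > 0" "cball a r \<times> cball b r \<subseteq> U"
    and u: "u \<in> ball a r" and v: "v \<in> cball b r"
  shows "deriv_u f (u, v) = integral {0..1} (\<lambda>x. cauchy_ker a r u x * f (circle_pt a r x, v))"
proof -
  let ?f = "\<lambda>t. f (t, v)"
  have sub: "(t, v) \<in> U" if "t \<in> cball a r" for t using assms(3) v that by blast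
  have fd: "?f field_differentiable (at t)" if "t \<in> cball a r" for t
    using assms(1) sub[OF that] by (auto simp: separately_holomorphic_def)
  have "continuous_on (cball a r) ?f"
    by (intro continuous_at_imp_continuous_on ballI field_differentiable_imp_continuous_at fd)
  moreover have "?f holomorphic_on ball a r"
    unfolding holomorphic_on_def using fd field_differentiable_at_within
    by (meson ball_subset_cball subsetD)
  ultimately have "(?f has_field_derivative
      (1 / (2 * of_real pi * \<i>) * contour_integral (circlepath a r) (\<lambda>t. ?f t / (t - u)\<^sup>2))) (at u)"
    using Cauchy_derivative_integral_circlepath(2) u by blast
  then have "deriv_u f (u, v) =
      1 / (2 * of_real pi * \<i>) * contour_integral (circlepath a r) (\<lambda>t. ?f t / (t - u)\<^sup>2)"
    by (simp add: deriv_u_def DERIV_imp_deriv)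
  also have "\<dots> = integral {0..1} (\<lambda>x. 1 / (2 * of_real pi * \<i>) *
     (?f (circlepath a r x) / (circlepath a r x - u)\<^sup>2 * vector_derivative (circlepath a r) (at x)))"
    by (simp only: contour_integral_integral integral_mult_right)
  also have "\<dots> = integral {0..1} (\<lambda>x. cauchy_ker a r u x * f (circle_pt a r x, v))"
    by (intro integral_cong, subst vector_derivative_circlepath)
       (simp add: cauchy_ker_def circlepath circle_pt_def field_simps)
  finally show ?thesis .
qed

lemma continuous_cauchy_ker:
  assumes "r > 0"
  shows "continuous_on (ball a r \<times> S) (\<lambda>(w, x). cauchy_ker a r w x)"
  unfolding cauchy_ker_def case_prod_beta
  by (intro continuous_intros) (use circle_pt_ne[OF assms] in auto)

lemma continuous_deriv_u:
  assumes "separately_holomorphic f U" "open U"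
  shows "continuous_on U (deriv_u f)"
proof -
  have "continuous (at z) (deriv_u f)" if zU: "z \<in> U" for z
  proof -
    obtain a b where z: "z = (a, b)" by fastforce
    obtain r where r: "r > 0" "cball a r \<times> cball b r \<subseteq> U"
      using cball_polydisc[of U a b] assms(2) zU z by metis
    have cf: "continuous_on (cball a r \<times> cball b r) f"
      using assms(1) r(2) continuous_on_subset by (auto simp: separately_holomorphic_def)
    let ?g = "\<lambda>(w::c2) x. cauchy_ker a r (fst w) x * f (circle_pt a r x, snd w)"
    have "continuous_on ((ball a r \<times> ball b r) \<times> cbox 0 1) (\<lambda>(w, x). ?g w x)"
      unfolding case_prod_beta
      apply (intro continuous_intros)
       apply (rule continuous_on_compose2[OF continuous_cauchy_ker[OF r(1), of a UNIV],
            where f="\<lambda>z. (fst (fst z), snd z)", unfolded case_prod_beta fst_conv snd_conv])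
        apply (intro continuous_intros)
       apply auto[1]
      apply (rule continuous_on_compose2[OF cf])
       apply (intro continuous_intros)
      using circle_pt_dist[OF r(1), of a] by auto
    then have "continuous_on (ball a r \<times> ball b r) (\<lambda>w. integral (cbox 0 1) (?g w))"
      by (rule integral_continuous_on_param)
    then have "continuous_on (ball a r \<times> ball b r) (deriv_u f)"
      by (rule continuous_on_eq) (use deriv_u_Cauchy[OF assms(1) r] in \<open>auto simp: case_prod_beta\<close>)
    then show ?thesis
      by (rule continuous_on_interior) (use r z in \<open>simp add: interior_open open_Times\<close>)
  qed
  then show ?thesis using continuous_at_imp_continuous_on by blast
qed

lemma continuous_deriv_v:
  assumes "separately_holomorphic f U" "open U"
  shows "continuous_on U (deriv_v f)"
  unfolding deriv_v_swap
  by (rule continuous_on_compose[OF continuous_on_swap])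
     (rule continuous_deriv_u[OF separately_holomorphic_swap[OF assms(1)] open_swap_image[OF assms(2)]])

lemma has_deriv_v:
  assumes "separately_holomorphic f U" "(u, v) \<in> U"
  shows "((\<lambda>t. f (u, t)) has_field_derivative deriv_v f (u, v)) (at v)"
  using assms field_differentiable_derivI by (auto simp: separately_holomorphic_def deriv_v_def)

lemma has_deriv_u:
  assumes "separately_holomorphic f U" "(u, v) \<in> U"
  shows "((\<lambda>t. f (t, v)) has_field_derivative deriv_u f (u, v)) (at u)"
  using assms field_differentiable_derivI by (auto simp: separately_holomorphic_def deriv_u_def)

text \<open>Differentiation under the integral sign in Cauchy's formula: the integral on the right is the
  Cauchy integral of \<open>deriv_v f\<close>, which is the source of the symmetry of mixed derivatives.\<close>

lemma deriv_u_has_deriv_v: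
  assumes "separately_holomorphic f U" "open U" "r > 0" "cball a r \<times> cball b r \<subseteq> U"
    and u: "u \<in> ball a r" and v: "v \<in> ball b r"
  shows "((\<lambda>t. deriv_u f (u, t)) has_field_derivative
     integral {0..1} (\<lambda>x. cauchy_ker a r u x * deriv_v f (circle_pt a r x, v))) (at v)"
proof -
  have inU: "(circle_pt a r x, t) \<in> U" if "t \<in> cball b r" for x t
    using assms(4) that circle_pt_dist[OF \<open>r > 0\<close>, of a x] by auto
  have ck: "continuous_on S (\<lambda>z. cauchy_ker a r u (h z))" if "continuous_on S h"
    for S :: "'a::topological_space set" and h
    by (rule continuous_on_compose2[OF continuous_cauchy_ker[OF \<open>r > 0\<close>, of a UNIV],
            where f="\<lambda>z. (u, h z)", unfolded case_prod_beta fst_conv snd_conv])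
       (use u in \<open>auto intro!: continuous_intros that\<close>)
  have cf: "continuous_on U f" using assms(1) by (auto simp: separately_holomorphic_def)
  have "((\<lambda>t. integral (cbox 0 1) (\<lambda>x. cauchy_ker a r u x * f (circle_pt a r x, t)))
     has_field_derivative integral (cbox 0 1) (\<lambda>x. cauchy_ker a r u x * deriv_v f (circle_pt a r x, v)))
       (at v within ball b r)"
  proof (rule leibniz_rule_field_derivative)
    show "((\<lambda>t. cauchy_ker a r u x * f (circle_pt a r x, t)) has_field_derivative
           cauchy_ker a r u x * deriv_v f (circle_pt a r x, t)) (at t within ball b r)"
      if "t \<in> ball b r" for t x
    proof -
      have "(circle_pt a r x, t) \<in> U" using that by (intro inU) auto
      from has_deriv_v[OF assms(1) this] show ?thesis
        by (intro DERIV_cmult) (rule has_field_derivative_at_within)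
    qed
    show "(\<lambda>x. cauchy_ker a r u x * f (circle_pt a r x, t)) integrable_on cbox 0 1"
      if "t \<in> ball b r" for t
      by (intro integrable_continuous continuous_intros ck continuous_on_compose2[OF cf])
         (use that inU in auto)
    show "continuous_on (ball b r \<times> cbox 0 1)
        (\<lambda>(t, x). cauchy_ker a r u x * deriv_v f (circle_pt a r x, t))"
      unfolding case_prod_beta
      by (intro continuous_intros ck continuous_on_compose2[OF continuous_deriv_v[OF assms(1,2)]])
         (use inU in auto)
  qed (use v in auto)
  then have "((\<lambda>t. integral {0..1} (\<lambda>x. cauchy_ker a r u x * f (circle_pt a r x, t)))
     has_field_derivative integral {0..1} (\<lambda>x. cauchy_ker a r u x * deriv_v f (circle_pt a r x, v)))
       (at v)"
    using v by (simp add: at_within_open[of v "ball b r"])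
  then show ?thesis
  proof (rule has_field_derivative_transform_within_open[where S="ball b r"])
    show "integral {0..1} (\<lambda>x. cauchy_ker a r u x * f (circle_pt a r x, t)) = deriv_u f (u, t)"
      if "t \<in> ball b r" for t
      using deriv_u_Cauchy[OF assms(1,3,4) u] that by simp
  qed (use v in auto)
qed

lemma separately_holomorphic_deriv_u:
  assumes "separately_holomorphic f U" "open U"
  shows "separately_holomorphic (deriv_u f) U"
  unfolding separately_holomorphic_def
proof (intro conjI allI impI)
  show "continuous_on U (deriv_u f)" by (rule continuous_deriv_u[OF assms])
next
  fix u v assume uv: "(u, v) \<in> U"
  obtain r where r: "r > 0" "cball u r \<times> cball v r \<subseteq> U"
    using cball_polydisc[of U u v] assms(2) uv by metis
  have "(\<lambda>t. f (t, v)) holomorphic_on ball u r"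
    unfolding holomorphic_on_def
  proof
    fix x assume "x \<in> ball u r"
    then have "(x, v) \<in> U" using r by auto
    then show "(\<lambda>t. f (t, v)) field_differentiable (at x within ball u r)"
      using assms(1) unfolding separately_holomorphic_def by (blast intro: field_differentiable_at_within)
  qed
  then have "deriv (\<lambda>t. f (t, v)) holomorphic_on ball u r" by (simp add: holomorphic_deriv)
  then show "(\<lambda>t. deriv_u f (t, v)) field_differentiable at u"
    using r by (simp add: deriv_u_def holomorphic_on_imp_differentiable_at)
  show "(\<lambda>t. deriv_u f (u, t)) field_differentiable at v"
    using deriv_u_has_deriv_v[OF assms r, of u v] r field_differentiable_def by auto
qed

lemma separately_holomorphic_deriv_v:
  assumes "separately_holomorphic f U" "open U"
  shows "separately_holomorphic (deriv_v f) U"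
  using separately_holomorphic_swap[OF separately_holomorphic_deriv_u
      [OF separately_holomorphic_swap[OF assms(1)] open_swap_image[OF assms(2)]]]
  by (simp add: deriv_v_swap image_image)

text \<open>Both sides are the same Cauchy integral of \<open>deriv_v f\<close>.\<close>

lemma mixed_derivs_commute:
  assumes "separately_holomorphic f U" "open U" "z \<in> U"
  shows "deriv_v (deriv_u f) z = deriv_u (deriv_v f) z"
proof -
  obtain u v where z: "z = (u, v)" by fastforce
  obtain r where r: "r > 0" "cball u r \<times> cball v r \<subseteq> U"
    using cball_polydisc[of U u v] assms z by metis
  have "deriv_v (deriv_u f) (u, v) = deriv (\<lambda>t. deriv_u f (u, t)) v" by (simp add: deriv_v_def)
  also have "\<dots> = integral {0..1} (\<lambda>x. cauchy_ker u r u x * deriv_v f (circle_pt u r x, v))"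
    using deriv_u_has_deriv_v[OF assms(1,2) r, of u v] r by (intro DERIV_imp_deriv) auto
  also have "\<dots> = deriv_u (deriv_v f) (u, v)"
    using deriv_u_Cauchy[OF separately_holomorphic_deriv_v[OF assms(1,2)] r, of u v] r by auto
  finally show ?thesis using z by simp
qed

text \<open>Differentials are recorded as covectors, so that wedge products and exterior derivatives become
  algebra with pairs of complex numbers.\<close>

definition has_d :: "(c2 \<Rightarrow> complex) \<Rightarrow> c2 \<Rightarrow> c2 \<Rightarrow> bool" where
  "has_d f w z \<longleftrightarrow> (f has_derivative (\<lambda>(h, k). fst w * h + snd w * k)) (at z)"

lemma holomorphic2_iff_has_d: "holomorphic2 f U \<longleftrightarrow> (\<forall>z\<in>U. \<exists>w. has_d f w z)"
  by (simp add: holomorphic2_def has_d_def)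

lemma has_d_slices:
  assumes "has_d f w (u, v)"
  shows "((\<lambda>t. f (t, v)) has_field_derivative fst w) (at u)"
    and "((\<lambda>t. f (u, t)) has_field_derivative snd w) (at v)"
proof -
  have *: "(f has_derivative (\<lambda>(h, k). fst w * h + snd w * k)) (at (t, s))" if "(t, s) = (u, v)" for t s
    using assms that by (simp add: has_d_def)
  have "((\<lambda>t. f (t, v)) has_derivative (\<lambda>h. (\<lambda>(h, k). fst w * h + snd w * k) (h, 0))) (at u)"
    by (rule has_derivative_compose[of "\<lambda>t. (t, v)" "\<lambda>h. (h, 0)" u UNIV f])
       (auto intro!: derivative_eq_intros *)
  then show "((\<lambda>t. f (t, v)) has_field_derivative fst w) (at u)"
    by (simp add: has_field_derivative_def)
  have "((\<lambda>t. f (u, t)) has_derivative (\<lambda>h. (\<lambda>(h, k). fst w * h + snd w * k) (0, h))) (at v)"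
    by (rule has_derivative_compose[of "\<lambda>t. (u, t)" "\<lambda>h. (0, h)" v UNIV f])
       (auto intro!: derivative_eq_intros *)
  then show "((\<lambda>t. f (u, t)) has_field_derivative snd w) (at v)"
    by (simp add: has_field_derivative_def)
qed

definition dd :: "(c2 \<Rightarrow> complex) \<Rightarrow> c2 \<Rightarrow> c2" where
  "dd f z = (deriv_u f z, deriv_v f z)"

lemma has_d_imp_dd: "has_d f w z \<Longrightarrow> dd f z = w"
  using has_d_slices[of f w "fst z" "snd z"]
  by (simp add: dd_def deriv_u_def deriv_v_def case_prod_beta DERIV_imp_deriv prod_eq_iff)

lemma holomorphic2_has_dd: "holomorphic2 f U \<Longrightarrow> z \<in> U \<Longrightarrow> has_d f (dd f z) z"
  using has_d_imp_dd by (metis holomorphic2_iff_has_d)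

lemma holomorphic2_imp_separately:
  assumes "holomorphic2 f U"
  shows "separately_holomorphic f U"
  unfolding separately_holomorphic_def
proof (intro conjI allI impI)
  have "continuous (at z) f" if "z \<in> U" for z
    using assms that has_derivative_continuous unfolding holomorphic2_def by blast
  then show "continuous_on U f" by (simp add: continuous_at_imp_continuous_on)
  fix u v assume "(u, v) \<in> U"
  then have "has_d f (dd f (u, v)) (u, v)" by (rule holomorphic2_has_dd[OF assms])
  from has_d_slices[OF this] show "(\<lambda>t. f (t, v)) field_differentiable at u"
    "(\<lambda>t. f (u, t)) field_differentiable at v" by (auto simp: field_differentiable_def)
qed

text \<open>Cauchy's formula makes the partial derivatives continuous, and functions with continuous partial
  derivatives are differentiable.\<close>

lemma separately_imp_holomorphic2:
  assumes "separately_holomorphic f U" "open U"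
  shows "holomorphic2 f U"
  unfolding holomorphic2_def
proof
  fix z assume "z \<in> U"
  obtain u v where z: "z = (u, v)" by fastforce
  obtain r where r: "r > 0" "cball u r \<times> cball v r \<subseteq> U"
    using cball_polydisc[of U u v] assms \<open>z \<in> U\<close> z by metis
  let ?X = "ball u r" and ?Y = "ball v r"
  have sub: "?X \<times> ?Y \<subseteq> U" using r(2) by auto
  have "((\<lambda>(x, y). f (x, y)) has_derivative
      (\<lambda>(tx, ty). (*) (deriv_u f (u, v)) tx + blinfun_apply (blinfun_mult_right (deriv_v f (u, v))) ty))
      (at (u, v) within ?X \<times> ?Y)"
  proof (rule has_derivative_partialsI)
    have "(u, v) \<in> U" using z \<open>z \<in> U\<close> by simp
    then show "((\<lambda>x. f (x, v)) has_derivative (*) (deriv_u f (u, v))) (at u within ?X)"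
      using has_deriv_u[OF assms(1)] has_field_derivative_at_within has_field_derivative_def by blast
    show "((\<lambda>y. f (x, y)) has_derivative blinfun_apply (blinfun_mult_right (deriv_v f (x, y))))
           (at y within ?Y)" if "x \<in> ?X" "y \<in> ?Y" for x y
    proof -
      have "(x, y) \<in> U" using sub that by blast
      then have "((\<lambda>y. f (x, y)) has_derivative (*) (deriv_v f (x, y))) (at y within ?Y)"
        using has_deriv_v[OF assms(1)] has_field_derivative_at_within has_field_derivative_def by blast
      moreover have "blinfun_apply (blinfun_mult_right (deriv_v f (x, y))) = (*) (deriv_v f (x, y))"
        by auto
      ultimately show ?thesis by simp
    qed
    have "continuous_on (?X \<times> ?Y) (deriv_v f)"
      using continuous_deriv_v[OF assms] sub continuous_on_subset by blast
    then have "continuous_on (?X \<times> ?Y) (\<lambda>z. blinfun_mult_right (deriv_v f z))"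
      by (rule bounded_linear.continuous_on[OF bounded_linear_blinfun_mult_right])
    then show "continuous (at (u, v) within ?X \<times> ?Y) (\<lambda>(x, y). blinfun_mult_right (deriv_v f (x, y)))"
      using r by (simp add: continuous_on_eq_continuous_within case_prod_beta')
  qed (use r in auto)
  then have "(f has_derivative (\<lambda>(h, k). deriv_u f (u, v) * h + deriv_v f (u, v) * k)) (at (u, v))"
    using r by (simp add: at_within_open[of "(u, v)" "?X \<times> ?Y"] open_Times)
  then show "\<exists>a b. (f has_derivative (\<lambda>(h, k). a * h + b * k)) (at z)" using z by blast
qed

lemma holomorphic2_iff_separately: "open U \<Longrightarrow> holomorphic2 f U \<longleftrightarrow> separately_holomorphic f U"
  using holomorphic2_imp_separately separately_imp_holomorphic2 by blast

lemma holomorphic2_deriv_u: "holomorphic2 f U \<Longrightarrow> open U \<Longrightarrow> holomorphic2 (deriv_u f) U"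
  by (simp add: holomorphic2_iff_separately separately_holomorphic_deriv_u)

lemma holomorphic2_deriv_v: "holomorphic2 f U \<Longrightarrow> open U \<Longrightarrow> holomorphic2 (deriv_v f) U"
  by (simp add: holomorphic2_iff_separately separately_holomorphic_deriv_v)

section \<open>Calculus of differential forms\<close>

lemma has_d_const: "has_d (\<lambda>z. c) (0, 0) z"
  by (simp add: has_d_def case_prod_beta')

lemma has_d_fst: "has_d fst (1, 0) z"
  unfolding has_d_def case_prod_beta' by (auto intro!: derivative_eq_intros)

lemma has_d_snd: "has_d snd (0, 1) z"
  unfolding has_d_def case_prod_beta' by (auto intro!: derivative_eq_intros)

lemma has_d_add:
  "has_d f a z \<Longrightarrow> has_d g b z \<Longrightarrow> has_d (\<lambda>z. f z + g z) (fst a + fst b, snd a + snd b) z"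
  unfolding has_d_def case_prod_beta'
  by (drule (1) has_derivative_add) (simp add: algebra_simps)

lemma has_d_diff:
  "has_d f a z \<Longrightarrow> has_d g b z \<Longrightarrow> has_d (\<lambda>z. f z - g z) (fst a - fst b, snd a - snd b) z"
  unfolding has_d_def case_prod_beta'
  by (drule (1) has_derivative_diff) (simp add: algebra_simps)

lemma has_d_uminus: "has_d f a z \<Longrightarrow> has_d (\<lambda>z. - f z) (- fst a, - snd a) z"
  using has_d_diff[OF has_d_const[of 0], of f a z] by simp

lemma has_d_mult:
  "has_d f a z \<Longrightarrow> has_d g b z \<Longrightarrow>
   has_d (\<lambda>z. f z * g z) (f z * fst b + g z * fst a, f z * snd b + g z * snd a) z"
  unfolding has_d_def case_prod_beta'
  by (drule (1) has_derivative_mult) (simp add: algebra_simps)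

lemma has_d_compose1:
  assumes "has_d f a z" "(G has_field_derivative G') (at (f z))"
  shows "has_d (\<lambda>z. G (f z)) (G' * fst a, G' * snd a) z"
proof -
  have "((\<lambda>z. G (f z)) has_derivative (\<lambda>x. G' * (fst a * fst x + snd a * snd x))) (at z)"
    using has_derivative_compose[of f _ z UNIV G] assms
    by (simp add: has_d_def has_field_derivative_def case_prod_beta')
  then show ?thesis by (simp add: has_d_def case_prod_beta' algebra_simps)
qed

lemma has_d_inverse:
  assumes "has_d f a z" "f z \<noteq> 0"
  shows "has_d (\<lambda>z. inverse (f z)) (- fst a / (f z)\<^sup>2, - snd a / (f z)\<^sup>2) z"
  using has_d_compose1[OF assms(1) DERIV_inverse[OF assms(2)]]
  by (simp add: divide_inverse power2_eq_square mult_ac)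

lemma has_d_divide:
  assumes "has_d f a z" "has_d g b z" "g z \<noteq> 0"
  shows "has_d (\<lambda>z. f z / g z) ((g z * fst a - f z * fst b) / (g z)\<^sup>2,
           (g z * snd a - f z * snd b) / (g z)\<^sup>2) z"
  using has_d_mult[OF assms(1) has_d_inverse[OF assms(2,3)]] assms(3)
  by (simp add: divide_inverse power2_eq_square algebra_simps)

lemma has_d_compose2:
  assumes "has_d f w (p z, q z)" "has_d p a z" "has_d q b z"
  shows "has_d (\<lambda>z. f (p z, q z)) (fst w * fst a + snd w * fst b, fst w * snd a + snd w * snd b) z"
proof -
  have "((\<lambda>z. (p z, q z)) has_derivative
     (\<lambda>x. (fst a * fst x + snd a * snd x, fst b * fst x + snd b * snd x))) (at z)"
    using assms(2,3) unfolding has_d_def case_prod_beta' by (rule has_derivative_Pair)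
  from has_derivative_compose[OF this, of f "\<lambda>x. fst w * fst x + snd w * snd x"] assms(1)
  show ?thesis
    by (simp add: has_d_def case_prod_beta' algebra_simps)
qed

lemma has_d_transform:
  assumes "has_d f w z" "open U" "z \<in> U" "\<And>x. x \<in> U \<Longrightarrow> f x = g x"
  shows "has_d g w z"
  using assms has_derivative_transform_within_open unfolding has_d_def by blast

lemma dd_cong:
  assumes "open U" "z \<in> U" "\<And>x. x \<in> U \<Longrightarrow> f x = g x"
  shows "dd f z = dd g z"
proof -
  obtain u v where z: "z = (u, v)" by fastforce
  have "((\<lambda>t. (t, v)) \<longlongrightarrow> (u, v)) (nhds u)" "((\<lambda>t. (u, t)) \<longlongrightarrow> (u, v)) (nhds v)"
    by (auto intro!: tendsto_intros filterlim_ident)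
  from topological_tendstoD[OF this(1)] topological_tendstoD[OF this(2)]
  have "\<forall>\<^sub>F t in nhds u. (t, v) \<in> U" "\<forall>\<^sub>F t in nhds v. (u, t) \<in> U" using assms z by auto
  then show ?thesis unfolding dd_def deriv_u_def deriv_v_def z
    by (auto intro!: deriv_cong_ev elim!: eventually_mono simp: assms(3))
qed

lemma ext_d_dd: "ext_d \<theta> z = snd (dd (\<lambda>z. fst (\<theta> z)) z) * (-1) + fst (dd (\<lambda>z. snd (\<theta> z)) z)"
  by (simp add: ext_d_def dd_def)

lemma ext_d_cong:
  assumes "open U" "z \<in> U" "\<And>x. x \<in> U \<Longrightarrow> \<theta> x = \<theta>' x"
  shows "ext_d \<theta> z = ext_d \<theta>' z"
  unfolding ext_d_dd
  using dd_cong[OF assms(1,2), of "\<lambda>z. fst (\<theta> z)" "\<lambda>z. fst (\<theta>' z)"]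
    dd_cong[OF assms(1,2), of "\<lambda>z. snd (\<theta> z)" "\<lambda>z. snd (\<theta>' z)"] assms(3) by simp

lemma ext_d_eqI:
  assumes "has_d (\<lambda>z. fst (\<theta> z)) a z" "has_d (\<lambda>z. snd (\<theta> z)) b z"
  shows "ext_d \<theta> z = fst b - snd a"
  using assms by (simp add: ext_d_dd has_d_imp_dd)

lemma holomorphic2_const: "holomorphic2 (\<lambda>z. c) U"
  using has_d_const holomorphic2_iff_has_d by blast
lemma holomorphic2_fst: "holomorphic2 fst U"
  using has_d_fst holomorphic2_iff_has_d by blast
lemma holomorphic2_snd: "holomorphic2 snd U"
  using has_d_snd holomorphic2_iff_has_d by blast
lemma holomorphic2_add:
  "holomorphic2 f U \<Longrightarrow> holomorphic2 g U \<Longrightarrow> holomorphic2 (\<lambda>z. f z + g z) U"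
  using has_d_add unfolding holomorphic2_iff_has_d by blast
lemma holomorphic2_diff:
  "holomorphic2 f U \<Longrightarrow> holomorphic2 g U \<Longrightarrow> holomorphic2 (\<lambda>z. f z - g z) U"
  using has_d_diff unfolding holomorphic2_iff_has_d by blast
lemma holomorphic2_mult:
  "holomorphic2 f U \<Longrightarrow> holomorphic2 g U \<Longrightarrow> holomorphic2 (\<lambda>z. f z * g z) U"
  using has_d_mult unfolding holomorphic2_iff_has_d by blast
lemma holomorphic2_divide:
  "holomorphic2 f U \<Longrightarrow> holomorphic2 g U \<Longrightarrow> (\<And>z. z \<in> U \<Longrightarrow> g z \<noteq> 0) \<Longrightarrow>
   holomorphic2 (\<lambda>z. f z / g z) U"
  using has_d_divide unfolding holomorphic2_iff_has_d by blast
lemma holomorphic2_uminus: "holomorphic2 f U \<Longrightarrow> holomorphic2 (\<lambda>z. - f z) U"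
  using holomorphic2_diff[OF holomorphic2_const[of 0]] by simp
lemma holomorphic2_sum:
  "(\<And>i. i \<in> I \<Longrightarrow> holomorphic2 (f i) U) \<Longrightarrow> holomorphic2 (\<lambda>z. \<Sum>i\<in>I. f i z) U"
  by (induction I rule: infinite_finite_induct) (auto intro: holomorphic2_const holomorphic2_add)
lemma holomorphic2_power: "holomorphic2 f U \<Longrightarrow> holomorphic2 (\<lambda>z. f z ^ n) U"
  by (induction n) (auto intro: holomorphic2_const holomorphic2_mult)

lemmas holomorphic2_intros = holomorphic2_const holomorphic2_fst holomorphic2_snd holomorphic2_add
  holomorphic2_diff holomorphic2_mult holomorphic2_divide holomorphic2_uminus holomorphic2_sum
  holomorphic2_power

lemma holomorphic2_subset: "holomorphic2 f U \<Longrightarrow> V \<subseteq> U \<Longrightarrow> holomorphic2 f V"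
  by (auto simp: holomorphic2_def)

lemma holomorphic2_compose1:
  assumes "holomorphic2 f U" "G holomorphic_on S" "open S" "\<And>z. z \<in> U \<Longrightarrow> f z \<in> S"
  shows "holomorphic2 (\<lambda>z. G (f z)) U"
  using has_d_compose1 holomorphic_derivI[OF assms(2,3)] assms(1,4)
  unfolding holomorphic2_iff_has_d by metis

lemma holomorphic2_compose2:
  assumes "holomorphic2 f S" "holomorphic2 p U" "holomorphic2 q U" "\<And>z. z \<in> U \<Longrightarrow> (p z, q z) \<in> S"
  shows "holomorphic2 (\<lambda>z. f (p z, q z)) U"
  unfolding holomorphic2_iff_has_d
proof
  fix z assume z: "z \<in> U"
  have "has_d f (dd f (p z, q z)) (p z, q z)"
    by (rule holomorphic2_has_dd[OF assms(1)]) (rule assms(4)[OF z])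
  from has_d_compose2[OF this holomorphic2_has_dd[OF assms(2) z] holomorphic2_has_dd[OF assms(3) z]]
  show "\<exists>w. has_d (\<lambda>z. f (p z, q z)) w z" by blast
qed

text \<open>This is the symmetry of mixed partial derivatives.\<close>

lemma dd_closed:
  assumes "holomorphic2 f U" "open U" "z \<in> U"
  shows "ext_d (dd f) z = 0"
  using mixed_derivs_commute[OF holomorphic2_imp_separately[OF assms(1)] assms(2,3)]
  by (simp add: ext_d_def dd_def)

definition holomorphic_form :: "(c2 \<Rightarrow> c2) \<Rightarrow> c2 set \<Rightarrow> bool" where
  "holomorphic_form \<theta> U \<longleftrightarrow> holomorphic2 (\<lambda>z. fst (\<theta> z)) U \<and> holomorphic2 (\<lambda>z. snd (\<theta> z)) U"

lemma holomorphic_form_dd: "holomorphic2 f U \<Longrightarrow> open U \<Longrightarrow> holomorphic_form (dd f) U"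
  by (simp add: holomorphic_form_def dd_def holomorphic2_deriv_u holomorphic2_deriv_v)

lemma holomorphic_form_cscale:
  "holomorphic2 f U \<Longrightarrow> holomorphic_form \<theta> U \<Longrightarrow> holomorphic_form (\<lambda>z. cscale (f z) (\<theta> z)) U"
  by (simp add: holomorphic_form_def cscale_def holomorphic2_mult)

lemma holomorphic_form_add:
  "holomorphic_form \<theta> U \<Longrightarrow> holomorphic_form \<theta>' U \<Longrightarrow> holomorphic_form (\<lambda>z. \<theta> z + \<theta>' z) U"
  by (simp add: holomorphic_form_def holomorphic2_add)

lemma holomorphic_form_diff:
  "holomorphic_form \<theta> U \<Longrightarrow> holomorphic_form \<theta>' U \<Longrightarrow> holomorphic_form (\<lambda>z. \<theta> z - \<theta>' z) U"
  by (simp add: holomorphic_form_def holomorphic2_diff)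

lemma holomorphic2_wedge:
  "holomorphic_form \<theta> U \<Longrightarrow> holomorphic_form \<theta>' U \<Longrightarrow> holomorphic2 (\<lambda>z. wedge (\<theta> z) (\<theta>' z)) U"
  by (simp add: holomorphic_form_def wedge_def holomorphic2_diff holomorphic2_mult)

lemma has_d_form:
  assumes "holomorphic_form \<theta> U" "z \<in> U"
  shows "has_d (\<lambda>z. fst (\<theta> z)) (dd (\<lambda>z. fst (\<theta> z)) z) z"
    and "has_d (\<lambda>z. snd (\<theta> z)) (dd (\<lambda>z. snd (\<theta> z)) z) z"
  using assms(1) holomorphic2_has_dd[OF _ assms(2)] unfolding holomorphic_form_def by blast+

lemma ext_d_cscale:
  assumes "holomorphic2 f U" "holomorphic_form \<theta> U" "z \<in> U"
  shows "ext_d (\<lambda>z. cscale (f z) (\<theta> z)) z = wedge (dd f z) (\<theta> z) + f z * ext_d \<theta> z"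
proof -
  have f: "has_d f (dd f z) z" using assms holomorphic2_has_dd by blast
  note d = has_d_mult[OF f has_d_form(1)[OF assms(2,3)]] has_d_mult[OF f has_d_form(2)[OF assms(2,3)]]
  have "ext_d (\<lambda>z. cscale (f z) (\<theta> z)) z =
    f z * fst (dd (\<lambda>z. snd (\<theta> z)) z) + snd (\<theta> z) * fst (dd f z)
    - (f z * snd (dd (\<lambda>z. fst (\<theta> z)) z) + fst (\<theta> z) * snd (dd f z))"
    using ext_d_eqI[of "\<lambda>z. cscale (f z) (\<theta> z)", unfolded cscale_def fst_conv snd_conv, OF d]
    by (simp add: cscale_def)
  then show ?thesis by (simp add: wedge_def ext_d_dd algebra_simps)
qed

lemma ext_d_add:
  assumes "holomorphic_form \<theta> U" "holomorphic_form \<theta>' U" "z \<in> U"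
  shows "ext_d (\<lambda>z. \<theta> z + \<theta>' z) z = ext_d \<theta> z + ext_d \<theta>' z"
proof -
  have "ext_d (\<lambda>z. \<theta> z + \<theta>' z) z =
    fst (dd (\<lambda>z. snd (\<theta> z)) z) + fst (dd (\<lambda>z. snd (\<theta>' z)) z)
    - (snd (dd (\<lambda>z. fst (\<theta> z)) z) + snd (dd (\<lambda>z. fst (\<theta>' z)) z))"
    using ext_d_eqI[of "\<lambda>z. \<theta> z + \<theta>' z", unfolded fst_add snd_add,
        OF has_d_add[OF has_d_form(1)[OF assms(1,3)] has_d_form(1)[OF assms(2,3)]]
           has_d_add[OF has_d_form(2)[OF assms(1,3)] has_d_form(2)[OF assms(2,3)]]] by simp
  then show ?thesis by (simp add: ext_d_dd)
qed

lemma ext_d_zero: "ext_d (\<lambda>z. 0) z = 0"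
  using ext_d_eqI[of "\<lambda>z. 0" "(0,0)" z "(0,0)"] has_d_const[of 0 z] by simp

lemma ext_d_sum:
  assumes "finite I" "\<And>i. i \<in> I \<Longrightarrow> holomorphic_form (\<theta> i) U" "z \<in> U"
  shows "ext_d (\<lambda>z. \<Sum>i\<in>I. \<theta> i z) z = (\<Sum>i\<in>I. ext_d (\<theta> i) z)
    \<and> holomorphic_form (\<lambda>z. \<Sum>i\<in>I. \<theta> i z) U"
  using assms(1,2)
proof (induction I rule: finite_induct)
  case empty
  show ?case by (simp add: ext_d_zero holomorphic_form_def holomorphic2_const)
next
  case (insert i I)
  then show ?case
    using ext_d_add[of "\<theta> i" U "\<lambda>z. \<Sum>i\<in>I. \<theta> i z", OF _ _ assms(3)]
      holomorphic_form_add[of "\<theta> i" U "\<lambda>z. \<Sum>i\<in>I. \<theta> i z"] by simp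
qed

text \<open>As \<open>1/f\<close> is a function of \<open>f\<close>, its differential is parallel to \<open>df\<close>.\<close>

lemma dlog_closed:
  assumes "holomorphic2 f U" "open U" "z \<in> U" "\<And>z. z \<in> U \<Longrightarrow> f z \<noteq> 0"
  shows "ext_d (\<lambda>z. cscale (1 / f z) (dd f z)) z = 0"
proof -
  have f: "has_d f (dd f z) z" using assms holomorphic2_has_dd by blast
  have "dd (\<lambda>z. 1 / f z) z = (- fst (dd f z) / (f z)\<^sup>2, - snd (dd f z) / (f z)\<^sup>2)"
    using has_d_imp_dd[OF has_d_inverse[OF f]] assms by (simp add: divide_inverse)
  moreover have "holomorphic2 (\<lambda>z. 1 / f z) U"
    using assms by (intro holomorphic2_intros) auto
  ultimately show ?thesis
    using ext_d_cscale[OF _ holomorphic_form_dd[OF assms(1,2)] assms(3), of "\<lambda>z. 1 / f z"]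
      dd_closed[OF assms(1-3)]
    by (simp add: wedge_def field_simps)
qed

lemma wedge_cscale: "wedge (cscale c a) b = c * wedge a b" "wedge a (cscale c b) = c * wedge a b"
  by (simp_all add: wedge_def cscale_def algebra_simps)

lemma dd_sum:
  assumes "finite I" "\<And>i. i \<in> I \<Longrightarrow> holomorphic2 (f i) U" "z \<in> U"
  shows "dd (\<lambda>z. \<Sum>i\<in>I. f i z) z = (\<Sum>i\<in>I. dd (f i) z)"
  using assms(1,2)
proof (induction I rule: finite_induct)
  case empty
  show ?case using has_d_imp_dd[OF has_d_const[of 0 z]] by (simp add: zero_prod_def)
next
  case (insert i I)
  have "has_d (\<lambda>z. f i z + (\<Sum>i\<in>I. f i z)) (fst (dd (f i) z) + fst (dd (\<lambda>z. \<Sum>i\<in>I. f i z) z),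
     snd (dd (f i) z) + snd (dd (\<lambda>z. \<Sum>i\<in>I. f i z) z)) z"
    by (rule has_d_add; rule holomorphic2_has_dd[OF _ assms(3)])
       (use insert in \<open>auto intro!: holomorphic2_sum\<close>)
  from has_d_imp_dd[OF this] show ?case using insert by (simp add: prod_eq_iff)
qed

text \<open>Two linearly independent covectors \<open>w\<close>, \<open>w'\<close> suffice to test equality. This is why the form \<open>\<eta>\<close> of
  three foliations is determined by its defining equations.\<close>

lemma covector_eqI:
  assumes "wedge w w' \<noteq> 0" "wedge e w = wedge e' w" "wedge e w' = wedge e' w'"
  shows "e = e'"
proof -
  obtain a b where w: "w = (a, b)" by fastforce
  obtain c d where w': "w' = (c, d)" by fastforce
  obtain x y where e: "e = (x, y)" by fastforce
  obtain x' y' where e': "e' = (x', y')" by fastforce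
  have D: "a * d - b * c \<noteq> 0" using assms(1) by (simp add: wedge_def w w')
  have 1: "x * b - y * a = x' * b - y' * a" using assms(2) by (simp add: wedge_def w w' e e')
  have 2: "x * d - y * c = x' * d - y' * c" using assms(3) by (simp add: wedge_def w w' e e')
  have "(x - x') * (a * d - b * c) = 0" using 1 2 by algebra
  moreover have "(y - y') * (a * d - b * c) = 0" using 1 2 by algebra
  ultimately show ?thesis using D e e' by simp
qed

section \<open>Curvature of webs with a transverse symmetry\<close>

text \<open>For three forms \<open>y\<^sub>i \<sigma> - dp\<close>, where \<open>\<sigma>\<close> is closed and \<open>dy\<^sub>i = d\<^sub>i dp\<close>, the equations that define \<open>\<eta>\<close> are
  linear in its coefficients with respect to \<open>dp\<close> and \<open>\<sigma>\<close>. Their solution is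
  \<open>\<eta> = eta_dp dp + eta_dq \<sigma>\<close>; the names refer to the case \<open>\<sigma> = dq/q\<close>.\<close>

definition eta_dp :: "complex \<Rightarrow> complex \<Rightarrow> complex \<Rightarrow> complex \<Rightarrow> complex \<Rightarrow> complex \<Rightarrow> complex" where
  "eta_dp y1 y2 y3 d1 d2 d3 =
     d1 * (y1 - y2 - y3) / ((y1 - y2) * (y1 - y3)) +
     d2 * (y2 - y3 - y1) / ((y2 - y3) * (y2 - y1)) +
     d3 * (y3 - y1 - y2) / ((y3 - y1) * (y3 - y2))"

definition eta_dq :: "complex \<Rightarrow> complex \<Rightarrow> complex \<Rightarrow> complex \<Rightarrow> complex \<Rightarrow> complex \<Rightarrow> complex" where
  "eta_dq y1 y2 y3 d1 d2 d3 =
     d1 * (y2 * y3) / ((y1 - y2) * (y1 - y3)) +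
     d2 * (y3 * y1) / ((y2 - y3) * (y2 - y1)) +
     d3 * (y1 * y2) / ((y3 - y1) * (y3 - y2))"

lemma eta_dp_cyclic: "eta_dp y2 y3 y1 d2 d3 d1 = eta_dp y1 y2 y3 d1 d2 d3"
  by (simp add: eta_dp_def)

lemma eta_dq_cyclic: "eta_dq y2 y3 y1 d2 d3 d1 = eta_dq y1 y2 y3 d1 d2 d3"
  by (simp add: eta_dq_def)

text \<open>One of the three equations for \<open>\<eta>\<close>. The other two arise by cyclic permutation, under which
  \<open>eta_dp\<close> and \<open>eta_dq\<close> are invariant. In the proof the contributions of \<open>d1\<close>, \<open>d2\<close> and \<open>d3\<close> are
  simplified separately.\<close>

lemma eta_identity:
  assumes "y1 \<noteq> y2" "y2 \<noteq> y3" "y3 \<noteq> y1"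
  shows "(y2 - y3) * (eta_dp y1 y2 y3 d1 d2 d3 * y1 + eta_dq y1 y2 y3 d1 d2 d3)
    = (d2 - d3) * y1 + (y2 - y3) * d1"
proof -
  define a b c where "a = y1 - y2" and "b = y2 - y3" and "c = y3 - y1"
  have nz: "a \<noteq> 0" "b \<noteq> 0" "c \<noteq> 0" using assms by (auto simp: a_def b_def c_def)
  have s: "y2 = y1 - a" "y3 = y1 + c" "b = - a - c" by (auto simp: a_def b_def c_def)
  have e: "y1 - y2 = a" "y1 - y3 = - c" "y2 - y3 = b" "y2 - y1 = - a" "y3 - y1 = c" "y3 - y2 = - b"
    by (auto simp: a_def b_def c_def)
  have 1: "d1 * (y1 - y2 - y3) / (a * - c) * y1 + d1 * (y2 * y3) / (a * - c) = d1"
  proof -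
    have "(y1 - y2 - y3) * y1 + y2 * y3 = a * - c" by (simp add: s algebra_simps)
    then have e: "d1 * (y1 - y2 - y3) * y1 + d1 * (y2 * y3) = d1 * (a * - c)"
      by (metis (no_types, lifting) distrib_left mult.assoc)
    have "d1 * (y1 - y2 - y3) / (a * - c) * y1 + d1 * (y2 * y3) / (a * - c) = (d1 * (y1 - y2 - y3) * y1 + d1 * (y2 * y3)) / (a * - c)"
      by (simp add: add_divide_distrib)
    also have "\<dots> = d1" unfolding e using nz by simp
    finally show ?thesis .
  qed
  have 2: "d2 * (y2 - y3 - y1) / (b * - a) * y1 + d2 * (y3 * y1) / (b * - a) = d2 * y1 / b"
  proof -
    have "(y2 - y3 - y1) * y1 + y3 * y1 = - a * y1" by (simp add: s algebra_simps)
    then have e: "d2 * (y2 - y3 - y1) * y1 + d2 * (y3 * y1) = d2 * (- a * y1)"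
      by (metis (no_types, lifting) distrib_left mult.assoc)
    have "d2 * (y2 - y3 - y1) / (b * - a) * y1 + d2 * (y3 * y1) / (b * - a) = (d2 * (y2 - y3 - y1) * y1 + d2 * (y3 * y1)) / (b * - a)"
      by (simp add: add_divide_distrib)
    also have "\<dots> = d2 * y1 / b" unfolding e using nz by simp
    finally show ?thesis .
  qed
  have 3: "d3 * (y3 - y1 - y2) / (c * - b) * y1 + d3 * (y1 * y2) / (c * - b) = - d3 * y1 / b"
  proof -
    have "(y3 - y1 - y2) * y1 + y1 * y2 = c * y1" by (simp add: s algebra_simps)
    then have e: "d3 * (y3 - y1 - y2) * y1 + d3 * (y1 * y2) = d3 * (c * y1)"
      by (metis (no_types, lifting) distrib_left mult.assoc)
    have "d3 * (y3 - y1 - y2) / (c * - b) * y1 + d3 * (y1 * y2) / (c * - b) = (d3 * (y3 - y1 - y2) * y1 + d3 * (y1 * y2)) / (c * - b)"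
      by (simp add: add_divide_distrib)
    also have "\<dots> = - d3 * y1 / b" unfolding e using nz by simp
    finally show ?thesis .
  qed
  have regroup: "(A1 + A2 + A3) * y1 + (B1 + B2 + B3) = (A1 * y1 + B1) + (A2 * y1 + B2) + (A3 * y1 + B3)"
    for A1 A2 A3 B1 B2 B3 by (simp add: algebra_simps)
  have "eta_dp y1 y2 y3 d1 d2 d3 * y1 + eta_dq y1 y2 y3 d1 d2 d3 = d1 + d2 * y1 / b - d3 * y1 / b"
    unfolding eta_dp_def eta_dq_def e regroup 1[unfolded e] 2[unfolded e] 3[unfolded e] by simp
  moreover have "b * (d1 + d2 * y1 / b - d3 * y1 / b) = (d2 - d3) * y1 + b * d1"
    using nz by (simp add: field_simps)
  ultimately show ?thesis unfolding e by simp
qed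

lemma basic_witness: "has_d f w z \<Longrightarrow> wedge w v = 0 \<Longrightarrow> \<exists>w. has_d f w z \<and> wedge w v = 0"
  by blast

text \<open>The forms \<open>\<theta>\<^sub>i = F\<^sub>i (y\<^sub>i dq/q - dp)\<close> define a web that is invariant under \<open>(p, q) \<mapsto> (p, \<lambda> q)\<close>. Here \<open>p\<close> and
  \<open>q\<close> are functions on \<open>U\<close> that need not be the ambient coordinates: curvature has to be computed in
  every affine chart of the dual plane, whereas the symmetry is visible only in \<open>(p, q)\<close>. Since \<open>J \<noteq> 0\<close>,
  they are local coordinates, and \<open>dy\<^sub>i \<and> dp = 0\<close> says that \<open>y\<^sub>i\<close> depends on \<open>p\<close> only.\<close>

locale invariant_web =
  fixes U :: "c2 set" and p q :: "c2 \<Rightarrow> complex" and k :: nat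
    and y F :: "nat \<Rightarrow> c2 \<Rightarrow> complex" and \<theta> :: "nat \<Rightarrow> c2 \<Rightarrow> c2"
    and \<sigma> :: "c2 \<Rightarrow> c2" and J :: "c2 \<Rightarrow> complex" and y' :: "nat \<Rightarrow> c2 \<Rightarrow> complex"
  assumes openU: "open U"
    and p: "holomorphic2 p U" and q: "holomorphic2 q U" and q_nz: "\<And>z. z \<in> U \<Longrightarrow> q z \<noteq> 0"
    and \<sigma>_def: "\<And>z. \<sigma> z = cscale (1 / q z) (dd q z)"
    and J_def: "\<And>z. J z = wedge (dd p z) (\<sigma> z)" and J_nz: "\<And>z. z \<in> U \<Longrightarrow> J z \<noteq> 0"
    and y: "\<And>i. i < k \<Longrightarrow> holomorphic2 (y i) U"
    and F: "\<And>i. i < k \<Longrightarrow> holomorphic2 (F i) U"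
    and F_nz: "\<And>i z. i < k \<Longrightarrow> z \<in> U \<Longrightarrow> F i z \<noteq> 0"
    and y_distinct: "\<And>i j z. i < k \<Longrightarrow> j < k \<Longrightarrow> i \<noteq> j \<Longrightarrow> z \<in> U \<Longrightarrow> y i z \<noteq> y j z"
    and y_basic: "\<And>i z. i < k \<Longrightarrow> z \<in> U \<Longrightarrow> wedge (dd (y i) z) (dd p z) = 0"
    and \<theta>: "\<And>i z. i < k \<Longrightarrow> z \<in> U \<Longrightarrow> \<theta> i z = cscale (F i z) (cscale (y i z) (\<sigma> z) - dd p z)"
    and y'_def: "\<And>i z. y' i z = wedge (dd (y i) z) (\<sigma> z) / J z"
begin

text \<open>Basic functions are those which locally depend on \<open>p\<close> only, the first integrals of \<open>dp\<close>.\<close>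

definition basic :: "(c2 \<Rightarrow> complex) \<Rightarrow> bool" where
  "basic f \<longleftrightarrow> holomorphic2 f U \<and> (\<forall>z\<in>U. wedge (dd f z) (dd p z) = 0)"

lemma basicI:
  assumes "\<And>z. z \<in> U \<Longrightarrow> \<exists>w. has_d f w z \<and> wedge w (dd p z) = 0"
  shows "basic f"
  unfolding basic_def holomorphic2_iff_has_d using assms has_d_imp_dd by metis

lemma basicD:
  assumes "basic f" "z \<in> U"
  shows "has_d f (dd f z) z" "wedge (dd f z) (dd p z) = 0"
  using assms holomorphic2_has_dd unfolding basic_def by blast+

lemma basic_add:
  assumes "basic f" "basic g" shows "basic (\<lambda>z. f z + g z)"
proof (rule basicI)
  fix z assume z: "z \<in> U"
  note f = basicD[OF assms(1) z] and g = basicD[OF assms(2) z]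
  show "\<exists>w. has_d (\<lambda>z. f z + g z) w z \<and> wedge w (dd p z) = 0"
    by (rule basic_witness[OF has_d_add[OF f(1) g(1)]])
       (use f(2) g(2) in \<open>simp add: wedge_def algebra_simps\<close>)
qed

lemma basic_diff:
  assumes "basic f" "basic g" shows "basic (\<lambda>z. f z - g z)"
proof (rule basicI)
  fix z assume z: "z \<in> U"
  note f = basicD[OF assms(1) z] and g = basicD[OF assms(2) z]
  show "\<exists>w. has_d (\<lambda>z. f z - g z) w z \<and> wedge w (dd p z) = 0"
    by (rule basic_witness[OF has_d_diff[OF f(1) g(1)]])
       (use f(2) g(2) in \<open>simp add: wedge_def algebra_simps\<close>)
qed

lemma basic_mult:
  assumes "basic f" "basic g" shows "basic (\<lambda>z. f z * g z)"
proof (rule basicI)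
  fix z assume z: "z \<in> U"
  note f = basicD[OF assms(1) z] and g = basicD[OF assms(2) z]
  have e: "f z * wedge (dd g z) (dd p z) + g z * wedge (dd f z) (dd p z) = 0" using f g by simp
  show "\<exists>w. has_d (\<lambda>z. f z * g z) w z \<and> wedge w (dd p z) = 0"
    by (rule basic_witness[OF has_d_mult[OF f(1) g(1)]])
       (use e in \<open>simp add: wedge_def algebra_simps\<close>)
qed

lemma basic_divide:
  assumes "basic f" "basic g" "\<And>z. z \<in> U \<Longrightarrow> g z \<noteq> 0" shows "basic (\<lambda>z. f z / g z)"
proof (rule basicI)
  fix z assume z: "z \<in> U"
  note f = basicD[OF assms(1) z] and g = basicD[OF assms(2) z]
  have e: "(g z * wedge (dd f z) (dd p z) - f z * wedge (dd g z) (dd p z)) / (g z)\<^sup>2 = 0"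
    using f g by simp
  show "\<exists>w. has_d (\<lambda>z. f z / g z) w z \<and> wedge w (dd p z) = 0"
    by (rule basic_witness[OF has_d_divide[OF f(1) g(1) assms(3)[OF z]]])
       (use e in \<open>simp add: wedge_def algebra_simps diff_divide_distrib add_divide_distrib\<close>)
qed

lemma \<sigma>_form: "holomorphic_form \<sigma> U"
  unfolding \<sigma>_def[abs_def]
  by (intro holomorphic_form_cscale holomorphic_form_dd q openU holomorphic2_intros q_nz)

lemma p_form: "holomorphic_form (dd p) U"
  by (intro holomorphic_form_dd p openU)

lemma \<sigma>_closed: "z \<in> U \<Longrightarrow> ext_d \<sigma> z = 0"
  unfolding \<sigma>_def[abs_def] using dlog_closed[OF q openU] q_nz by blast

lemma J: "holomorphic2 J U"
  unfolding J_def[abs_def] by (intro holomorphic2_wedge \<sigma>_form p_form)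

lemma y': "i < k \<Longrightarrow> holomorphic2 (y' i) U"
  unfolding y'_def[abs_def]
  by (intro holomorphic2_divide J J_nz holomorphic2_wedge \<sigma>_form holomorphic_form_dd y openU)

lemma dd_basic:
  assumes "wedge w (dd p z) = 0" "z \<in> U"
  shows "w = cscale (wedge w (\<sigma> z) / J z) (dd p z)"
proof (rule covector_eqI[of "dd p z" "\<sigma> z"])
  show "wedge (dd p z) (\<sigma> z) \<noteq> 0" using J_nz[OF assms(2)] by (simp add: J_def)
  then show "wedge w (\<sigma> z) = wedge (cscale (wedge w (\<sigma> z) / J z) (dd p z)) (\<sigma> z)"
    unfolding wedge_cscale J_def by simp
  show "wedge w (dd p z) = wedge (cscale (wedge w (\<sigma> z) / J z) (dd p z)) (dd p z)"
    using assms(1) unfolding wedge_cscale by (simp add: wedge_def)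
qed

lemma dd_y: "i < k \<Longrightarrow> z \<in> U \<Longrightarrow> dd (y i) z = cscale (y' i z) (dd p z)"
  unfolding y'_def using dd_basic y_basic by blast

lemma basic_y: "i < k \<Longrightarrow> basic (y i)"
  unfolding basic_def using y y_basic by blast

text \<open>Taking the exterior derivative of \<open>dy\<^sub>i = y\<^sub>i' dp\<close> shows that \<open>y\<^sub>i'\<close> is basic as well.\<close>

lemma basic_y':
  assumes "i < k" shows "basic (y' i)"
  unfolding basic_def
proof (intro conjI ballI)
  show "holomorphic2 (y' i) U" using y' assms .
  fix z assume z: "z \<in> U"
  have "0 = ext_d (dd (y i)) z" using dd_closed[OF y openU z] assms by simp
  also have "\<dots> = ext_d (\<lambda>z. cscale (y' i z) (dd p z)) z"
    by (rule ext_d_cong[OF openU z]) (use dd_y assms in auto)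
  also have "\<dots> = wedge (dd (y' i) z) (dd p z)"
    using ext_d_cscale[OF y'[OF assms] p_form z] dd_closed[OF p openU z] by simp
  finally show "wedge (dd (y' i) z) (dd p z) = 0" by simp
qed

definition \<alpha> :: "nat \<Rightarrow> nat \<Rightarrow> nat \<Rightarrow> c2 \<Rightarrow> complex" where
  "\<alpha> r s t z = eta_dp (y r z) (y s z) (y t z) (y' r z) (y' s z) (y' t z)"

definition \<beta> :: "nat \<Rightarrow> nat \<Rightarrow> nat \<Rightarrow> c2 \<Rightarrow> complex" where
  "\<beta> r s t z = eta_dq (y r z) (y s z) (y t z) (y' r z) (y' s z) (y' t z)"

definition G :: "nat \<Rightarrow> nat \<Rightarrow> nat \<Rightarrow> c2 \<Rightarrow> complex" where
  "G r s t z = F r z * F s z * F t z * J z"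

text \<open>The logarithmic differential accounts for the factors \<open>F\<close> of the three forms and for the factor \<open>J\<close>
  which compares \<open>dp \<and> \<sigma>\<close> with the ambient volume form; the other terms are those for the normalized
  forms \<open>y\<^sub>i \<sigma> - dp\<close>.\<close>

definition \<eta> :: "nat \<Rightarrow> nat \<Rightarrow> nat \<Rightarrow> c2 \<Rightarrow> c2" where
  "\<eta> r s t z = cscale (1 / G r s t z) (dd (G r s t) z) + cscale (\<alpha> r s t z) (dd p z)
     + cscale (\<beta> r s t z) (\<sigma> z)"

lemma \<eta>_cyclic: "\<eta> s t r = \<eta> r s t"
  by (simp add: \<eta>_def[abs_def] \<alpha>_def \<beta>_def eta_dp_cyclic eta_dq_cyclic G_def[abs_def] mult_ac)

lemma G: "r < k \<Longrightarrow> s < k \<Longrightarrow> t < k \<Longrightarrow> holomorphic2 (G r s t) U"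
  unfolding G_def[abs_def] by (intro holomorphic2_mult F J)

lemma G_nz: "r < k \<Longrightarrow> s < k \<Longrightarrow> t < k \<Longrightarrow> z \<in> U \<Longrightarrow> G r s t z \<noteq> 0"
  unfolding G_def using F_nz J_nz by simp

lemma wform_eq:
  assumes "r < k" "s < k" "t < k" "z \<in> U"
  shows "wform (\<theta> s) (\<theta> t) (\<theta> r) z =
    cscale (G r s t z * (y s z - y t z)) (cscale (y r z) (\<sigma> z) - dd p z)"
  using assms by (simp add: wform_def \<theta> cscale_def wedge_def G_def J_def algebra_simps)

lemma \<eta>_equation:
  assumes i: "r < k" "s < k" "t < k" and d: "r \<noteq> s" "s \<noteq> t" "t \<noteq> r" and z: "z \<in> U"
  shows "ext_d (wform (\<theta> s) (\<theta> t) (\<theta> r)) z = wedge (\<eta> r s t z) (wform (\<theta> s) (\<theta> t) (\<theta> r) z)"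
proof -
  let ?f = "\<lambda>z. G r s t z * (y s z - y t z)"
  let ?w = "\<lambda>z. cscale (y r z) (\<sigma> z) - dd p z"
  have f: "holomorphic2 ?f U" by (intro holomorphic2_intros G y i)
  have \<omega>1: "holomorphic_form (\<lambda>z. cscale (y r z) (\<sigma> z)) U"
    by (intro holomorphic_form_cscale y i \<sigma>_form)
  have w: "holomorphic_form ?w U" by (intro holomorphic_form_diff \<omega>1 p_form)
  have mp: "holomorphic_form (\<lambda>z. cscale (-1) (dd p z)) U"
    by (intro holomorphic_form_cscale p_form holomorphic2_const)
  have dmp: "ext_d (\<lambda>z. cscale (-1) (dd p z)) z = 0"
    using ext_d_cscale[OF holomorphic2_const p_form z] dd_closed[OF p openU z]
      has_d_imp_dd[OF has_d_const] by (simp add: wedge_def)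
  have "ext_d ?w z = ext_d (\<lambda>z. cscale (y r z) (\<sigma> z) + cscale (-1) (dd p z)) z"
    by (rule arg_cong[where f="\<lambda>w. ext_d w z"]) (simp add: fun_eq_iff cscale_def prod_eq_iff)
  also have "\<dots> = ext_d (\<lambda>z. cscale (y r z) (\<sigma> z)) z"
    using ext_d_add[OF \<omega>1 mp z] dmp by simp
  also have "\<dots> = wedge (dd (y r) z) (\<sigma> z)"
    using ext_d_cscale[OF y[OF i(1)] \<sigma>_form z] \<sigma>_closed[OF z] by simp
  also have "\<dots> = y' r z * J z" using J_nz[OF z] by (simp add: y'_def)
  finally have dw: "ext_d ?w z = y' r z * J z" .
  have hs: "has_d (y s) (cscale (y' s z) (dd p z)) z" if "s < k" for s
    using holomorphic2_has_dd[OF y[OF that] z] dd_y[OF that z] by simp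
  have "dd ?f z = cscale (y s z - y t z) (dd (G r s t) z)
      + cscale (G r s t z * (y' s z - y' t z)) (dd p z)"
    using has_d_imp_dd[OF has_d_mult[OF holomorphic2_has_dd[OF G[OF i] z] has_d_diff[OF hs[OF i(2)] hs[OF i(3)]]]]
    by (simp add: cscale_def prod_eq_iff algebra_simps)
  moreover have "ext_d (wform (\<theta> s) (\<theta> t) (\<theta> r)) z = ext_d (\<lambda>z. cscale (?f z) (?w z)) z"
    by (rule ext_d_cong[OF openU z]) (use wform_eq i in auto)
  moreover have "\<dots> = wedge (dd ?f z) (?w z) + ?f z * ext_d ?w z"
    by (rule ext_d_cscale[OF f w z])
  ultimately have L: "ext_d (wform (\<theta> s) (\<theta> t) (\<theta> r)) z =
     (y s z - y t z) * wedge (dd (G r s t) z) (?w z)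
     + G r s t z * J z * ((y' s z - y' t z) * y r z + (y s z - y t z) * y' r z)"
    unfolding dw by (simp add: wedge_def cscale_def J_def algebra_simps)
  \<comment> \<open>The choice of \<open>\<alpha>\<close> and \<open>\<beta>\<close> enters only here.\<close>
  have "(y s z - y t z) * (\<alpha> r s t z * y r z + \<beta> r s t z)
      = (y' s z - y' t z) * y r z + (y s z - y t z) * y' r z"
    unfolding \<alpha>_def \<beta>_def by (rule eta_identity) (use y_distinct i d z in auto)
  then have L': "ext_d (wform (\<theta> s) (\<theta> t) (\<theta> r)) z =
     (y s z - y t z) * wedge (dd (G r s t) z) (?w z)
     + G r s t z * J z * ((y s z - y t z) * (\<alpha> r s t z * y r z + \<beta> r s t z))"
    using L by simp
  have "wedge (cscale (1 / G r s t z) (dd (G r s t) z)) (cscale (?f z) (?w z))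
     = (y s z - y t z) * wedge (dd (G r s t) z) (?w z)"
    using G_nz[OF i z] by (simp add: wedge_def cscale_def field_simps)
  moreover have "wedge (cscale (\<alpha> r s t z) (dd p z) + cscale (\<beta> r s t z) (\<sigma> z)) (cscale (?f z) (?w z))
     = G r s t z * J z * ((y s z - y t z) * (\<alpha> r s t z * y r z + \<beta> r s t z))"
    by (simp add: wedge_def cscale_def J_def algebra_simps)
  moreover have "wedge (a + b) c = wedge a c + wedge b c" for a b c
    by (simp add: wedge_def algebra_simps)
  ultimately show ?thesis
    unfolding L' wform_eq[OF i z] \<eta>_def add.assoc by simp
qed

lemma web_eta_eq:
  assumes i: "r < k" "s < k" "t < k" and d: "r \<noteq> s" "s \<noteq> t" "t \<noteq> r" and z: "z \<in> U"
  shows "web_eta (\<theta> r) (\<theta> s) (\<theta> t) z = \<eta> r s t z"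
proof -
  note e1 = \<eta>_equation[OF i d z]
  note e2 = \<eta>_equation[OF i(2,3,1) d(2,3,1) z, unfolded \<eta>_cyclic[of s t r]]
  note e3 = \<eta>_equation[OF i(3,1,2) d(3,1,2) z, unfolded \<eta>_cyclic[of t r s] \<eta>_cyclic[of s t r]]
  have "wedge (wform (\<theta> s) (\<theta> t) (\<theta> r) z) (wform (\<theta> t) (\<theta> r) (\<theta> s) z)
    = G r s t z * (y s z - y t z) * (G s t r z * (y t z - y r z)) * ((y r z - y s z) * J z)"
    unfolding wform_eq[OF i z] wform_eq[OF i(2,3,1) z]
    by (simp add: wedge_def cscale_def J_def algebra_simps)
  \<comment> \<open>Two of the three normalized forms are independent, so the three equations determine \<open>\<eta>\<close>.\<close>
  then have ind: "wedge (wform (\<theta> s) (\<theta> t) (\<theta> r) z) (wform (\<theta> t) (\<theta> r) (\<theta> s) z) \<noteq> 0"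
    using G_nz[OF i z] G_nz[OF i(2,3,1) z] J_nz[OF z] y_distinct i d z by simp
  show ?thesis unfolding web_eta_def
  proof (rule the_equality)
    fix e assume "ext_d (wform (\<theta> s) (\<theta> t) (\<theta> r)) z = wedge e (wform (\<theta> s) (\<theta> t) (\<theta> r) z) \<and>
      ext_d (wform (\<theta> t) (\<theta> r) (\<theta> s)) z = wedge e (wform (\<theta> t) (\<theta> r) (\<theta> s) z) \<and>
      ext_d (wform (\<theta> r) (\<theta> s) (\<theta> t)) z = wedge e (wform (\<theta> r) (\<theta> s) (\<theta> t) z)"
    then show "e = \<eta> r s t z" using e1 e2 by (intro covector_eqI[OF ind]) auto
  qed (use e1 e2 e3 in auto)
qed

lemma basic_\<alpha>_\<beta>:
  assumes i: "r < k" "s < k" "t < k" and d: "r \<noteq> s" "s \<noteq> t" "t \<noteq> r"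
  shows "basic (\<alpha> r s t)" "basic (\<beta> r s t)"
  unfolding \<alpha>_def[abs_def] \<beta>_def[abs_def] eta_dp_def eta_dq_def
  by (intro basic_add basic_diff basic_mult basic_divide basic_y basic_y' i;
      use i d y_distinct in \<open>force simp del: split_paired_All\<close>)+

lemma ext_d_\<eta>:
  assumes i: "r < k" "s < k" "t < k" and d: "r \<noteq> s" "s \<noteq> t" "t \<noteq> r" and z: "z \<in> U"
  shows "ext_d (\<eta> r s t) z = wedge (dd (\<beta> r s t) z) (\<sigma> z)" "holomorphic_form (\<eta> r s t) U"
proof -
  note ab = basic_\<alpha>_\<beta>[OF i d]
  have a: "holomorphic2 (\<alpha> r s t) U" and b: "holomorphic2 (\<beta> r s t) U"
    using ab by (auto simp: basic_def)
  let ?A = "\<lambda>z. cscale (1 / G r s t z) (dd (G r s t) z)"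
  let ?B = "\<lambda>z. cscale (\<alpha> r s t z) (dd p z)"
  let ?C = "\<lambda>z. cscale (\<beta> r s t z) (\<sigma> z)"
  have A: "holomorphic_form ?A U"
    by (intro holomorphic_form_cscale holomorphic_form_dd G i openU holomorphic2_intros G_nz)
  have B: "holomorphic_form ?B U" by (intro holomorphic_form_cscale a p_form)
  have C: "holomorphic_form ?C U" by (intro holomorphic_form_cscale b \<sigma>_form)
  have "ext_d ?A z = 0" by (rule dlog_closed[OF G[OF i] openU z G_nz[OF i]])
  moreover have "ext_d ?B z = 0"
    using ext_d_cscale[OF a p_form z] dd_closed[OF p openU z] basicD(2)[OF ab(1) z] by simp
  moreover have "ext_d ?C z = wedge (dd (\<beta> r s t) z) (\<sigma> z)"
    using ext_d_cscale[OF b \<sigma>_form z] \<sigma>_closed[OF z] by simp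
  moreover have "\<eta> r s t = (\<lambda>z. (?A z + ?B z) + ?C z)" by (simp add: \<eta>_def[abs_def])
  ultimately show "ext_d (\<eta> r s t) z = wedge (dd (\<beta> r s t) z) (\<sigma> z)"
    using ext_d_add[OF holomorphic_form_add[OF A B] C z] ext_d_add[OF A B z] by simp
  show "holomorphic_form (\<eta> r s t) U"
    unfolding \<eta>_def[abs_def] by (intro holomorphic_form_add A B C)
qed

definition triples :: "(nat \<times> nat \<times> nat) set" where
  "triples = {(r, s, t). r < s \<and> s < t \<and> t < k}"

lemma finite_triples: "finite triples"
  by (rule finite_subset[of _ "{..<k} \<times> {..<k} \<times> {..<k}"]) (auto simp: triples_def)

text \<open>In \<open>\<eta> = dlog G + \<alpha> dp + \<beta> \<sigma>\<close> the first term is closed, the second one is closed because \<open>\<alpha>\<close> is basic,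
  and \<open>\<sigma>\<close> is closed, which leaves \<open>d\<beta> \<and> \<sigma>\<close>.\<close>

theorem curvature_eq:
  assumes z: "z \<in> U"
  shows "curvature k \<theta> z = wedge (dd (\<lambda>z. \<Sum>(r, s, t)\<in>triples. \<beta> r s t z) z) (\<sigma> z)"
proof -
  have tr: "fst x < k \<and> fst (snd x) < k \<and> snd (snd x) < k \<and> fst x \<noteq> fst (snd x)
      \<and> fst (snd x) \<noteq> snd (snd x) \<and> snd (snd x) \<noteq> fst x" if "x \<in> triples" for x
    using that by (auto simp: triples_def)
  let ?e = "\<lambda>x. \<eta> (fst x) (fst (snd x)) (snd (snd x))"
  let ?b = "\<lambda>x. \<beta> (fst x) (fst (snd x)) (snd (snd x))"
  have "curvature k \<theta> z = ext_d (\<lambda>z. \<Sum>x\<in>triples. ?e x z) z"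
    unfolding curvature_def triples_def[symmetric]
    by (rule ext_d_cong[OF openU z]) (auto intro!: sum.cong web_eta_eq simp: triples_def)
  also have "\<dots> = (\<Sum>x\<in>triples. ext_d (?e x) z)"
    using ext_d_sum[OF finite_triples _ z, of ?e] ext_d_\<eta>(2)[OF _ _ _ _ _ _ z] tr by blast
  also have "\<dots> = (\<Sum>x\<in>triples. wedge (dd (?b x) z) (\<sigma> z))"
    by (intro sum.cong ext_d_\<eta>(1) z refl) (use tr in auto)
  also have "\<dots> = wedge (\<Sum>x\<in>triples. dd (?b x) z) (\<sigma> z)"
    by (simp add: wedge_def fst_sum snd_sum sum_distrib_right sum_subtractf)
  also have "(\<Sum>x\<in>triples. dd (?b x) z) = dd (\<lambda>z. \<Sum>x\<in>triples. ?b x z) z"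
    by (rule dd_sum[symmetric, OF finite_triples _ z])
       (use tr basic_\<alpha>_\<beta>(2) in \<open>auto simp: basic_def\<close>)
  finally show ?thesis by (simp add: case_prod_beta)
qed

end

section \<open>Sums over the roots of a trinomial\<close>

text \<open>Each unordered triple has six orderings, which the symmetry of \<open>H\<close> in its last two arguments
  identifies in pairs. The curvature is a sum over unordered triples, but the inner sums can only be
  evaluated when the indices range independently.\<close>

lemma sum_ordered_triples:
  fixes H :: "nat \<Rightarrow> nat \<Rightarrow> nat \<Rightarrow> complex"
  assumes sym: "\<And>r s t. H r s t = H r t s"
  shows "2 * (\<Sum>(r, s, t) \<in> {(r, s, t). r < s \<and> s < t \<and> t < k}. H r s t + H s t r + H t r s)
    = (\<Sum>r<k. \<Sum>s\<in>{..<k} - {r}. \<Sum>t\<in>{..<k} - {r, s}. H r s t)"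
proof -
  let ?T = "{(r, s, t). r < s \<and> s < t \<and> t < k}"
  let ?h = "\<lambda>(r, s, t). H r s t"
  let ?D = "{(r, s, t). r < k \<and> s < k \<and> t < k \<and> r \<noteq> s \<and> r \<noteq> t \<and> s \<noteq> t}"
  have fin: "finite {(r, s, t). r < k \<and> s < k \<and> t < k \<and> P r s t}" for P
    by (rule finite_subset[of _ "{..<k} \<times> {..<k} \<times> {..<k}"]) auto
  have part: "sum ?h {(r, s, t). r < k \<and> s < k \<and> t < k \<and> r \<noteq> s \<and> r \<noteq> t \<and> s \<noteq> t \<and> P r s t \<and> Q r s t}
     + sum ?h {(r, s, t). r < k \<and> s < k \<and> t < k \<and> r \<noteq> s \<and> r \<noteq> t \<and> s \<noteq> t \<and> P r s t \<and> \<not> Q r s t}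
     = sum ?h {(r, s, t). r < k \<and> s < k \<and> t < k \<and> r \<noteq> s \<and> r \<noteq> t \<and> s \<noteq> t \<and> P r s t}" for P Q
    by (subst sum.union_disjoint[symmetric])
       (auto intro!: finite_subset[OF _ fin[of "\<lambda>r s t. True"]] arg_cong[where f="sum ?h"])
  define A where "A = (\<lambda>P. {(r, s, t). r < k \<and> s < k \<and> t < k \<and> r \<noteq> s \<and> r \<noteq> t \<and> s \<noteq> t \<and> P r s t})"
  have split: "sum ?h (A P) = sum ?h (A (\<lambda>r s t. P r s t \<and> Q r s t))
      + sum ?h (A (\<lambda>r s t. P r s t \<and> \<not> Q r s t))" for P Q
    unfolding A_def using part[of P Q] by simp
  \<comment> \<open>The decision tree that sorts three distinct numbers, with one leaf for each ordering.\<close>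
  have six: "sum ?h (A (\<lambda>r s t. True)) =
      sum ?h (A (\<lambda>r s t. (True \<and> r < s) \<and> s < t)) +
      (sum ?h (A (\<lambda>r s t. ((True \<and> r < s) \<and> \<not> s < t) \<and> r < t)) +
      sum ?h (A (\<lambda>r s t. ((True \<and> r < s) \<and> \<not> s < t) \<and> \<not> r < t))) +
      (sum ?h (A (\<lambda>r s t. ((True \<and> \<not> r < s) \<and> s < t) \<and> r < t)) +
      sum ?h (A (\<lambda>r s t. ((True \<and> \<not> r < s) \<and> s < t) \<and> \<not> r < t)) +
      sum ?h (A (\<lambda>r s t. (True \<and> \<not> r < s) \<and> \<not> s < t)))"
    unfolding split[of "\<lambda>r s t. True" "\<lambda>r s t. r < s"]
      split[of "\<lambda>r s t. True \<and> r < s" "\<lambda>r s t. s < t"]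
      split[of "\<lambda>r s t. True \<and> \<not> r < s" "\<lambda>r s t. s < t"]
      split[of "\<lambda>r s t. (True \<and> r < s) \<and> \<not> s < t" "\<lambda>r s t. r < t"]
      split[of "\<lambda>r s t. (True \<and> \<not> r < s) \<and> s < t" "\<lambda>r s t. r < t"]
    by (simp only: add.assoc)
  have a1: "sum ?h (A (\<lambda>r s t. (True \<and> r < s) \<and> s < t)) = (\<Sum>(r, s, t)\<in>?T. H r s t)"
    by (rule sum.reindex_bij_witness[where i="\<lambda>(r,s,t). (r,s,t)" and j="\<lambda>(r,s,t). (r,s,t)"])
       (auto simp: A_def)
  have a2: "sum ?h (A (\<lambda>r s t. ((True \<and> r < s) \<and> \<not> s < t) \<and> r < t)) = (\<Sum>(r, s, t)\<in>?T. H r t s)"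
    by (rule sum.reindex_bij_witness[where i="\<lambda>(r,s,t). (r,t,s)" and j="\<lambda>(r,t,s). (r,s,t)"])
       (auto simp: A_def)
  have a3: "sum ?h (A (\<lambda>r s t. ((True \<and> r < s) \<and> \<not> s < t) \<and> \<not> r < t)) = (\<Sum>(r, s, t)\<in>?T. H s t r)"
    by (rule sum.reindex_bij_witness[where i="\<lambda>(r,s,t). (s,t,r)" and j="\<lambda>(s,t,r). (r,s,t)"])
       (auto simp: A_def)
  have a4: "sum ?h (A (\<lambda>r s t. ((True \<and> \<not> r < s) \<and> s < t) \<and> r < t)) = (\<Sum>(r, s, t)\<in>?T. H s r t)"
    by (rule sum.reindex_bij_witness[where i="\<lambda>(r,s,t). (s,r,t)" and j="\<lambda>(s,r,t). (r,s,t)"])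
       (auto simp: A_def)
  have a5: "sum ?h (A (\<lambda>r s t. ((True \<and> \<not> r < s) \<and> s < t) \<and> \<not> r < t)) = (\<Sum>(r, s, t)\<in>?T. H t r s)"
    by (rule sum.reindex_bij_witness[where i="\<lambda>(r,s,t). (t,r,s)" and j="\<lambda>(t,r,s). (r,s,t)"])
       (auto simp: A_def)
  have a6: "sum ?h (A (\<lambda>r s t. (True \<and> \<not> r < s) \<and> \<not> s < t)) = (\<Sum>(r, s, t)\<in>?T. H t s r)"
    by (rule sum.reindex_bij_witness[where i="\<lambda>(r,s,t). (t,s,r)" and j="\<lambda>(t,s,r). (r,s,t)"])
       (auto simp: A_def)
  have "(\<Sum>r<k. \<Sum>s\<in>{..<k} - {r}. \<Sum>t\<in>{..<k} - {r, s}. H r s t)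
    = sum ?h (Sigma {..<k} (\<lambda>r. Sigma ({..<k} - {r}) (\<lambda>s. {..<k} - {r, s})))"
    by (simp add: sum.Sigma)
  also have "Sigma {..<k} (\<lambda>r. Sigma ({..<k} - {r}) (\<lambda>s. {..<k} - {r, s})) = A (\<lambda>r s t. True)"
    by (auto simp: A_def)
  finally have "(\<Sum>r<k. \<Sum>s\<in>{..<k} - {r}. \<Sum>t\<in>{..<k} - {r, s}. H r s t)
    = (\<Sum>(r, s, t)\<in>?T. H r s t) + ((\<Sum>(r, s, t)\<in>?T. H r t s) + (\<Sum>(r, s, t)\<in>?T. H s t r))
     + ((\<Sum>(r, s, t)\<in>?T. H s r t) + (\<Sum>(r, s, t)\<in>?T. H t r s) + (\<Sum>(r, s, t)\<in>?T. H t s r))"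
    unfolding six a1 a2 a3 a4 a5 a6 .
  also have "\<dots> = (\<Sum>(r, s, t)\<in>?T. H r s t + H r t s + H s t r + H s r t + H t r s + H t s r)"
    by (simp add: sum.distrib[symmetric] case_prod_beta' add_ac)
  also have "\<dots> = (\<Sum>(r, s, t)\<in>?T. 2 * (H r s t + H s t r + H t r s))"
  proof (rule sum.cong[OF refl], clarify)
    fix r s t
    show "H r s t + H r t s + H s t r + H s r t + H t r s + H t s r = 2 * (H r s t + H s t r + H t r s)"
      using sym[of r t s] sym[of s r t] sym[of t s r] by simp
  qed
  finally show ?thesis by (simp add: sum_distrib_left case_prod_beta')
qed

text \<open>The sum of the \<open>1/(x - a\<^sub>i)\<close> is \<open>Q'/Q\<close>, and the derivative of \<open>Q'/Q\<close> yields the sum of squares. So sums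
  of this kind over the roots of a polynomial are known without knowing the roots.\<close>

lemma log_derivatives_prod:
  fixes a :: "'a \<Rightarrow> complex"
  assumes "finite I" "\<And>i. i \<in> I \<Longrightarrow> x \<noteq> a i"
  defines "Q \<equiv> \<Prod>i\<in>I. [:- a i, 1:]"
  shows "poly (pderiv Q) x = poly Q x * (\<Sum>i\<in>I. 1 / (x - a i))"
    and "poly (pderiv (pderiv Q)) x =
      poly Q x * ((\<Sum>i\<in>I. 1 / (x - a i))\<^sup>2 - (\<Sum>i\<in>I. 1 / (x - a i)\<^sup>2))"
proof -
  have "poly (pderiv (\<Prod>i\<in>I. [:- a i, 1:])) x = poly (\<Prod>i\<in>I. [:- a i, 1:]) x * (\<Sum>i\<in>I. 1 / (x - a i)) \<and>
    poly (pderiv (pderiv (\<Prod>i\<in>I. [:- a i, 1:]))) x = poly (\<Prod>i\<in>I. [:- a i, 1:]) x *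
      ((\<Sum>i\<in>I. 1 / (x - a i))\<^sup>2 - (\<Sum>i\<in>I. 1 / (x - a i)\<^sup>2))"
    using assms(1,2)
  proof (induction I rule: finite_induct)
    case empty
    show ?case by (simp add: pderiv_1)
  next
    case (insert i I)
    define R where "R = (\<Prod>i\<in>I. [:- a i, 1:])"
    define e where "e = (\<Sum>i\<in>I. 1 / (x - a i))"
    define e' where "e' = (\<Sum>i\<in>I. 1 / (x - a i)\<^sup>2)"
    have IH: "poly (pderiv R) x = poly R x * e" "poly (pderiv (pderiv R)) x = poly R x * (e\<^sup>2 - e')"
      using insert unfolding R_def e_def e'_def by auto
    have nz: "x - a i \<noteq> 0" using insert by auto
    have P: "(\<Prod>i\<in>insert i I. [:- a i, 1:]) = [:- a i, 1:] * R" using insert by (simp add: R_def)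
    have d1: "pderiv ([:- a i, 1:] * R) = R + [:- a i, 1:] * pderiv R"
      by (simp only: pderiv_mult) (simp add: pderiv_pCons)
    have d2: "pderiv (pderiv ([:- a i, 1:] * R)) = 2 * pderiv R + [:- a i, 1:] * pderiv (pderiv R)"
      unfolding d1 by (simp only: pderiv_mult pderiv_add) (simp add: pderiv_pCons)
    have s: "(\<Sum>i\<in>insert i I. 1 / (x - a i)) = 1 / (x - a i) + e"
      "(\<Sum>i\<in>insert i I. 1 / (x - a i)\<^sup>2) = 1 / (x - a i)\<^sup>2 + e'"
      using insert by (auto simp: e_def e'_def)
    have "poly (pderiv ([:- a i, 1:] * R)) x = poly ([:- a i, 1:] * R) x * (1 / (x - a i) + e)"
      unfolding d1 using IH nz by (simp add: field_simps)
    moreover have "poly (pderiv (pderiv ([:- a i, 1:] * R))) x =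
       poly ([:- a i, 1:] * R) x * ((1 / (x - a i) + e)\<^sup>2 - (1 / (x - a i)\<^sup>2 + e'))"
    proof -
      define w where "w = x - a i"
      have "poly (pderiv (pderiv ([:- a i, 1:] * R))) x = 2 * (poly R x * e) + w * (poly R x * (e\<^sup>2 - e'))"
        unfolding d2 poly_add poly_mult IH by (simp add: w_def)
      also have "\<dots> = (w * poly R x) * ((1 / w + e)\<^sup>2 - (1 / w\<^sup>2 + e'))"
        using nz by (simp add: w_def[symmetric] field_simps power2_eq_square)
      finally show ?thesis by (simp add: w_def algebra_simps)
    qed
    ultimately show ?case unfolding P s by blast
  qed
  then show "poly (pderiv Q) x = poly Q x * (\<Sum>i\<in>I. 1 / (x - a i))"
    "poly (pderiv (pderiv Q)) x =
      poly Q x * ((\<Sum>i\<in>I. 1 / (x - a i))\<^sup>2 - (\<Sum>i\<in>I. 1 / (x - a i)\<^sup>2))"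
    by (auto simp: Q_def)
qed

lemma poly_eq_prod_roots:
  fixes f :: "complex poly"
  assumes "degree f \<le> d" "inj_on t {..<d}" "\<And>i. i < d \<Longrightarrow> poly f (t i) = 0"
  shows "f = smult (coeff f d) (\<Prod>i<d. [:- t i, 1:])"
proof (rule ccontr)
  let ?Q = "\<Prod>i<d. [:- t i, 1:]"
  let ?h = "f - smult (coeff f d) ?Q"
  assume "f \<noteq> smult (coeff f d) ?Q"
  then have h: "?h \<noteq> 0" by simp
  have dQ: "degree ?Q = d" by (subst degree_prod_eq_sum_degree) auto
  have "lead_coeff ?Q = 1" by (simp add: lead_coeff_prod)
  then have cQ: "coeff ?Q d = 1" by (simp add: dQ)
  have "degree ?h < d \<or> d = 0"
  proof -
    have "degree ?h \<le> d" using assms(1) dQ by (intro degree_diff_le) auto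
    moreover have "coeff ?h d = 0" by (simp add: cQ)
    ultimately show ?thesis
      using h by (metis leading_coeff_0_iff le_neq_implies_less)
  qed
  moreover have "d \<noteq> 0"
  proof
    assume "d = 0"
    then have "degree f = 0" using assms(1) by simp
    then show False using h \<open>d = 0\<close> by (auto elim: degree_eq_zeroE)
  qed
  ultimately have "degree ?h < d" by simp
  moreover have "t ` {..<d} \<subseteq> {x. poly ?h x = 0}"
    using assms(3) by (auto simp: poly_prod)
  then have "card (t ` {..<d}) \<le> degree ?h"
    using card_mono[OF poly_roots_finite[OF h]] card_poly_roots_bound[OF h] by (meson le_trans)
  ultimately show False using card_image[OF assms(2)] by simp
qed

lemma sum_roots_prod:
  fixes t :: "nat \<Rightarrow> complex"
  shows "coeff (\<Prod>i<Suc m. [:- t i, 1:]) m = - (\<Sum>i<Suc m. t i)"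
proof (induction m)
  case (Suc m)
  let ?Q = "\<lambda>m. \<Prod>i<m. [:- t i, 1:]"
  have "degree (?Q (Suc m)) = Suc m" by (subst degree_prod_eq_sum_degree) auto
  moreover have "lead_coeff (?Q (Suc m)) = 1" by (simp only: lead_coeff_prod) simp
  ultimately have "coeff (?Q (Suc m)) (Suc m) = 1" by simp
  moreover have "?Q (Suc (Suc m)) = ?Q (Suc m) * [:- t (Suc m), 1:]" by (simp only: prod.lessThan_Suc)
  ultimately show ?case using Suc by (simp del: prod.lessThan_Suc add: mult.commute[of _ "[:- t (Suc m), 1:]"])
qed simp

text \<open>The directions \<open>t = y/x\<close> along which the leaves of the normal form have slope \<open>p\<close> are the roots of this
  polynomial for \<open>g = p + \<rho>\<close>. Its linear part is \<open>g\<close> times the tangent line of \<open>t\<^bsup>d\<^esup>\<close> at \<open>t = 1\<close>, which makes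
  \<open>t = 1\<close> a critical direction.\<close>

definition trinomial :: "nat \<Rightarrow> complex \<Rightarrow> complex \<Rightarrow> complex poly" where
  "trinomial d c g = monom c d + [:- (g * of_nat (d - 1)), g * of_nat d:]"

lemma poly_trinomial: "poly (trinomial d c g) x = c * x ^ d + g * (of_nat d * x - of_nat (d - 1))"
  by (simp add: trinomial_def poly_monom algebra_simps)

locale trinomial_roots =
  fixes d :: nat and c g :: complex and t :: "nat \<Rightarrow> complex"
  assumes d: "d \<ge> 3" and c: "c \<noteq> 0" and inj: "inj_on t {..<d}"
    and root: "\<And>i. i < d \<Longrightarrow> c * t i ^ d + g * (of_nat d * t i - of_nat (d - 1)) = 0"
begin

definition D :: complex where "D = of_nat d"
definition n :: complex where "n = of_nat (d - 1)"

lemma Dn: "D = n + 1" "n \<noteq> 0" "D \<noteq> 0" "of_nat (d - 2) = n - 1"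
  using d by (auto simp: D_def n_def of_nat_diff)

lemma trinomial_eq_prod: "trinomial d c g = smult c (\<Prod>i<d. [:- t i, 1:])"
proof -
  have "coeff (trinomial d c g) d = c"
    using d by (cases d; cases "d - 1") (auto simp: trinomial_def coeff_pCons split: nat.splits)
  moreover have "degree (trinomial d c g) \<le> d"
    unfolding trinomial_def using d
    by (intro degree_add_le) (auto simp: degree_monom_le intro: order_trans)
  ultimately show ?thesis
    using poly_eq_prod_roots[OF _ inj, of "trinomial d c g"] root by (simp add: poly_trinomial)
qed

lemma prod_eq: "c * (\<Prod>i<d. x - t i) = c * x ^ d + g * (D * x - n)"
  using arg_cong[OF trinomial_eq_prod, of "\<lambda>f. poly f x"]
  by (simp add: poly_trinomial poly_prod D_def n_def)

lemma g_nz: "g \<noteq> 0"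
proof
  assume g: "g = 0"
  have "t 0 = 0" "t 1 = 0" using root[of 0] root[of 1] c d g by auto
  then show False using inj_onD[OF inj, of 0 1] d by simp
qed

lemma t_nz:
  assumes "i < d" shows "t i \<noteq> 0"
proof
  assume "t i = 0"
  then show False using root[OF assms] d g_nz by (simp add: power_0_left)
qed

text \<open>The trinomial with the root \<open>t\<^sub>r\<close> removed. Its logarithmic derivatives at \<open>t\<^sub>r\<close> are the sums over
  the remaining roots, and by \<open>pderivs\<close> its derivatives at \<open>t\<^sub>r\<close> are those of the trinomial, one order
  higher.\<close>

definition Qr :: "nat \<Rightarrow> complex poly" where "Qr r = smult c (\<Prod>i\<in>{..<d} - {r}. [:- t i, 1:])"

lemma factor: "r < d \<Longrightarrow> trinomial d c g = [:- t r, 1:] * Qr r"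
  unfolding trinomial_eq_prod Qr_def by (subst prod.remove[of _ r]) (auto simp: mult_smult_right)

lemma Qr_nz: "r < d \<Longrightarrow> poly (Qr r) (t r) \<noteq> 0"
  using c inj_onD[OF inj, of r] by (auto simp: Qr_def poly_prod)

lemma pderivs:
  assumes "r < d"
  shows "poly (pderiv (trinomial d c g)) (t r) = poly (Qr r) (t r)"
    and "poly (pderiv (pderiv (trinomial d c g))) (t r) = 2 * poly (pderiv (Qr r)) (t r)"
    and "poly (pderiv (pderiv (pderiv (trinomial d c g)))) (t r) = 3 * poly (pderiv (pderiv (Qr r))) (t r)"
proof -
  let ?l = "[:- t r, 1:]"
  have l: "pderiv ?l = 1" by (simp add: pderiv_pCons)
  have 1: "pderiv (?l * Qr r) = Qr r + ?l * pderiv (Qr r)"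
    by (simp only: pderiv_mult l) simp
  have 2: "pderiv (pderiv (?l * Qr r)) = 2 * pderiv (Qr r) + ?l * pderiv (pderiv (Qr r))"
    unfolding 1 by (simp only: pderiv_mult pderiv_add l) simp
  have two: "pderiv (2 * f) = 2 * pderiv f" for f :: "complex poly"
    by (metis mult_2 pderiv_add)
  have 3: "pderiv (pderiv (pderiv (?l * Qr r))) = 3 * pderiv (pderiv (Qr r)) + ?l * pderiv (pderiv (pderiv (Qr r)))"
    unfolding 2 by (simp only: pderiv_mult pderiv_add two l) simp
  show "poly (pderiv (trinomial d c g)) (t r) = poly (Qr r) (t r)"
    "poly (pderiv (pderiv (trinomial d c g))) (t r) = 2 * poly (pderiv (Qr r)) (t r)"
    "poly (pderiv (pderiv (pderiv (trinomial d c g)))) (t r) = 3 * poly (pderiv (pderiv (Qr r))) (t r)"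
    unfolding factor[OF assms] 3 unfolding 2 unfolding 1 by simp_all
qed

lemma pderiv_trinomial:
  shows "poly (pderiv (trinomial d c g)) x = D * c * x ^ (d - 1) + g * D"
    and "poly (pderiv (pderiv (trinomial d c g))) x = D * n * c * x ^ (d - 2)"
    and "poly (pderiv (pderiv (pderiv (trinomial d c g)))) x = D * n * (n - 1) * c * x ^ (d - 3)"
proof -
  have e: "d - 1 - 1 = d - 2" "d - 2 - 1 = d - 3" by auto
  have 1: "pderiv (trinomial d c g) = monom (D * c) (d - 1) + [:g * D:]"
    by (simp add: trinomial_def pderiv_add pderiv_monom pderiv_pCons D_def)
  have 2: "pderiv (pderiv (trinomial d c g)) = monom (n * (D * c)) (d - 2)"
    unfolding 1 n_def by (simp only: pderiv_add pderiv_monom e) (simp add: pderiv_pCons)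
  have 3: "pderiv (pderiv (pderiv (trinomial d c g))) = monom ((n - 1) * (n * (D * c))) (d - 3)"
    unfolding 2 by (simp add: pderiv_monom Dn(4) e)
  show "poly (pderiv (trinomial d c g)) x = D * c * x ^ (d - 1) + g * D"
   "poly (pderiv (pderiv (trinomial d c g))) x = D * n * c * x ^ (d - 2)"
   "poly (pderiv (pderiv (pderiv (trinomial d c g)))) x = D * n * (n - 1) * c * x ^ (d - 3)"
    unfolding 3 unfolding 2 unfolding 1 by (simp_all add: poly_monom)
qed

lemma powers: "x ^ d = x * x ^ (d - 1)" "x ^ d = x\<^sup>2 * x ^ (d - 2)" "x ^ d = x ^ 3 * x ^ (d - 3)"
  for x :: complex
proof -
  obtain m where "d = m + 3" using d by (metis add.commute le_iff_add)
  then show "x ^ d = x * x ^ (d - 1)" "x ^ d = x\<^sup>2 * x ^ (d - 2)" "x ^ d = x ^ 3 * x ^ (d - 3)"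
    by (simp_all add: power_add power2_eq_square power3_eq_cube)
qed

definition L :: "nat \<Rightarrow> complex" where "L r = D * t r - n"

lemma root': "r < d \<Longrightarrow> c * t r ^ d = - g * L r"
  using root[of r] by (simp add: L_def D_def n_def add_eq_0_iff algebra_simps)

text \<open>Multiplied by suitable powers of the root, the derivatives contain the power \<open>t\<^sub>r\<^bsup>d\<^esup>\<close>, which the equation of
  the root replaces by the linear expression \<open>L\<close>. Their quotients are therefore rational functions of
  small degree in \<open>t\<^sub>r\<close>.\<close>

lemma derivs_at_root:
  assumes "r < d"
  shows "t r * poly (pderiv (trinomial d c g)) (t r) = - D * n * g * (t r - 1)"
    and "(t r)\<^sup>2 * poly (pderiv (pderiv (trinomial d c g))) (t r) = - D * n * g * L r"
    and "t r ^ 3 * poly (pderiv (pderiv (pderiv (trinomial d c g)))) (t r) = - D * n * (n - 1) * g * L r"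
proof -
  have "t r * poly (pderiv (trinomial d c g)) (t r) = D * (c * t r ^ d) + g * D * t r"
    unfolding pderiv_trinomial using powers(1)[of "t r"] by (simp add: algebra_simps)
  also have "\<dots> = - D * n * g * (t r - 1)"
    unfolding root'[OF assms] L_def Dn(1) by (simp add: algebra_simps)
  finally show "t r * poly (pderiv (trinomial d c g)) (t r) = - D * n * g * (t r - 1)" .
  have "(t r)\<^sup>2 * poly (pderiv (pderiv (trinomial d c g))) (t r) = D * n * (c * t r ^ d)"
    unfolding pderiv_trinomial powers(2)[of "t r"] by (simp add: algebra_simps)
  then show "(t r)\<^sup>2 * poly (pderiv (pderiv (trinomial d c g))) (t r) = - D * n * g * L r"
    unfolding root'[OF assms] by simp
  have "t r ^ 3 * poly (pderiv (pderiv (pderiv (trinomial d c g)))) (t r) = D * n * (n - 1) * (c * t r ^ d)"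
    unfolding pderiv_trinomial powers(3)[of "t r"] by (simp add: algebra_simps)
  then show "t r ^ 3 * poly (pderiv (pderiv (pderiv (trinomial d c g)))) (t r) = - D * n * (n - 1) * g * L r"
    unfolding root'[OF assms] by simp
qed

lemma t_ne1: "r < d \<Longrightarrow> t r \<noteq> 1"
  using derivs_at_root(1)[of r] pderivs(1)[of r] Qr_nz[of r] t_nz[of r] by auto

lemma cg_nz: "c + g \<noteq> 0"
proof -
  have "c * (\<Prod>i<d. 1 - t i) = c + g" unfolding prod_eq[of 1] by (simp add: Dn(1))
  then show ?thesis using c t_ne1 by (metis (no_types, lifting) eq_iff_diff_eq_0 finite_lessThan
      lessThan_iff mult_eq_0_iff prod_zero_iff)
qed

text \<open>Half the quotient of the second by the first derivative of the trinomial at its root \<open>t\<^sub>r\<close>, and a third of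
  the quotient of the third by the first derivative.\<close>

lemma others:
  assumes r: "r < d"
  shows "(\<Sum>i\<in>{..<d} - {r}. 1 / (t r - t i)) = L r / (2 * t r * (t r - 1))"
    and "(\<Sum>i\<in>{..<d} - {r}. 1 / (t r - t i))\<^sup>2 - (\<Sum>i\<in>{..<d} - {r}. 1 / (t r - t i)\<^sup>2)
      = (n - 1) * L r / (3 * (t r)\<^sup>2 * (t r - 1))"
proof -
  let ?I = "{..<d} - {r}"
  have ne: "t r \<noteq> t i" if "i \<in> ?I" for i using inj_onD[OF inj, of r i] r that by auto
  define e where "e = (\<Sum>i\<in>?I. 1 / (t r - t i))"
  define e' where "e' = e\<^sup>2 - (\<Sum>i\<in>?I. 1 / (t r - t i)\<^sup>2)"
  define f where "f = trinomial d c g"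
  note ld = log_derivatives_prod[of ?I "t r" t, OF _ ne]
  have q1: "poly (pderiv (Qr r)) (t r) = poly (Qr r) (t r) * e"
    using ld(1) by (simp add: Qr_def pderiv_smult e_def)
  have q2: "poly (pderiv (pderiv (Qr r))) (t r) = poly (Qr r) (t r) * e'"
    using ld(2) by (simp add: Qr_def pderiv_smult e_def e'_def)
  note p = pderivs[OF r, folded f_def, unfolded q1 q2]
  note v = derivs_at_root[OF r, folded f_def]
  have nz: "t r \<noteq> 0" "t r - 1 \<noteq> 0" using t_nz[OF r] t_ne1[OF r] by auto
  define k where "k = D * n * g"
  have k: "k \<noteq> 0" using Dn g_nz by (simp add: k_def)
  have v1: "t r * poly (Qr r) (t r) = - k * (t r - 1)" using v(1) p(1) by (simp add: k_def)
  have "(t r)\<^sup>2 * (2 * (poly (Qr r) (t r) * e)) = - k * L r" using v(2) p(2) by (simp add: k_def)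
  then have "(t r * poly (Qr r) (t r)) * (t r * 2 * e) = - k * L r"
    by (simp add: power2_eq_square mult_ac)
  then have "- k * ((t r - 1) * (t r * 2 * e)) = - k * L r" unfolding v1 by (simp add: mult_ac)
  then have "(t r - 1) * (t r * 2 * e) = L r" using k by simp
  then show "(\<Sum>i\<in>?I. 1 / (t r - t i)) = L r / (2 * t r * (t r - 1))"
    using nz by (simp add: e_def[symmetric] field_simps)
  have "t r ^ 3 * (3 * (poly (Qr r) (t r) * e')) = - k * ((n - 1) * L r)"
    using v(3) p(3) by (simp add: k_def)
  then have "(t r * poly (Qr r) (t r)) * ((t r)\<^sup>2 * 3 * e') = - k * ((n - 1) * L r)"
    by (simp add: power2_eq_square power3_eq_cube mult_ac)
  then have "- k * ((t r - 1) * ((t r)\<^sup>2 * 3 * e')) = - k * ((n - 1) * L r)"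
    unfolding v1 by (simp add: mult_ac)
  then have "(t r - 1) * ((t r)\<^sup>2 * 3 * e') = (n - 1) * L r" using k by simp
  then have "e' = (n - 1) * L r / (3 * (t r)\<^sup>2 * (t r - 1))" using nz by (simp add: field_simps)
  then show "(\<Sum>i\<in>?I. 1 / (t r - t i))\<^sup>2 - (\<Sum>i\<in>?I. 1 / (t r - t i)\<^sup>2)
      = (n - 1) * L r / (3 * (t r)\<^sup>2 * (t r - 1))" by (simp add: e'_def e_def)
qed

lemma log_derivatives_at:
  assumes "\<And>i. i < d \<Longrightarrow> x \<noteq> t i"
  shows "poly (pderiv (trinomial d c g)) x = poly (trinomial d c g) x * (\<Sum>i<d. 1 / (x - t i))"
    and "poly (pderiv (pderiv (trinomial d c g))) x = poly (trinomial d c g) x *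
      ((\<Sum>i<d. 1 / (x - t i))\<^sup>2 - (\<Sum>i<d. 1 / (x - t i)\<^sup>2))"
  using log_derivatives_prod[of "{..<d}" x t] assms
  unfolding trinomial_eq_prod by (simp_all add: pderiv_smult)

text \<open>Logarithmic derivatives of the trinomial at \<open>0\<close>, where it agrees with its linear part to second
  order because \<open>d \<ge> 3\<close>.\<close>

lemma power_sums_0:
  shows "(\<Sum>i<d. 1 / t i) = D / n" and "(\<Sum>i<d. 1 / (t i)\<^sup>2) = (D / n)\<^sup>2"
proof -
  note ld = log_derivatives_at[of 0]
  have d0: "(0::complex) ^ (d - 1) = 0" "(0::complex) ^ (d - 2) = 0" "(0::complex) ^ d = 0"
    using d by auto
  have m: "(\<Sum>i<d. 1 / (0 - t i)) = - (\<Sum>i<d. 1 / t i)" by (simp add: sum_negf)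
  have s: "(\<Sum>i<d. 1 / (0 - t i)\<^sup>2) = (\<Sum>i<d. 1 / (t i)\<^sup>2)" by simp
  have v: "poly (trinomial d c g) 0 = - (g * n)"
    by (simp add: poly_trinomial d0 n_def)
  have "g * D = (- (g * n)) * (- (\<Sum>i<d. 1 / t i))"
    using ld(1) t_nz unfolding pderiv_trinomial d0 v m by simp
  from this[symmetric] have "g * (n * (\<Sum>i<d. 1 / t i)) = g * D"
    by (simp only: minus_mult_minus mult.assoc)
  then have "n * (\<Sum>i<d. 1 / t i) = D" using g_nz by (metis mult_left_cancel)
  then show 1: "(\<Sum>i<d. 1 / t i) = D / n" using Dn(2) by (simp add: field_simps)
  have "0 = (- (g * n)) * ((- (\<Sum>i<d. 1 / t i))\<^sup>2 - (\<Sum>i<d. 1 / (t i)\<^sup>2))"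
    using ld(2) t_nz unfolding pderiv_trinomial d0 v m s by simp
  then show "(\<Sum>i<d. 1 / (t i)\<^sup>2) = (D / n)\<^sup>2" using g_nz Dn unfolding 1 by simp
qed

text \<open>Logarithmic derivatives of the trinomial at \<open>1\<close>. The value there is \<open>c + g\<close> and the first derivative
  is \<open>d (c + g)\<close>; the second one is not divisible by \<open>c + g\<close>, and this is what creates the pole of the
  curvature at the critical value \<open>p = - \<rho> - c\<close>.\<close>

lemma power_sums_1:
  shows "(\<Sum>i<d. 1 / (t i - 1)) = - D"
    and "(\<Sum>i<d. 1 / (t i - 1)\<^sup>2) = D\<^sup>2 - D * n * (c / (c + g))"
proof -
  have ne: "1 \<noteq> t i" if "i < d" for i using t_ne1[OF that] by auto
  note ld = log_derivatives_at[of 1, OF ne]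
  have v: "poly (trinomial d c g) 1 = c + g"
    using Dn(1) by (simp add: poly_trinomial D_def n_def)
  have "D * (c + g) = (c + g) * (\<Sum>i<d. 1 / (1 - t i))"
    using ld(1) unfolding pderiv_trinomial v by (simp add: algebra_simps)
  then have 1: "(\<Sum>i<d. 1 / (1 - t i)) = D" using cg_nz by simp
  have "1 / (t i - 1) = - (1 / (1 - t i))" for i by (metis minus_diff_eq minus_divide_right)
  then show "(\<Sum>i<d. 1 / (t i - 1)) = - D" using 1 by (simp add: sum_negf)
  have "D * n * c = (c + g) * (D\<^sup>2 - (\<Sum>i<d. 1 / (1 - t i)\<^sup>2))"
    using ld(2) unfolding pderiv_trinomial v 1 by simp
  then have "(\<Sum>i<d. 1 / (1 - t i)\<^sup>2) = D\<^sup>2 - D * n * (c / (c + g))"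
    using cg_nz by (simp add: field_simps)
  then show "(\<Sum>i<d. 1 / (t i - 1)\<^sup>2) = D\<^sup>2 - D * n * (c / (c + g))"
    by (simp add: power2_commute)
qed

text \<open>The coefficient of \<open>T\<^bsup>d-1\<^esup>\<close> in the trinomial vanishes because \<open>d \<ge> 3\<close>.\<close>

lemma sum_roots: "(\<Sum>i<d. t i) = 0"
proof -
  obtain m where m: "d = Suc m" using d by (cases d) auto
  have "coeff (trinomial d c g) m = 0"
    using d m by (cases m; cases "m - 1") (auto simp: trinomial_def coeff_pCons split: nat.splits)
  then have "coeff (\<Prod>i<d. [:- t i, 1:]) m = 0" using c by (simp add: trinomial_eq_prod)
  moreover have "(\<Sum>i<d. t i) = - coeff (\<Prod>i<d. [:- t i, 1:]) m"
    unfolding m using sum_roots_prod[of t m] by (simp only: minus_minus)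
  ultimately show ?thesis by simp
qed

text \<open>The derivative of \<open>p - t\<^sub>r(p)\<close> with respect to \<open>p\<close>, obtained by differentiating the equation of the root
  implicitly with \<open>g = p + \<rho>\<close>.\<close>

definition slope :: "nat \<Rightarrow> complex" where "slope r = 1 - t r * L r / (D * n * g * (t r - 1))"

text \<open>For fixed \<open>r\<close> the summand is a product \<open>x\<^sub>s x\<^sub>u\<close>, so that the double sum over distinct indices is
  \<open>(\<Sum>x)\<^sup>2 - \<Sum>x\<^sup>2\<close>; as \<open>x\<^sub>s\<close> is affine in \<open>1/(t\<^sub>r - t\<^sub>s)\<close>, this is given by the sums of \<open>others\<close>.\<close>

lemma inner_sum:
  assumes r: "r < d"
  shows "(\<Sum>s\<in>{..<d} - {r}. \<Sum>u\<in>{..<d} - {r, s}.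
      slope r * ((p - t s) * (p - t u)) / (((p - t r) - (p - t s)) * ((p - t r) - (p - t u))))
    = slope r * (n * (n - 1) + (n - 1) * (p - t r) * L r / (t r * (t r - 1))
        + (p - t r)\<^sup>2 * ((n - 1) * L r / (3 * (t r)\<^sup>2 * (t r - 1))))"
proof -
  let ?I = "{..<d} - {r}"
  define y where "y = p - t r"
  define x where "x = (\<lambda>s. - 1 - y * (1 / (t r - t s)))"
  have ne: "t r - t i \<noteq> 0" if "i \<in> ?I" for i using inj_onD[OF inj, of r i] r that by auto
  have x: "(p - t s) / ((p - t r) - (p - t s)) = x s" if "s \<in> ?I" for s
  proof -
    have A: "(p - t r) - (p - t s) = - (t r - t s)" and B: "p - t s = y + (t r - t s)"
      by (auto simp: y_def)
    have "(p - t s) / ((p - t r) - (p - t s)) = - ((y + (t r - t s)) / (t r - t s))"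
      unfolding A unfolding B by (rule minus_divide_right[symmetric])
    also have "\<dots> = x s" using ne[OF that] by (simp add: x_def add_divide_distrib)
    finally show ?thesis .
  qed
  define e where "e = (\<Sum>s\<in>?I. 1 / (t r - t s))"
  define e2 where "e2 = (\<Sum>s\<in>?I. 1 / (t r - t s)\<^sup>2)"
  have card: "of_nat (card ?I) = n" using r by (simp add: n_def)
  have "(\<Sum>s\<in>?I. \<Sum>u\<in>{..<d} - {r, s}.
      slope r * ((p - t s) * (p - t u)) / (((p - t r) - (p - t s)) * ((p - t r) - (p - t u))))
    = (\<Sum>s\<in>?I. \<Sum>u\<in>?I - {s}. slope r * (x s * x u))"
  proof (intro sum.cong)
    fix s u assume su: "s \<in> ?I" "u \<in> ?I - {s}"
    show "slope r * ((p - t s) * (p - t u)) / (((p - t r) - (p - t s)) * ((p - t r) - (p - t u)))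
       = slope r * (x s * x u)"
      using x[of s] x[of u] su by (metis DiffD1 times_divide_eq_right times_divide_times_eq)
  qed auto
  also have "\<dots> = (\<Sum>s\<in>?I. slope r * (x s * (sum x ?I - x s)))"
    by (intro sum.cong refl) (simp add: sum_distrib_left[symmetric] sum_diff1)
  also have "\<dots> = slope r * ((sum x ?I)\<^sup>2 - (\<Sum>s\<in>?I. (x s)\<^sup>2))"
    by (simp add: sum_distrib_left[symmetric] right_diff_distrib sum_subtractf power2_eq_square
        sum_distrib_right)
  also have "sum x ?I = - n - y * e"
    using card by (simp add: x_def sum_subtractf e_def sum_distrib_left)
  also have "(\<Sum>s\<in>?I. (x s)\<^sup>2) = n + 2 * y * e + y\<^sup>2 * e2"
  proof -
    have "(x s)\<^sup>2 = 1 + (2 * y * (1 / (t r - t s)) + y\<^sup>2 * (1 / (t r - t s)\<^sup>2))" for s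
      by (simp add: x_def power2_eq_square algebra_simps)
    then have "(\<Sum>s\<in>?I. (x s)\<^sup>2) = of_nat (card ?I) + (2 * y * e + y\<^sup>2 * e2)"
      by (simp only: sum.distrib sum_distrib_left[symmetric] e_def[symmetric] e2_def[symmetric]) simp
    then show ?thesis by (simp only: card add.assoc)
  qed
  also have "(- n - y * e)\<^sup>2 - (n + 2 * y * e + y\<^sup>2 * e2)
     = n * (n - 1) + (n - 1) * y * (2 * e) + y\<^sup>2 * (e\<^sup>2 - e2)"
    by (simp add: power2_eq_square algebra_simps)
  also have "e\<^sup>2 - e2 = (n - 1) * L r / (3 * (t r)\<^sup>2 * (t r - 1))"
    using others(2)[OF r] by (simp add: e_def e2_def)
  also have "(n - 1) * y * (2 * e) = (n - 1) * y * L r / (t r * (t r - 1))"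
    using others(1)[OF r] by (simp add: e_def)
  finally show ?thesis by (simp add: y_def)
qed

definition \<kappa> :: complex where "\<kappa> = 1 / (D * n * g)"

text \<open>Up to the factor \<open>(n - 1)/3\<close>, these are coefficients in the partial fraction expansion of the
  expression of \<open>inner_sum\<close> as a function of \<open>t\<^sub>r\<close>, whose poles are at \<open>0\<close>, \<open>1\<close> and \<open>\<infinity>\<close>.\<close>

definition pf0 :: "complex \<Rightarrow> complex" where
  "pf0 p = (3 * n - 2 * D) * (1 - \<kappa>) - \<kappa> * D * (n * p + p - 2)"
definition pf1 :: complex where "pf1 = \<kappa> * D * (3 * n - 2 * D)"
definition pf2 :: "complex \<Rightarrow> complex" where
  "pf2 p = (1 - \<kappa>) * (n * p - p\<^sup>2) - \<kappa> * D * p\<^sup>2 * n + \<kappa> * p\<^sup>2 * n + \<kappa> * (n * p - p\<^sup>2)"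
definition pf3 :: "complex \<Rightarrow> complex" where
  "pf3 p = (1 - \<kappa> - \<kappa> * D) * (p\<^sup>2 + p - 2) - \<kappa> * ((3 * n - 2 * D) + p\<^sup>2 * n + n * p - p\<^sup>2)"

lemma partial_fractions:
  assumes r: "r < d"
  shows "slope r * (n * (n - 1) + (n - 1) * (p - t r) * L r / (t r * (t r - 1))
        + (p - t r)\<^sup>2 * ((n - 1) * L r / (3 * (t r)\<^sup>2 * (t r - 1))))
    = (n - 1) / 3 * (pf0 p - pf1 * t r
       + pf2 p * (1 / t r)
       + p\<^sup>2 * n * (1 / (t r)\<^sup>2)
       + pf3 p * (1 / (t r - 1))
       - \<kappa> * (p\<^sup>2 + p - 2) * (1 / (t r - 1)\<^sup>2))"
proof -
  \<comment> \<open>With \<open>u = 1/T\<close> and \<open>w = 1/(T - 1)\<close>, the relations \<open>T u = 1\<close>, \<open>T w = 1 + w\<close> and \<open>u w = w - u\<close>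
     turn the expansion into polynomial algebra.\<close>
  define T u w where "T = t r" and "u = 1 / t r" and "w = 1 / (t r - 1)"
  have nz: "T \<noteq> 0" "T - 1 \<noteq> 0" using t_nz[OF r] t_ne1[OF r] by (auto simp: T_def)
  have Tu: "T * u = 1" and Tw: "T * w = 1 + w" using nz by (auto simp: T_def u_def w_def field_simps)
  have uw: "u * w = w - u" using nz by (simp add: T_def u_def w_def field_simps)
  have u2: "1 / (t r)\<^sup>2 = u\<^sup>2" and w2: "1 / (t r - 1)\<^sup>2 = w\<^sup>2" by (auto simp: u_def w_def power_divide)
  have Lw: "L r * w = D + w"
    using nz by (simp add: L_def w_def T_def Dn(1) field_simps)
  have sl: "slope r = 1 - \<kappa> * (T * (L r * w))"
    by (simp add: slope_def \<kappa>_def T_def w_def)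
  have gen: "s * (n * (n - 1) + (n - 1) * A * u * E + (n - 1) / 3 * A\<^sup>2 * u\<^sup>2 * E)
     = (n - 1) / 3 * (s * (3 * n + 3 * (A * u) * E + (A * u)\<^sup>2 * E))" for s A E
    by (simp add: power_mult_distrib field_simps)
  have m1: "(n - 1) * (p - t r) * L r / (t r * (t r - 1)) = (n - 1) * (p - T) * u * (L r * w)"
    by (simp add: T_def u_def w_def)
  have m2: "(p - t r)\<^sup>2 * ((n - 1) * L r / (3 * (t r)\<^sup>2 * (t r - 1)))
      = (n - 1) / 3 * (p - T)\<^sup>2 * u\<^sup>2 * (L r * w)"
    by (simp add: T_def u_def w_def power_divide)
  have "slope r * (n * (n - 1) + (n - 1) * (p - t r) * L r / (t r * (t r - 1))
        + (p - t r)\<^sup>2 * ((n - 1) * L r / (3 * (t r)\<^sup>2 * (t r - 1))))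
     = (n - 1) / 3 * ((1 - \<kappa> * (T * (D + w))) *
         (3 * n + 3 * ((p - T) * u) * (D + w) + ((p - T) * u)\<^sup>2 * (D + w)))"
    unfolding m1 m2 sl Lw gen by (rule refl)
  also have "(p - T) * u = p * u - 1" using Tu by (simp add: algebra_simps)
  also have "T * (D + w) = D * T + 1 + w" using Tw by (simp add: algebra_simps)
  also have "3 * n + 3 * (p * u - 1) * (D + w) + (p * u - 1)\<^sup>2 * (D + w)
     = (3 * n - 2 * D) + p\<^sup>2 * n * u\<^sup>2 + (n * p - p\<^sup>2) * u + (p\<^sup>2 + p - 2) * w"
    using uw Dn(1) by algebra
  also have "(1 - \<kappa> * (D * T + 1 + w)) * \<dots>
     = pf0 p - pf1 * T
       + pf2 p * u
       + p\<^sup>2 * n * u\<^sup>2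
       + pf3 p * w
       - \<kappa> * (p\<^sup>2 + p - 2) * w\<^sup>2"
    unfolding pf0_def pf1_def pf2_def pf3_def using uw Tu Tw by algebra
  finally show ?thesis unfolding u2 w2 by (simp add: T_def u_def w_def)
qed

text \<open>The sum \<open>S\<close> of all \<open>\<beta>\<close>. It is symmetric in the roots and therefore rational in \<open>p\<close> and \<open>g\<close>: the
  partial fractions of \<open>partial_fractions\<close> are summed over \<open>r\<close> by means of the power sums.\<close>

theorem sum_eta_dq:
  shows "(\<Sum>(r, s, u) \<in> {(r, s, u). r < s \<and> s < u \<and> u < d}.
      eta_dq (p - t r) (p - t s) (p - t u) (slope r) (slope s) (slope u))
    = (n - 1) / 6 * (D * n - (D * p - 2 - (p + 2) * (p - 1) * (c / (c + g))) / g)"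
proof -
  define X where "X = c / (c + g)"
  define H where "H = (\<lambda>r s u. slope r * ((p - t s) * (p - t u)) /
      (((p - t r) - (p - t s)) * ((p - t r) - (p - t u))))"
  have "2 * (\<Sum>(r, s, u) \<in> {(r, s, u). r < s \<and> s < u \<and> u < d}.
      eta_dq (p - t r) (p - t s) (p - t u) (slope r) (slope s) (slope u))
    = 2 * (\<Sum>(r, s, u) \<in> {(r, s, u). r < s \<and> s < u \<and> u < d}. H r s u + H s u r + H u r s)"
    by (simp add: eta_dq_def H_def)
  also have "\<dots> = (\<Sum>r<d. \<Sum>s\<in>{..<d} - {r}. \<Sum>u\<in>{..<d} - {r, s}. H r s u)"
    by (rule sum_ordered_triples) (simp add: H_def mult.commute)
  also have "\<dots> = (\<Sum>r<d. (n - 1) / 3 * (pf0 p - pf1 * t r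
       + pf2 p * (1 / t r)
       + p\<^sup>2 * n * (1 / (t r)\<^sup>2)
       + pf3 p * (1 / (t r - 1))
       - \<kappa> * (p\<^sup>2 + p - 2) * (1 / (t r - 1)\<^sup>2)))"
    unfolding H_def by (intro sum.cong refl) (simp only: inner_sum partial_fractions lessThan_iff)
  also have "\<dots> = (n - 1) / 3 * (D * pf0 p - pf1 * 0
       + pf2 p * (D / n)
       + p\<^sup>2 * n * (D / n)\<^sup>2
       + pf3 p * (- D)
       - \<kappa> * (p\<^sup>2 + p - 2) * (D\<^sup>2 - D * n * X))"
    unfolding sum_distrib_left[symmetric] sum.distrib sum_subtractf
      sum_roots power_sums_0 power_sums_1 X_def[symmetric]
    by (simp add: D_def algebra_simps)
  also have "\<dots> = (n - 1) / 3 * (D * n - (D * p - 2 - (p + 2) * (p - 1) * X) * (\<kappa> * D * n))"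
  proof -
    define m where "m = 1 / n"
    have nm: "n * m = 1" using Dn(2) by (simp add: m_def)
    have dn: "D / n = 1 + m" using Dn(2) by (simp add: m_def Dn(1) field_simps)
    have pf2: "pf2 p = n * p - p\<^sup>2 - \<kappa> * p\<^sup>2 * n\<^sup>2"
      by (simp add: pf2_def Dn(1) algebra_simps power2_eq_square)
    have h1: "pf2 p * (D / n)
      = n * p - p\<^sup>2 - \<kappa> * p\<^sup>2 * n\<^sup>2 + p - p\<^sup>2 * m - \<kappa> * p\<^sup>2 * n"
    proof -
      have "(n * p - p\<^sup>2 - \<kappa> * p\<^sup>2 * n\<^sup>2) * (1 + m)
        = n * p - p\<^sup>2 - \<kappa> * p\<^sup>2 * n\<^sup>2 + (n * m) * p - p\<^sup>2 * m - \<kappa> * p\<^sup>2 * n * (n * m)"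
        by (simp add: algebra_simps power2_eq_square)
      then show ?thesis unfolding dn nm pf2 by simp
    qed
    have h2: "p\<^sup>2 * n * (D / n)\<^sup>2 = p\<^sup>2 * (D + 1 + m)"
    proof -
      have "p\<^sup>2 * n * (1 + m)\<^sup>2 = p\<^sup>2 * (n + 2 * (n * m) + (n * m) * m)"
        by (simp add: algebra_simps power2_eq_square)
      then show ?thesis unfolding dn nm by (simp add: Dn(1) add_ac)
    qed
    show ?thesis unfolding h1 h2 unfolding pf0_def pf1_def pf3_def Dn(1) by (simp add: algebra_simps power2_eq_square)
  qed
  also have "\<kappa> * D * n = 1 / g" using Dn by (simp add: \<kappa>_def)
  finally have "2 * (\<Sum>(r, s, u) \<in> {(r, s, u). r < s \<and> s < u \<and> u < d}.
      eta_dq (p - t r) (p - t s) (p - t u) (slope r) (slope s) (slope u))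
    = (n - 1) / 3 * (D * n - (D * p - 2 - (p + 2) * (p - 1) * X) * (1 / g))" .
  moreover have "a = x / 6 * (y - w / g)" if "2 * a = x / 3 * (y - w * (1 / g))" for a x y w
  proof -
    have "a = (2 * a) / 2" by simp
    also have "\<dots> = x / 6 * (y - w / g)" unfolding that by simp
    finally show ?thesis .
  qed
  ultimately show ?thesis unfolding X_def by blast
qed

end

section \<open>Curvature of the Legendre webs of the normal forms\<close>

text \<open>Off the discriminant the symmetric form is a product of pairwise independent linear forms, which
  has simple zeros only. This excludes the lines in the discriminant without computing it.\<close>

lemma web_no_singular_direction:
  assumes sp: "web_splits k W U \<theta>" and z: "z \<in> U" and k: "k \<ge> 2"
    and ab: "(a, b) \<noteq> (0, 0)" and W0: "W z (a, b) = 0"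
    and deriv0: "\<And>h1 h2. ((\<lambda>e. W z (a + e * h1, b + e * h2)) has_field_derivative 0) (at 0)"
  shows False
proof -
  have W: "W z \<xi> = (\<Prod>i<k. form_apply (\<theta> i z) \<xi>)" for \<xi>
    using sp z unfolding web_splits_def by blast
  have dist: "wedge (\<theta> i z) (\<theta> j z) \<noteq> 0" if "i < k" "j < k" "i \<noteq> j" for i j
    using sp z that unfolding web_splits_def by blast
  obtain i where i: "i < k" "form_apply (\<theta> i z) (a, b) = 0" using W0 unfolding W by auto
  obtain j where "j < k" "j \<noteq> i" using that[of 0] that[of 1] k i by (cases "i = 0") auto
  then have "\<theta> i z \<noteq> (0, 0)" using dist[of i j] i by (auto simp: wedge_def)
  then obtain h1 h2 where h: "form_apply (\<theta> i z) (h1, h2) \<noteq> 0"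
    using that[of 1 0] that[of 0 1] by (cases "\<theta> i z") (auto simp: form_apply_def)
  have others: "form_apply (\<theta> j z) (a, b) \<noteq> 0" if j: "j < k" "j \<noteq> i" for j
  proof
    assume "form_apply (\<theta> j z) (a, b) = 0"
    then have 1: "fst (\<theta> j z) * a + snd (\<theta> j z) * b = 0" by (simp add: form_apply_def)
    have 2: "fst (\<theta> i z) * a + snd (\<theta> i z) * b = 0" using i by (simp add: form_apply_def)
    have "wedge (\<theta> i z) (\<theta> j z) * a = 0" "wedge (\<theta> i z) (\<theta> j z) * b = 0"
      using 1 2 unfolding wedge_def by algebra+
    then show False using dist[of i j] i j ab by auto
  qed
  let ?R = "\<lambda>e. \<Prod>j\<in>{..<k} - {i}. form_apply (\<theta> j z) (a + e * h1, b + e * h2)"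
  have Weq: "W z (a + e * h1, b + e * h2) = (e * form_apply (\<theta> i z) (h1, h2)) * ?R e" for e
  proof -
    have "form_apply (\<theta> i z) (a + e * h1, b + e * h2)
        = form_apply (\<theta> i z) (a, b) + e * form_apply (\<theta> i z) (h1, h2)"
      by (simp add: form_apply_def algebra_simps)
    then show ?thesis unfolding W using i by (subst prod.remove[of _ i]) auto
  qed
  have "?R holomorphic_on UNIV" unfolding form_apply_def fst_conv snd_conv by (intro holomorphic_intros)
  then have "?R field_differentiable (at 0)" by (simp add: holomorphic_on_imp_differentiable_at)
  then obtain R' where R': "(?R has_field_derivative R') (at 0)" by (auto simp: field_differentiable_def)
  have "((\<lambda>e. (e * form_apply (\<theta> i z) (h1, h2)) * ?R e) has_field_derivative
      (0 * form_apply (\<theta> i z) (h1, h2)) * R' + (1 * form_apply (\<theta> i z) (h1, h2)) * ?R 0) (at 0)"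
    by (rule DERIV_mult'[OF _ R', THEN DERIV_cong]) (auto intro!: derivative_eq_intros)
  then have "((\<lambda>e. W z (a + e * h1, b + e * h2)) has_field_derivative
      form_apply (\<theta> i z) (h1, h2) * ?R 0) (at 0)" unfolding Weq by simp
  from DERIV_unique[OF this deriv0] have "form_apply (\<theta> i z) (h1, h2) * ?R 0 = 0" .
  then show False using h others by auto
qed

text \<open>The normal form of a homogeneous foliation \<open>A dx + B dy\<close> whose Gauss map \<open>t \<mapsto> - A(1,t)/B(1,t)\<close> is branched
  only over three directions: it equals \<open>- \<rho> - c t\<^bsup>d\<^esup>/(d t - (d-1))\<close>, with critical points \<open>0\<close>, \<open>1\<close> and \<open>\<infinity>\<close>,
  where the values are \<open>- \<rho>\<close>, \<open>- \<rho> - c\<close> and \<open>\<infinity>\<close>.\<close>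

definition famB :: "nat \<Rightarrow> complex \<Rightarrow> complex \<Rightarrow> complex" where
  "famB d x y = x ^ (d - 1) * (of_nat d * y - of_nat (d - 1) * x)"

definition famA :: "nat \<Rightarrow> complex \<Rightarrow> complex \<Rightarrow> complex \<Rightarrow> complex \<Rightarrow> complex" where
  "famA d \<rho> c x y = \<rho> * famB d x y + c * y ^ d"

text \<open>The Legendre web of the normal form in homogeneous coordinates of the dual plane: the line \<open>l\<close>
  moving with velocity \<open>\<xi>\<close> turns about the point \<open>l \<times> \<xi>\<close>, whose first two coordinates are the arguments
  of \<open>famA\<close> and \<open>famB\<close>.\<close>

definition fam_web :: "nat \<Rightarrow> complex \<Rightarrow> complex \<Rightarrow> complex^3 \<Rightarrow> complex^3 \<Rightarrow> complex" where
  "fam_web d \<rho> c l \<xi> =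
     l$1 * famB d (l$2 * \<xi>$3 - l$3 * \<xi>$2) (l$3 * \<xi>$1 - l$1 * \<xi>$3)
     - l$2 * famA d \<rho> c (l$2 * \<xi>$3 - l$3 * \<xi>$2) (l$3 * \<xi>$1 - l$1 * \<xi>$3)"

definition chart_family_web :: "nat \<Rightarrow> complex \<Rightarrow> complex \<Rightarrow> complex \<Rightarrow> complex^3^3 \<Rightarrow> c2 \<Rightarrow> c2 \<Rightarrow> complex" where
  "chart_family_web d \<rho> c \<kappa> M z \<xi> =
     \<kappa> * fam_web d \<rho> c (M *v vector [fst z, snd z, 1]) (M *v vector [fst \<xi>, snd \<xi>, 0])"

text \<open>A decomposition of this web into foliations, in an arbitrary affine chart of the dual plane. The
  factor \<open>\<kappa>\<close> is the scalar up to which the web of a conjugate foliation is determined.\<close>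

locale split_family =
  fixes d :: nat and \<rho> c \<kappa> :: complex and M :: "complex^3^3" and U :: "c2 set" and \<theta> :: "nat \<Rightarrow> c2 \<Rightarrow> c2"
  assumes d: "d \<ge> 3" and c: "c \<noteq> 0" and \<kappa>: "\<kappa> \<noteq> 0" and M: "det M \<noteq> 0"
    and split: "web_splits d (chart_family_web d \<rho> c \<kappa> M) U \<theta>"
begin

text \<open>The homogeneous coordinates of the line with chart coordinates \<open>z\<close>, and their differentials. The
  forms \<open>\<alpha>1\<close> and \<open>\<alpha>2\<close> map a velocity to the affine coordinates \<open>x\<close> and \<open>y\<close> of the point about which the
  line turns.\<close>

definition l :: "3 \<Rightarrow> c2 \<Rightarrow> complex" where
  "l i z = M$i$1 * fst z + M$i$2 * snd z + M$i$3"
definition m :: "3 \<Rightarrow> c2" where "m i = (M$i$1, M$i$2)"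

definition \<alpha>1 :: "c2 \<Rightarrow> c2" where "\<alpha>1 z = cscale (l 2 z) (m 3) - cscale (l 3 z) (m 2)"
definition \<alpha>2 :: "c2 \<Rightarrow> c2" where "\<alpha>2 z = cscale (l 3 z) (m 1) - cscale (l 1 z) (m 3)"

lemma split':
  shows openU: "open U" and \<theta>_hol: "\<And>i. i < d \<Longrightarrow> holomorphic_form (\<theta> i) U"
    and \<theta>_wedge: "\<And>i j z. i < d \<Longrightarrow> j < d \<Longrightarrow> i \<noteq> j \<Longrightarrow> z \<in> U \<Longrightarrow> wedge (\<theta> i z) (\<theta> j z) \<noteq> 0"
    and web_prod: "\<And>z \<xi>. z \<in> U \<Longrightarrow> \<kappa> * (l 1 z * famB d (form_apply (\<alpha>1 z) \<xi>) (form_apply (\<alpha>2 z) \<xi>)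
       - l 2 z * famA d \<rho> c (form_apply (\<alpha>1 z) \<xi>) (form_apply (\<alpha>2 z) \<xi>))
       = (\<Prod>i<d. form_apply (\<theta> i z) \<xi>)"
proof -
  show "open U" "\<And>i. i < d \<Longrightarrow> holomorphic_form (\<theta> i) U"
   "\<And>i j z. i < d \<Longrightarrow> j < d \<Longrightarrow> i \<noteq> j \<Longrightarrow> z \<in> U \<Longrightarrow> wedge (\<theta> i z) (\<theta> j z) \<noteq> 0"
    using split by (auto simp: web_splits_def holomorphic_form_def)
  fix z \<xi> :: c2 assume "z \<in> U"
  have 1: "(M *v vector [fst z, snd z, 1]) $ i = l i z" for i
    by (simp add: matrix_vector_mult_def sum_3 l_def)
  have 2: "(M *v vector [fst \<xi>, snd \<xi>, 0]) $ i = form_apply (m i) \<xi>" for i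
    by (simp add: matrix_vector_mult_def sum_3 m_def form_apply_def)
  have "(\<Prod>i<d. form_apply (\<theta> i z) \<xi>) = chart_family_web d \<rho> c \<kappa> M z \<xi>"
    using split \<open>z \<in> U\<close> unfolding web_splits_def by metis
  then show "\<kappa> * (l 1 z * famB d (form_apply (\<alpha>1 z) \<xi>) (form_apply (\<alpha>2 z) \<xi>)
       - l 2 z * famA d \<rho> c (form_apply (\<alpha>1 z) \<xi>) (form_apply (\<alpha>2 z) \<xi>))
       = (\<Prod>i<d. form_apply (\<theta> i z) \<xi>)"
    unfolding chart_family_web_def fam_web_def 1 2 by (simp add: \<alpha>1_def \<alpha>2_def form_apply_def cscale_def algebra_simps)
qed

text \<open>In a direction where \<open>\<alpha>1\<close> vanishes the web form is \<open>- \<kappa> c l\<^sub>2 y\<^bsup>d\<^esup>\<close> with \<open>y\<close> the value of \<open>\<alpha>2\<close>, up to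
  second order in the deviation of \<open>\<alpha>1\<close> from \<open>0\<close>. It has no double zero there.\<close>

lemma direction_\<alpha>1:
  assumes z: "z \<in> U" and ab: "(a, b) \<noteq> (0, 0)" and x0: "form_apply (\<alpha>1 z) (a, b) = 0"
  shows "l 2 z \<noteq> 0" "form_apply (\<alpha>2 z) (a, b) \<noteq> 0"
proof -
  let ?y0 = "form_apply (\<alpha>2 z) (a, b)"
  have False if h: "l 2 z = 0 \<or> ?y0 = 0"
  proof (rule web_no_singular_direction[OF split z _ ab])
    let ?F = "\<lambda>x y. \<kappa> * (l 1 z * famB d x y - l 2 z * famA d \<rho> c x y)"
    have W: "chart_family_web d \<rho> c \<kappa> M z \<xi> = ?F (form_apply (\<alpha>1 z) \<xi>) (form_apply (\<alpha>2 z) \<xi>)" for \<xi>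
      using web_prod[OF z, of \<xi>] split z unfolding web_splits_def by metis
    have d0: "d \<noteq> 0" "d - 1 \<noteq> 0" using d by auto
    have F0: "?F 0 ?y0 = 0" using h d0 by (auto simp: famA_def famB_def)
    then show "chart_family_web d \<rho> c \<kappa> M z (a, b) = 0" unfolding W x0 .
    fix h1 h2
    have lin: "form_apply \<alpha> (a + e * h1, b + e * h2) = form_apply \<alpha> (a, b) + e * form_apply \<alpha> (h1, h2)"
      for e \<alpha> by (simp add: form_apply_def algebra_simps)
    let ?x1 = "form_apply (\<alpha>1 z) (h1, h2)" and ?y1 = "form_apply (\<alpha>2 z) (h1, h2)"
    obtain k where k: "d = k + 3" using d by (metis add.commute le_iff_add)
    have "((\<lambda>e. ?F (0 + e * ?x1) (?y0 + e * ?y1)) has_field_derivative 0) (at 0)"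
      unfolding famA_def famB_def k
      by (rule derivative_eq_intros refl | simp)+ (use h in auto)
    then show "((\<lambda>e. chart_family_web d \<rho> c \<kappa> M z (a + e * h1, b + e * h2))
       has_field_derivative 0) (at 0)"
      unfolding W lin x0 .
  qed (use d in auto)
  then show "l 2 z \<noteq> 0" "?y0 \<noteq> 0" by auto
qed

text \<open>The vertical lines and the lines through the origin lie in the discriminant, so that the slope \<open>p\<close>
  and the logarithmic form \<open>dq/q\<close> are defined on \<open>U\<close>. If \<open>l\<^sub>3 = 0\<close>, then \<open>\<alpha>1\<close> and \<open>\<alpha>2\<close> have a common kernel.\<close>

lemma l_nz:
  assumes z: "z \<in> U" shows "l 2 z \<noteq> 0" "l 3 z \<noteq> 0"
proof -
  have ker: "\<exists>a b. (a, b) \<noteq> (0, 0) \<and> form_apply w (a, b) = 0" for w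
  proof (cases "w = (0, 0)")
    case True then show ?thesis by (intro exI[of _ 1]) (simp add: form_apply_def)
  next
    case False then show ?thesis
      by (intro exI[of _ "snd w"] exI[of _ "- fst w"]) (auto simp: form_apply_def prod_eq_iff)
  qed
  show "l 2 z \<noteq> 0" using ker[of "\<alpha>1 z"] direction_\<alpha>1(1)[OF z] by blast
  show "l 3 z \<noteq> 0"
  proof
    assume l3: "l 3 z = 0"
    obtain a b where ab: "(a, b) \<noteq> (0, 0)" "form_apply (m 3) (a, b) = 0" using ker by blast
    have "form_apply (\<alpha>1 z) (a, b) = l 2 z * form_apply (m 3) (a, b)"
      "form_apply (\<alpha>2 z) (a, b) = - l 1 z * form_apply (m 3) (a, b)"
      using l3 by (auto simp: \<alpha>1_def \<alpha>2_def form_apply_def cscale_def algebra_simps)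
    then show False using direction_\<alpha>1(2)[OF z ab(1)] ab(2) by simp
  qed
qed

text \<open>The coordinates in which \<open>l\<close> is the line \<open>y = p x - q\<close>.\<close>

definition p :: "c2 \<Rightarrow> complex" where "p z = - l 1 z / l 2 z"
definition q :: "c2 \<Rightarrow> complex" where "q z = l 3 z / l 2 z"
definition \<sigma> :: "c2 \<Rightarrow> c2" where "\<sigma> z = cscale (1 / q z) (dd q z)"
definition J :: "c2 \<Rightarrow> complex" where "J z = wedge (dd p z) (\<sigma> z)"

lemma has_d_l: "has_d (l i) (m i) z"
  unfolding l_def[abs_def] m_def has_d_def case_prod_beta' by (auto intro!: derivative_eq_intros)

lemma l_hol: "holomorphic2 (l i) U"
  unfolding l_def[abs_def] by (intro holomorphic2_intros)

lemma p_hol: "holomorphic2 p U" and q_hol: "holomorphic2 q U"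
  unfolding p_def[abs_def] q_def[abs_def] by (intro holomorphic2_intros l_hol l_nz; assumption)+

lemma q_nz: "z \<in> U \<Longrightarrow> q z \<noteq> 0" using l_nz by (simp add: q_def)

lemma dd_q: "z \<in> U \<Longrightarrow> dd q z = cscale (1 / (l 2 z)\<^sup>2) (\<alpha>1 z)"
  using has_d_imp_dd[OF has_d_divide[OF has_d_l has_d_l l_nz(1)], of z 3]
  by (simp add: q_def[abs_def] \<alpha>1_def cscale_def)

lemma dd_p: "z \<in> U \<Longrightarrow> dd p z = cscale (1 / (l 2 z)\<^sup>2) (cscale (l 1 z) (m 2) - cscale (l 2 z) (m 1))"
  using has_d_imp_dd[OF has_d_divide[OF has_d_uminus[OF has_d_l] has_d_l l_nz(1)], of z 1]
  by (simp add: p_def[abs_def] cscale_def diff_divide_distrib mult_ac)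

lemma \<sigma>_eq: "z \<in> U \<Longrightarrow> \<sigma> z = cscale (1 / (l 2 z * l 3 z)) (\<alpha>1 z)"
  using l_nz[of z] by (simp add: \<sigma>_def dd_q q_def cscale_def power2_eq_square field_simps)

lemma J_eq: assumes z: "z \<in> U" shows "J z = det M / ((l 2 z)\<^sup>2 * l 3 z)"
proof -
  have "wedge (cscale (l 1 z) (m 2) - cscale (l 2 z) (m 1)) (\<alpha>1 z) = l 2 z * det M"
    by (simp add: \<alpha>1_def wedge_def cscale_def m_def l_def det_3 algebra_simps)
  then have "J z = 1 / (l 2 z)\<^sup>2 * (1 / (l 2 z * l 3 z) * (l 2 z * det M))"
    unfolding J_def dd_p[OF z] \<sigma>_eq[OF z] wedge_cscale by simp
  then show ?thesis using l_nz[OF z] by (simp add: power2_eq_square field_simps)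
qed

lemma J_nz: "z \<in> U \<Longrightarrow> J z \<noteq> 0"
  using l_nz[of z] M by (simp add: J_eq)

text \<open>The covector \<open>\<theta>\<^sub>i\<close> is annihilated by the velocity \<open>(snd \<theta>\<^sub>i, - fst \<theta>\<^sub>i)\<close>. A line moving along a leaf of the
  \<open>i\<close>-th foliation turns about the point \<open>(X\<^sub>i, Y\<^sub>i)\<close>, where it is tangent to the original foliation.\<close>

definition X :: "nat \<Rightarrow> c2 \<Rightarrow> complex" where
  "X i z = form_apply (\<alpha>1 z) (snd (\<theta> i z), - fst (\<theta> i z))"
definition Y :: "nat \<Rightarrow> c2 \<Rightarrow> complex" where
  "Y i z = form_apply (\<alpha>2 z) (snd (\<theta> i z), - fst (\<theta> i z))"
definition t :: "nat \<Rightarrow> c2 \<Rightarrow> complex" where "t i z = Y i z / X i z"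

lemma \<theta>_nz: assumes "i < d" "z \<in> U" shows "\<theta> i z \<noteq> (0, 0)"
proof -
  obtain j where "j < d" "j \<noteq> i" using d assms by (cases "i = 0") (auto intro: that[of 0] that[of 1])
  then show ?thesis using \<theta>_wedge[of i j z] assms by (auto simp: wedge_def)
qed

lemma XY: assumes i: "i < d" and z: "z \<in> U"
  shows "l 1 z * famB d (X i z) (Y i z) - l 2 z * famA d \<rho> c (X i z) (Y i z) = 0" and "X i z \<noteq> 0"
proof -
  let ?\<xi> = "(snd (\<theta> i z), - fst (\<theta> i z))"
  have \<xi>: "?\<xi> \<noteq> (0, 0)" using \<theta>_nz[OF i z] by (auto simp: prod_eq_iff)
  have "form_apply (\<theta> i z) ?\<xi> = 0" by (simp add: form_apply_def)
  then have "(\<Prod>i<d. form_apply (\<theta> i z) ?\<xi>) = 0" using i by (intro prod_zero) auto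
  then have "\<kappa> * (l 1 z * famB d (X i z) (Y i z) - l 2 z * famA d \<rho> c (X i z) (Y i z)) = 0"
    using web_prod[OF z, of ?\<xi>] unfolding X_def Y_def by (simp only:)
  then show eq: "l 1 z * famB d (X i z) (Y i z) - l 2 z * famA d \<rho> c (X i z) (Y i z) = 0"
    using \<kappa> by simp
  show "X i z \<noteq> 0"
  proof
    assume x: "X i z = 0"
    have "(0::complex) ^ (d - 1) = 0" using d by simp
    then have "l 2 z * (c * Y i z ^ d) = 0" using eq x by (simp only: famA_def famB_def) simp
    then have "Y i z = 0" using l_nz[OF z] c by simp
    then show False using direction_\<alpha>1(2)[OF z \<xi>] x by (simp add: X_def Y_def)
  qed
qed

lemma root: assumes i: "i < d" and z: "z \<in> U"
  shows "c * t i z ^ d + (p z + \<rho>) * (of_nat d * t i z - of_nat (d - 1)) = 0"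
proof -
  have x: "X i z \<noteq> 0" and l2: "l 2 z \<noteq> 0" using XY i z l_nz by auto
  have B: "famB d (X i z) (Y i z) = X i z ^ d * (of_nat d * t i z - of_nat (d - 1))"
  proof -
    have "X i z ^ d = X i z ^ (d - 1) * X i z" using d by (metis One_nat_def Suc_le_D Suc_pred
      diff_Suc_1 power_Suc2 le_trans numeral_3_eq_3 zero_less_Suc)
    then show ?thesis using x by (simp add: famB_def t_def field_simps)
  qed
  have Y: "Y i z ^ d = X i z ^ d * t i z ^ d" using x by (simp add: t_def power_divide)
  have "X i z ^ d * (l 1 z * (of_nat d * t i z - of_nat (d - 1))
      - l 2 z * (\<rho> * (of_nat d * t i z - of_nat (d - 1)) + c * t i z ^ d)) = 0"
    using XY(1)[OF i z] unfolding famA_def B Y by (simp add: algebra_simps)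
  then have "l 1 z * (of_nat d * t i z - of_nat (d - 1))
      - l 2 z * (\<rho> * (of_nat d * t i z - of_nat (d - 1)) + c * t i z ^ d) = 0" using x by simp
  moreover have "l 1 z = - (p z * l 2 z)" using l2 by (simp add: p_def)
  ultimately have "l 2 z * (c * t i z ^ d + (p z + \<rho>) * (of_nat d * t i z - of_nat (d - 1))) = 0"
    by (simp add: algebra_simps)
  then show ?thesis using l2 by simp
qed

text \<open>The normalized \<open>i\<close>-th form; by \<open>\<theta>_eq\<close>, \<open>\<theta>\<^sub>i\<close> is a multiple \<open>F\<^sub>i \<omega>\<^sub>i\<close> of it.\<close>

definition \<omega> :: "nat \<Rightarrow> c2 \<Rightarrow> c2" where "\<omega> i z = cscale (p z - t i z) (\<sigma> z) - dd p z"
definition F :: "nat \<Rightarrow> c2 \<Rightarrow> complex" where "F i z = - wedge (\<theta> i z) (\<sigma> z) / J z"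

lemma \<omega>_eq: assumes i: "i < d" and z: "z \<in> U"
  shows "\<omega> i z = cscale (1 / (l 2 z * l 3 z)) (\<alpha>2 z - cscale (t i z) (\<alpha>1 z))"
proof -
  have "l 2 z \<noteq> 0" "l 3 z \<noteq> 0" using l_nz z by auto
  then show ?thesis unfolding \<omega>_def \<sigma>_eq[OF z] dd_p[OF z] p_def
    by (auto simp: \<alpha>1_def \<alpha>2_def cscale_def prod_eq_iff power2_eq_square field_simps)
qed

lemma \<theta>_eq: assumes i: "i < d" and z: "z \<in> U" shows "\<theta> i z = cscale (F i z) (\<omega> i z)"
proof (rule covector_eqI[of "\<sigma> z" "\<omega> i z"])
  have so: "wedge (\<sigma> z) (\<omega> i z) = J z"
    by (simp add: \<omega>_def J_def wedge_def cscale_def algebra_simps)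
  then show "wedge (\<sigma> z) (\<omega> i z) \<noteq> 0" using J_nz[OF z] by simp
  have os: "wedge (\<omega> i z) (\<sigma> z) = - J z" using so by (simp add: wedge_def algebra_simps)
  show "wedge (\<theta> i z) (\<sigma> z) = wedge (cscale (F i z) (\<omega> i z)) (\<sigma> z)"
    unfolding wedge_cscale os using J_nz[OF z] by (simp add: F_def)
  have "wedge (\<alpha>2 z - cscale (t i z) (\<alpha>1 z)) (\<theta> i z) = Y i z - t i z * X i z"
    by (simp add: X_def Y_def wedge_def form_apply_def cscale_def algebra_simps)
  also have "\<dots> = 0" using XY(2)[OF i z] by (simp add: t_def)
  finally have "wedge (\<omega> i z) (\<theta> i z) = 0" unfolding \<omega>_eq[OF i z] wedge_cscale by simp
  then have "wedge (\<theta> i z) (\<omega> i z) = 0" by (simp add: wedge_def algebra_simps)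
  then show "wedge (\<theta> i z) (\<omega> i z) = wedge (cscale (F i z) (\<omega> i z)) (\<omega> i z)"
    unfolding wedge_cscale by (simp add: wedge_def)
qed

lemma t_distinct: assumes "i < d" "j < d" "i \<noteq> j" "z \<in> U" shows "t i z \<noteq> t j z"
proof
  assume "t i z = t j z"
  then have "\<omega> i z = \<omega> j z" by (simp add: \<omega>_def)
  then have "wedge (\<theta> i z) (\<theta> j z) = 0"
    unfolding \<theta>_eq[OF assms(1,4)] \<theta>_eq[OF assms(2,4)] wedge_cscale by (simp add: wedge_def)
  then show False using \<theta>_wedge assms by blast
qed

lemma t_hol: assumes "i < d" shows "holomorphic2 (t i) U"
proof -
  have "holomorphic2 (\<lambda>z. fst (\<theta> i z)) U" "holomorphic2 (\<lambda>z. snd (\<theta> i z)) U"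
    using \<theta>_hol[OF assms] by (auto simp: holomorphic_form_def)
  moreover have "X i = (\<lambda>z. (l 2 z * fst (m 3) - l 3 z * fst (m 2)) * snd (\<theta> i z)
      + (l 2 z * snd (m 3) - l 3 z * snd (m 2)) * - fst (\<theta> i z))"
    and "Y i = (\<lambda>z. (l 3 z * fst (m 1) - l 1 z * fst (m 3)) * snd (\<theta> i z)
      + (l 3 z * snd (m 1) - l 1 z * snd (m 3)) * - fst (\<theta> i z))"
    by (auto simp: fun_eq_iff X_def Y_def form_apply_def \<alpha>1_def \<alpha>2_def cscale_def)
  ultimately have "holomorphic2 (X i) U" "holomorphic2 (Y i) U"
    by (simp_all only:) (intro holomorphic2_intros l_hol; assumption)+
  then show ?thesis unfolding t_def[abs_def] by (intro holomorphic2_divide XY(2)[OF assms])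
qed

lemma \<sigma>_form: "holomorphic_form \<sigma> U"
  unfolding \<sigma>_def[abs_def]
  by (intro holomorphic_form_cscale holomorphic_form_dd q_hol openU holomorphic2_intros q_nz)

lemma J_hol: "holomorphic2 J U"
  unfolding J_def[abs_def] by (intro holomorphic2_wedge holomorphic_form_dd p_hol openU \<sigma>_form)

lemma F_hol: "i < d \<Longrightarrow> holomorphic2 (F i) U"
  unfolding F_def[abs_def]
  by (intro holomorphic2_divide holomorphic2_uminus J_nz J_hol holomorphic2_wedge \<sigma>_form \<theta>_hol)

lemma F_nz: assumes "i < d" "z \<in> U" shows "F i z \<noteq> 0"
  using \<theta>_nz[OF assms] unfolding \<theta>_eq[OF assms] by (auto simp: cscale_def)

lemma roots: assumes z: "z \<in> U" shows "trinomial_roots d c (p z + \<rho>) (\<lambda>i. t i z)"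
proof
  show "inj_on (\<lambda>i. t i z) {..<d}" using t_distinct z unfolding inj_on_def by blast
qed (use d c root[OF _ z] in blast)+

definition slope :: "nat \<Rightarrow> c2 \<Rightarrow> complex" where
  "slope i z = trinomial_roots.slope d (p z + \<rho>) (\<lambda>i. t i z) i"

text \<open>Implicit differentiation of the equation satisfied by \<open>t\<^sub>i\<close>.\<close>

lemma dd_y: assumes i: "i < d" and z: "z \<in> U"
  shows "has_d (\<lambda>z. p z - t i z) (cscale (slope i z) (dd p z)) z"
proof -
  interpret r: trinomial_roots d c "p z + \<rho>" "\<lambda>i. t i z" by (rule roots[OF z])
  let ?T = "t i z" and ?g = "p z + \<rho>"
  have ht: "has_d (t i) (dd (t i) z) z" using holomorphic2_has_dd[OF t_hol[OF i] z] .
  have hp: "has_d p (dd p z) z" using holomorphic2_has_dd[OF p_hol z] .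
  have h1: "has_d (\<lambda>z. c * t i z ^ d) (c * (of_nat d * ?T ^ (d - 1)) * fst (dd (t i) z),
      c * (of_nat d * ?T ^ (d - 1)) * snd (dd (t i) z)) z"
    by (rule has_d_compose1[OF ht]) (auto intro!: derivative_eq_intros)
  have h2: "has_d (\<lambda>z. of_nat d * t i z - of_nat (d - 1))
     (of_nat d * fst (dd (t i) z), of_nat d * snd (dd (t i) z)) z"
    by (rule has_d_compose1[OF ht]) (auto intro!: derivative_eq_intros)
  have h3: "has_d (\<lambda>z. p z + \<rho>) (dd p z) z"
    using has_d_add[OF hp has_d_const[of \<rho>]] by simp
  have "has_d (\<lambda>z. 0) (c * (of_nat d * ?T ^ (d - 1)) * fst (dd (t i) z) +
      (?g * (of_nat d * fst (dd (t i) z)) + (of_nat d * ?T - of_nat (d - 1)) * fst (dd p z)),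
      c * (of_nat d * ?T ^ (d - 1)) * snd (dd (t i) z) +
      (?g * (of_nat d * snd (dd (t i) z)) + (of_nat d * ?T - of_nat (d - 1)) * snd (dd p z))) z"
    by (rule has_d_transform[OF has_d_add[OF h1 has_d_mult[OF h3 h2], unfolded fst_conv snd_conv] openU z])
       (use root[OF i] in auto)
  from has_d_imp_dd[OF this] has_d_imp_dd[OF has_d_const[of 0 z]]
  have e: "c * (of_nat d * ?T ^ (d - 1)) * fst (dd (t i) z) +
      (?g * (of_nat d * fst (dd (t i) z)) + (of_nat d * ?T - of_nat (d - 1)) * fst (dd p z)) = 0"
     "c * (of_nat d * ?T ^ (d - 1)) * snd (dd (t i) z) +
      (?g * (of_nat d * snd (dd (t i) z)) + (of_nat d * ?T - of_nat (d - 1)) * snd (dd p z)) = 0"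
    by auto
  \<comment> \<open>\<open>P\<close> is the derivative of the trinomial at its root, and \<open>P dt + L dp = 0\<close>.\<close>
  define P where "P = c * of_nat d * ?T ^ (d - 1) + ?g * of_nat d"
  have P: "?T * P = - r.D * r.n * ?g * (?T - 1)"
    using r.derivs_at_root(1)[OF i] unfolding r.pderiv_trinomial P_def r.D_def by (simp add: algebra_simps)
  have nz: "?T \<noteq> 0" "?T - 1 \<noteq> 0" "r.D \<noteq> 0" "r.n \<noteq> 0" "?g \<noteq> 0"
    using r.t_nz[OF i] r.t_ne1[OF i] r.Dn r.g_nz by auto
  have sl: "slope i z = 1 - ?T * r.L i / (r.D * r.n * ?g * (?T - 1))"
    by (simp add: slope_def r.slope_def)
  have solve: "w = (1 - slope i z) * v" if "P * w + r.L i * v = 0" for w v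
  proof -
    have "?T * P * w = - ?T * r.L i * v" using that by algebra
    then have "(r.D * r.n * ?g * (?T - 1)) * w = ?T * r.L i * v" unfolding P by (simp add: algebra_simps)
    moreover have "r.D * r.n * ?g * (?T - 1) \<noteq> 0" using nz by simp
    ultimately show ?thesis unfolding sl by (simp add: field_simps)
  qed
  have L: "r.L i = of_nat d * ?T - of_nat (d - 1)" by (simp add: r.L_def r.D_def r.n_def)
  have "fst (dd (t i) z) = (1 - slope i z) * fst (dd p z)"
    "snd (dd (t i) z) = (1 - slope i z) * snd (dd p z)"
    by (rule solve, unfold P_def L, use e in \<open>simp add: algebra_simps\<close>)+
  then have "(fst (dd p z) - fst (dd (t i) z), snd (dd p z) - snd (dd (t i) z)) = cscale (slope i z) (dd p z)"
    by (simp add: cscale_def algebra_simps)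
  then show ?thesis using has_d_diff[OF hp ht] by simp
qed

lemma invariant: "invariant_web U p q d (\<lambda>i z. p z - t i z) F \<theta> \<sigma> J
   (\<lambda>i z. wedge (dd (\<lambda>z. p z - t i z) z) (\<sigma> z) / J z)"
proof
  show "holomorphic2 (\<lambda>z. p z - t i z) U" if "i < d" for i
    by (intro holomorphic2_diff p_hol t_hol that)
  show "wedge (dd (\<lambda>z. p z - t i z) z) (dd p z) = 0" if "i < d" "z \<in> U" for i z
    unfolding has_d_imp_dd[OF dd_y[OF that]] wedge_cscale by (simp add: wedge_def)
  show "\<theta> i z = cscale (F i z) (cscale (p z - t i z) (\<sigma> z) - dd p z)" if "i < d" "z \<in> U" for i z
    using \<theta>_eq[OF that] by (simp add: \<omega>_def)
qed (use openU p_hol q_hol q_nz J_nz F_hol F_nz t_distinct in \<open>auto simp: \<sigma>_def J_def\<close>)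

text \<open>By \<open>curvature_eq\<close> the curvature is \<open>S'(p) J\<close>, with \<open>S\<close> given by \<open>sum_eta_dq\<close>. Partial fractions in \<open>g = p + \<rho>\<close>
  exhibit \<open>S\<close> as a constant minus multiples of \<open>R0/g\<close> and \<open>R1/(c + g)\<close>.\<close>

theorem curvature_family:
  assumes z: "z \<in> U"
  shows "p z + \<rho> \<noteq> 0" "c + (p z + \<rho>) \<noteq> 0"
    and "curvature d \<theta> z = J z * (of_nat (d - 2) / 6) *
     (- (\<rho> * (\<rho> + of_nat (d - 1))) / (p z + \<rho>)\<^sup>2
       + (\<rho> + c - 2) * (\<rho> + c + 1) / (c + (p z + \<rho>))\<^sup>2)"
proof -
  interpret w: invariant_web U p q d "\<lambda>i z. p z - t i z" F \<theta> \<sigma> J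
    "\<lambda>i z. wedge (dd (\<lambda>z. p z - t i z) z) (\<sigma> z) / J z" by (rule invariant)
  define n D where "n = (of_nat (d - 1) :: complex)" and "D = (of_nat d :: complex)"
  have Dn: "D = n + 1" and n1: "of_nat (d - 2) = n - 1" using d by (auto simp: n_def D_def of_nat_diff)
  define R0 R1 where "R0 = - (\<rho> * (\<rho> + n))" and "R1 = (\<rho> + c - 2) * (\<rho> + c + 1)"
  define s where "s = (\<lambda>x. (n - 1) / 6 * (D * n - (D - c) - R0 / (x + \<rho>) - R1 / (c + (x + \<rho>))))"
  have nz: "p z + \<rho> \<noteq> 0" "c + (p z + \<rho>) \<noteq> 0" if "z \<in> U" for z
    using trinomial_roots.g_nz[OF roots[OF that]] trinomial_roots.cg_nz[OF roots[OF that]] by auto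
  show "p z + \<rho> \<noteq> 0" "c + (p z + \<rho>) \<noteq> 0" by (rule nz[OF z])+
  have S: "(\<Sum>(r, s, t)\<in>w.triples. w.\<beta> r s t x) = s (p x)" if x: "x \<in> U" for x
  proof -
    interpret r: trinomial_roots d c "p x + \<rho>" "\<lambda>i. t i x" by (rule roots[OF x])
    have y': "wedge (dd (\<lambda>z. p z - t i z) x) (\<sigma> x) / J x = r.slope i" if "i < d" for i
      unfolding has_d_imp_dd[OF dd_y[OF that x]] wedge_cscale slope_def
      using J_nz[OF x] by (simp add: J_def)
    have "(\<Sum>(r, s, t)\<in>w.triples. w.\<beta> r s t x)
      = (\<Sum>(i, j, k) \<in> {(r, s, u). r < s \<and> s < u \<and> u < d}.
      eta_dq (p x - t i x) (p x - t j x) (p x - t k x) (r.slope i) (r.slope j) (r.slope k))"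
      unfolding w.triples_def w.\<beta>_def by (rule sum.cong) (auto simp: y')
    also have "\<dots> = (r.n - 1) / 6 * (r.D * r.n -
        (r.D * p x - 2 - (p x + 2) * (p x - 1) * (c / (c + (p x + \<rho>)))) / (p x + \<rho>))"
      by (rule r.sum_eta_dq)
    also have "\<dots> = s (p x)"
    proof -
      define g where "g = p x + \<rho>"
      have g: "g \<noteq> 0" "c + g \<noteq> 0" using nz[OF x] by (auto simp: g_def)
      have px: "p x = g - \<rho>" by (simp add: g_def)
      have "(D * (g - \<rho>) - 2 - ((g - \<rho>) + 2) * ((g - \<rho>) - 1) * (c / (c + g))) / g
         = (D - c) + R0 / g + R1 / (c + g)"
      proof -
        define u v where "u = 1 / g" and "v = 1 / (c + g)"
        have u: "g * u = 1" and v: "(c + g) * v = 1" using g by (auto simp: u_def v_def)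
        have uv: "c * v * u = u - v" using g by (simp add: u_def v_def field_simps)
        define a where "a = c + \<rho>"
        have e1: "((g - \<rho>) + 2) * ((g - \<rho>) - 1) * u = g + (1 - 2 * \<rho>) + (\<rho> - 2) * (\<rho> + 1) * u"
        proof -
          have "((g - \<rho>) + 2) * ((g - \<rho>) - 1) * u = g * (g * u) + (1 - 2 * \<rho>) * (g * u) + (\<rho> - 2) * (\<rho> + 1) * u"
            by (simp add: algebra_simps)
          then show ?thesis unfolding u by simp
        qed
        have e2: "((g - \<rho>) + 2) * ((g - \<rho>) - 1) * v = (c + g) + (1 - 2 * a) + (a - 2) * (a + 1) * v"
        proof -
          have "((g - \<rho>) + 2) * ((g - \<rho>) - 1) * v
              = (c + g) * ((c + g) * v) + (1 - 2 * a) * ((c + g) * v) + (a - 2) * (a + 1) * v"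
            by (simp add: a_def algebra_simps)
          then show ?thesis unfolding v by simp
        qed
        have "(D * (g - \<rho>) - 2 - ((g - \<rho>) + 2) * ((g - \<rho>) - 1) * (c / (c + g))) / g
          = D * (g * u) - (D * \<rho> + 2) * u - ((g - \<rho>) + 2) * ((g - \<rho>) - 1) * (c * v * u)"
        proof -
          have *: "(A - 2 - B * (c / (c + g))) / g = A * u - 2 * u - B * (c * v * u)" for A B
            by (simp add: u_def v_def diff_divide_distrib)
          show ?thesis unfolding * by (simp add: algebra_simps)
        qed
        also have "\<dots> = D - (D * \<rho> + 2) * u - ((g - \<rho>) + 2) * ((g - \<rho>) - 1) * u
            + ((g - \<rho>) + 2) * ((g - \<rho>) - 1) * v"
          unfolding u uv by (simp only: right_diff_distrib mult_1_right) simp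
        also have "\<dots> = (D - c) + R0 * u + R1 * v"
          unfolding e1 e2 by (simp add: a_def R0_def R1_def Dn algebra_simps)
        finally show ?thesis by (simp add: u_def v_def)
      qed
      then show ?thesis unfolding s_def r.n_def r.D_def n_def[symmetric] D_def[symmetric]
          g_def[symmetric] px by simp
    qed
    finally show ?thesis .
  qed
  have "(s has_field_derivative (n - 1) / 6 * (R0 / (p z + \<rho>)\<^sup>2 + R1 / (c + (p z + \<rho>))\<^sup>2)) (at (p z))"
    (is "(s has_field_derivative ?s') _")
  proof -
    have inv: "((\<lambda>x. a / h x) has_field_derivative - (a / (h x)\<^sup>2)) (at x)"
      if "(h has_field_derivative 1) (at x)" "h x \<noteq> 0" for a x and h :: "complex \<Rightarrow> complex"
      using DERIV_divide[OF DERIV_const that, of a] by (simp add: power2_eq_square)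
    have 1: "((\<lambda>x. x + \<rho>) has_field_derivative 1) (at (p z))"
      "((\<lambda>x. c + (x + \<rho>)) has_field_derivative 1) (at (p z))"
      by (auto intro!: derivative_eq_intros)
    show ?thesis unfolding s_def
      by (rule DERIV_cong[OF DERIV_cmult[OF DERIV_diff[OF DERIV_diff[OF DERIV_const
          inv[OF 1(1) nz(1)[OF z]]] inv[OF 1(2) nz(2)[OF z]]]]]) simp
  qed
  from has_d_compose1[OF holomorphic2_has_dd[OF p_hol z] this]
  have "has_d (\<lambda>x. s (p x)) (cscale ((n - 1) / 6 * (R0 / (p z + \<rho>)\<^sup>2 + R1 / (c + (p z + \<rho>))\<^sup>2)) (dd p z)) z"
    by (simp add: cscale_def)
  from has_d_imp_dd[OF has_d_transform[OF this openU z S[symmetric]]]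
  have "dd (\<lambda>x. \<Sum>(r, s, t)\<in>w.triples. w.\<beta> r s t x) z
    = cscale ((n - 1) / 6 * (R0 / (p z + \<rho>)\<^sup>2 + R1 / (c + (p z + \<rho>))\<^sup>2)) (dd p z)" by blast
  then have "curvature d \<theta> z = ((n - 1) / 6 * (R0 / (p z + \<rho>)\<^sup>2 + R1 / (c + (p z + \<rho>))\<^sup>2)) * J z"
    unfolding w.curvature_eq[OF z] by (simp only: wedge_cscale J_def)
  then show "curvature d \<theta> z = J z * (of_nat (d - 2) / 6) *
     (- (\<rho> * (\<rho> + of_nat (d - 1))) / (p z + \<rho>)\<^sup>2
       + (\<rho> + c - 2) * (\<rho> + c + 1) / (c + (p z + \<rho>))\<^sup>2)"
    unfolding n1 R0_def R1_def n_def[symmetric] by simp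
qed

end

text \<open>Eliminating \<open>c x\<^bsup>d-1\<^esup>\<close> between the trinomial and its derivative shows that \<open>1\<close> is the only possible
  multiple root, and the value at \<open>1\<close> is \<open>c + g\<close>.\<close>

lemma trinomial_has_distinct_roots:
  fixes c g :: complex
  assumes d: "d \<ge> 3" and c: "c \<noteq> 0" and g: "g \<noteq> 0" "c + g \<noteq> 0"
  obtains t where "inj_on t {..<d}"
    "\<And>i. i < d \<Longrightarrow> c * t i ^ d + g * (of_nat d * t i - of_nat (d - 1)) = 0"
    "\<And>i. i < d \<Longrightarrow> of_nat d * c * t i ^ (d - 1) + g * of_nat d \<noteq> 0"
proof -
  let ?f = "trinomial d c g"
  have df: "poly (pderiv ?f) x = of_nat d * c * x ^ (d - 1) + g * of_nat d" for x
    by (simp add: trinomial_def pderiv_add pderiv_monom pderiv_pCons poly_monom)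
  have cd: "coeff ?f d = c"
    using d by (cases d; cases "d - 1") (auto simp: trinomial_def coeff_pCons split: nat.splits)
  have f0: "?f \<noteq> 0" using cd c by auto
  have dle: "degree ?f \<le> d"
    unfolding trinomial_def using d
    by (intro degree_add_le) (auto simp: degree_monom_le intro: order_trans)
  have deg: "degree ?f = d" using dle le_degree[of ?f d] cd c by auto
  have simple: "poly (pderiv ?f) x \<noteq> 0" if x: "poly ?f x = 0" for x
  proof
    assume h: "poly (pderiv ?f) x = 0"
    have xd: "x ^ d = x * x ^ (d - 1)" using d by (cases d) auto
    have "of_nat d * c * x ^ (d - 1) + g * of_nat d = 0" using h unfolding df .
    then have "of_nat d * (c * x ^ (d - 1) + g) = 0" by (simp only: distrib_left mult_ac)
    then have e: "c * x ^ (d - 1) = - g" using d by (simp add: eq_neg_iff_add_eq_0)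
    have "x * (c * x ^ (d - 1)) + g * (of_nat d * x - of_nat (d - 1)) = 0"
      using x unfolding poly_trinomial xd by (simp add: mult_ac)
    then have "g * of_nat (d - 1) * (x - 1) = 0"
      unfolding e using d by (simp add: of_nat_diff algebra_simps)
    then have "x = 1" using g d by simp
    then show False using e g by (simp add: add_eq_0_iff2)
  qed
  have "rsquarefree ?f" unfolding rsquarefree_roots using simple by blast
  then have "?f = smult (lead_coeff ?f) (\<Prod>x\<in>{x. poly ?f x = 0}. [:- x, 1:])"
    using complex_poly_decompose_rsquarefree[of ?f] by simp
  then have "degree ?f = degree (\<Prod>x\<in>{x. poly ?f x = 0}. [:- x, 1:])"
    using f0 by (metis degree_smult_eq leading_coeff_0_iff)
  also have "\<dots> = card {x. poly ?f x = 0}" by (subst degree_prod_eq_sum_degree) auto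
  finally have card: "card {x. poly ?f x = 0} = d" using deg by simp
  obtain t where t: "bij_betw t {..<d} {x. poly ?f x = 0}"
    using ex_bij_betw_nat_finite[OF poly_roots_finite[OF f0]] card by (auto simp: atLeast0LessThan)
  show ?thesis
  proof (rule that)
    show "inj_on t {..<d}" using t by (simp add: bij_betw_def)
    fix i assume "i < d"
    then have r: "poly ?f (t i) = 0" using bij_betwE[OF t] by auto
    then show "c * t i ^ d + g * (of_nat d * t i - of_nat (d - 1)) = 0" by (simp add: poly_trinomial)
    show "of_nat d * c * t i ^ (d - 1) + g * of_nat d \<noteq> 0" using simple[OF r] unfolding df .
  qed
qed

text \<open>The equation is linear in \<open>p\<close>: solving it gives \<open>p = G(t)\<close> with \<open>G\<close> holomorphic, and a simple root is
  a point where \<open>G\<close> can be inverted.\<close>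

lemma root_branch:
  assumes d: "d \<ge> 3" and c: "c \<noteq> 0"
    and root: "c * t0 ^ d + (p0 + \<rho>) * (of_nat d * t0 - of_nat (d - 1)) = 0"
    and simple: "of_nat d * c * t0 ^ (d - 1) + (p0 + \<rho>) * of_nat d \<noteq> 0"
  obtains V h where "open V" "p0 \<in> V" "h holomorphic_on V" "h p0 = t0"
    "\<And>p. p \<in> V \<Longrightarrow> c * h p ^ d + (p + \<rho>) * (of_nat d * h p - of_nat (d - 1)) = 0"
proof -
  let ?n = "of_nat (d - 1) :: complex" and ?D = "of_nat d :: complex"
  define S where "S = {t. ?D * t - ?n \<noteq> 0}"
  define G where "G = (\<lambda>t. - c * t ^ d / (?D * t - ?n) - \<rho>)"
  have "open S" unfolding S_def by (intro open_Collect_neq continuous_intros)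
  have hG: "G holomorphic_on S" unfolding G_def S_def by (intro holomorphic_intros) auto
  have t0: "t0 \<in> S"
  proof (rule ccontr)
    assume "t0 \<notin> S"
    then have e: "?D * t0 = ?n" by (simp add: S_def)
    then have "c * t0 ^ d = 0" using root by simp
    then have "t0 = 0" using c by simp
    then show False using e d by simp
  qed
  have Geq: "c * t ^ d + (G t + \<rho>) * (?D * t - ?n) = 0" if "t \<in> S" for t
    using that by (simp add: G_def S_def)
  have Gt0: "G t0 = p0"
  proof -
    have "(G t0 - p0) * (?D * t0 - ?n) = (c * t0 ^ d + (G t0 + \<rho>) * (?D * t0 - ?n))
        - (c * t0 ^ d + (p0 + \<rho>) * (?D * t0 - ?n))" by (simp add: algebra_simps)
    then have "(G t0 - p0) * (?D * t0 - ?n) = 0" unfolding Geq[OF t0] root by simp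
    then show ?thesis using t0 by (simp add: S_def)
  qed
  have "deriv G t0 \<noteq> 0"
  proof
    assume "deriv G t0 = 0"
    then have G': "(G has_field_derivative 0) (at t0)"
      using holomorphic_derivI[OF hG \<open>open S\<close> t0] by simp
    have "((\<lambda>t. c * t ^ d + (G t + \<rho>) * (?D * t - ?n)) has_field_derivative
       c * (?D * t0 ^ (d - 1)) + (p0 + \<rho>) * ?D) (at t0)"
      by (rule derivative_eq_intros G' refl | simp add: Gt0)+
    moreover have "((\<lambda>t. c * t ^ d + (G t + \<rho>) * (?D * t - ?n)) has_field_derivative 0) (at t0)"
      by (rule has_field_derivative_transform_within_open[OF DERIV_const[of 0] \<open>open S\<close> t0])
         (rule Geq[symmetric])
    ultimately have "c * (?D * t0 ^ (d - 1)) + (p0 + \<rho>) * ?D = 0" by (rule DERIV_unique)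
    then show False using simple by (simp add: mult_ac)
  qed
  from has_complex_derivative_locally_invertible[OF hG t0 \<open>open S\<close> this]
  obtain r where r: "r > 0" "ball t0 r \<subseteq> S" "open (G ` ball t0 r)" "inj_on G (ball t0 r)" by metis
  obtain h where h: "h holomorphic_on (G ` ball t0 r)" "\<And>z. z \<in> ball t0 r \<Longrightarrow> h (G z) = z"
    using holomorphic_has_inverse[OF holomorphic_on_subset[OF hG r(2)] open_ball r(4)] by metis
  show ?thesis
  proof (rule that[OF r(3) _ h(1)])
    show "p0 \<in> G ` ball t0 r" using Gt0 r(1) by force
    show "h p0 = t0" using h(2)[of t0] Gt0 r(1) by simp
    fix p assume "p \<in> G ` ball t0 r"
    then obtain t where t: "t \<in> ball t0 r" "p = G t" by blast
    then show "c * h p ^ d + (p + \<rho>) * (?D * h p - ?n) = 0"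
      using Geq[of t] h(2) r(2) by auto
  qed
qed

lemma trinomial_homogeneous:
  assumes "trinomial_roots d c g t"
  shows "c * (\<Prod>i<d. Y - t i * x) = c * Y ^ d + g * famB d x Y"
proof -
  interpret trinomial_roots d c g t by fact
  show ?thesis
  proof (cases "x = 0")
    case True
    then show ?thesis using d by (simp add: famB_def)
  next
    case False
    have "c * (\<Prod>i<d. Y - t i * x) = c * (\<Prod>i<d. x * (Y / x - t i))"
      using False by (simp add: right_diff_distrib mult.commute)
    also have "\<dots> = x ^ d * (c * (\<Prod>i<d. Y / x - t i))" by (simp add: prod.distrib)
    also have "\<dots> = x ^ d * (c * (Y / x) ^ d + g * (D * (Y / x) - n))" unfolding prod_eq ..
    also have "\<dots> = c * Y ^ d + g * (x ^ (d - 1) * (D * Y - n * x))"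
    proof -
      have "x ^ d = x ^ (d - 1) * x" using d by (cases d) auto
      moreover have "x ^ d * (c * (Y / x) ^ d) = c * Y ^ d" using False by (simp add: power_divide)
      moreover have "x * (D * (Y / x) - n) = D * Y - n * x" using False by (simp add: field_simps)
      ultimately show ?thesis by (simp only: distrib_left mult.assoc mult.left_commute[of _ g])
    qed
    finally show ?thesis by (simp add: famB_def D_def n_def)
  qed
qed

text \<open>The chart of the dual plane with coordinates \<open>(p, q)\<close>: the line \<open>p x - y - q = 0\<close>.\<close>

definition dual_chart :: "complex^3^3" where
  "dual_chart = vector [vector [1, 0, 0], vector [0, 0, -1], vector [0, -1, 0]]"

lemma dual_chart_mult: "dual_chart *v vector [u, v, w] = vector [u, - w, - v]"
  by (simp add: vec_eq_iff forall_3 matrix_vector_mult_def sum_3 dual_chart_def)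

lemma det_dual_chart: "det dual_chart = -1"
  by (simp add: det_3 dual_chart_def)

text \<open>Flatness is a condition on local decompositions of the web, so it has consequences only where
  the web can be decomposed. Near a regular value of the Gauss map the branches of its inverse provide
  a decomposition, over an open set of values of \<open>p\<close> and all \<open>q \<noteq> 0\<close>.\<close>

lemma family_web_splits_somewhere:
  assumes d: "d \<ge> 3" and c: "c \<noteq> 0" and \<kappa>: "\<kappa> \<noteq> 0"
  obtains V \<theta> where "open V" "V \<noteq> {}"
    "web_splits d (chart_family_web d \<rho> c \<kappa> dual_chart) (V \<times> (- {0})) \<theta>"
proof -
  \<comment> \<open>This choice gives \<open>g = c\<close>, which avoids the critical values \<open>g = 0\<close> and \<open>g = - c\<close>.\<close>
  define p0 where "p0 = c - \<rho>"
  have g0: "p0 + \<rho> \<noteq> 0" "c + (p0 + \<rho>) \<noteq> 0" using c by (auto simp: p0_def)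
  obtain t0 where t0: "inj_on t0 {..<d}"
    "\<And>i. i < d \<Longrightarrow> c * t0 i ^ d + (p0 + \<rho>) * (of_nat d * t0 i - of_nat (d - 1)) = 0"
    "\<And>i. i < d \<Longrightarrow> of_nat d * c * t0 i ^ (d - 1) + (p0 + \<rho>) * of_nat d \<noteq> 0"
    using trinomial_has_distinct_roots[OF d c g0] by metis
  have "\<forall>i\<in>{..<d}. \<exists>V h. open V \<and> p0 \<in> V \<and> h holomorphic_on V \<and> h p0 = t0 i \<and>
     (\<forall>p\<in>V. c * h p ^ d + (p + \<rho>) * (of_nat d * h p - of_nat (d - 1)) = 0)"
    using root_branch[OF d c t0(2) t0(3)] by (metis lessThan_iff)
  then obtain Vs t where Vt: "\<And>i. i < d \<Longrightarrow> open (Vs i)" "\<And>i. i < d \<Longrightarrow> p0 \<in> Vs i"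
    "\<And>i. i < d \<Longrightarrow> t i holomorphic_on Vs i" "\<And>i. i < d \<Longrightarrow> t i p0 = t0 i"
    "\<And>i p. i < d \<Longrightarrow> p \<in> Vs i \<Longrightarrow> c * t i p ^ d + (p + \<rho>) * (of_nat d * t i p - of_nat (d - 1)) = 0"
    unfolding bchoice_iff by (metis lessThan_iff)
  have ne: "\<forall>\<^sub>F p in nhds p0. t i p \<noteq> t j p" if ij: "i < d" "j < d" "i \<noteq> j" for i j
  proof -
    have "isCont (t k) p0" if "k < d" for k
      using Vt(1-3)[OF that] by (meson continuous_on_eq_continuous_at holomorphic_on_imp_continuous_on)
    then have "((\<lambda>p. t i p - t j p) \<longlongrightarrow> t i p0 - t j p0) (nhds p0)"
      using ij by (intro tendsto_diff) (auto simp: isCont_def tendsto_at_iff_tendsto_nhds)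
    moreover have "t i p0 - t j p0 \<noteq> 0" using Vt(4) t0(1) ij by (auto simp: inj_on_def)
    ultimately have "\<forall>\<^sub>F p in nhds p0. t i p - t j p \<noteq> 0" by (rule tendsto_imp_eventually_ne)
    then show ?thesis by simp
  qed
  have "\<forall>\<^sub>F p in nhds p0. \<forall>i\<in>{..<d}. p \<in> Vs i \<and> (\<forall>j\<in>{..<d}. i \<noteq> j \<longrightarrow> t i p \<noteq> t j p)"
    using Vt(1,2) ne
    by (intro eventually_ball_finite ballI eventually_conj eventually_nhds_in_open)
       (auto intro!: eventually_mono[OF ne])
  then obtain V where V: "open V" "p0 \<in> V"
    "\<And>p i. p \<in> V \<Longrightarrow> i < d \<Longrightarrow> p \<in> Vs i" "\<And>p i j. p \<in> V \<Longrightarrow> i < d \<Longrightarrow> j < d \<Longrightarrow> i \<noteq> j \<Longrightarrow> t i p \<noteq> t j p"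
    unfolding eventually_nhds by (metis lessThan_iff)
  \<comment> \<open>The leading coefficient \<open>\<kappa> c\<close> is absorbed in the first form.\<close>
  define k where "k = (\<lambda>i::nat. if i = 0 then \<kappa> * c else 1)"
  define \<theta> where "\<theta> = (\<lambda>i (z::c2). (k i * - snd z, k i * (fst z - t i (fst z))))"
  let ?U = "V \<times> (- {0}) :: c2 set"
  have k: "k i \<noteq> 0" for i using c \<kappa> by (simp add: k_def)
  have roots: "trinomial_roots d c (p + \<rho>) (\<lambda>i. t i p)" if "p \<in> V" for p
    using d c V(4)[OF that] Vt(5)[OF _ V(3)[OF that]] unfolding trinomial_roots_def inj_on_def by blast
  have pk: "(\<Prod>i<d. k i) = \<kappa> * c"
  proof -
    have "(\<Prod>i<d. k i) = k 0 * (\<Prod>i\<in>{..<d} - {0}. k i)" using d by (subst prod.remove[of _ 0]) auto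
    also have "(\<Prod>i\<in>{..<d} - {0}. k i) = 1" by (intro prod.neutral) (auto simp: k_def)
    finally show ?thesis by (simp add: k_def)
  qed
  have "web_splits d (chart_family_web d \<rho> c \<kappa> dual_chart) ?U \<theta>"
    unfolding web_splits_def
  proof (intro conjI allI impI ballI)
    show "open ?U" by (intro open_Times V open_Compl) auto
    show "holomorphic2 (\<lambda>z. fst (\<theta> i z)) ?U" for i
      unfolding \<theta>_def fst_conv by (intro holomorphic2_intros)
    show "holomorphic2 (\<lambda>z. snd (\<theta> i z)) ?U" if "i < d" for i
    proof -
      have "holomorphic2 (\<lambda>z. t i (fst z)) ?U"
        by (rule holomorphic2_compose1[OF holomorphic2_fst Vt(3)[OF that] Vt(1)[OF that]])
           (use V(3) that in auto)
      then show ?thesis unfolding \<theta>_def snd_conv by (intro holomorphic2_intros) auto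
    qed
    show "wedge (\<theta> i z) (\<theta> j z) \<noteq> 0" if "z \<in> ?U" "i < d" "j < d" "i \<noteq> j" for z i j
    proof -
      have "wedge (\<theta> i z) (\<theta> j z) = k i * k j * snd z * (t j (fst z) - t i (fst z))"
        by (simp add: wedge_def \<theta>_def algebra_simps)
      moreover have "t j (fst z) \<noteq> t i (fst z)" "snd z \<noteq> 0" using V(4)[of "fst z" j i] that by auto
      ultimately show ?thesis using k by simp
    qed
    show "chart_family_web d \<rho> c \<kappa> dual_chart z \<xi> = (\<Prod>i<d. form_apply (\<theta> i z) \<xi>)" if z: "z \<in> ?U" for z \<xi>
    proof -
      obtain p q where pq: "z = (p, q)" by fastforce
      obtain a b where ab: "\<xi> = (a, b)" by fastforce
      let ?Y = "p * b - q * a"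
      have "form_apply (\<theta> i z) \<xi> = k i * (?Y - t i p * b)" for i
        by (simp add: form_apply_def \<theta>_def pq ab algebra_simps)
      then have "(\<Prod>i<d. form_apply (\<theta> i z) \<xi>) = (\<Prod>i<d. k i) * (\<Prod>i<d. ?Y - t i p * b)"
        by (simp add: prod.distrib)
      also have "\<dots> = \<kappa> * (c * (\<Prod>i<d. ?Y - t i p * b))" by (simp add: pk)
      also have "\<dots> = \<kappa> * (c * ?Y ^ d + (p + \<rho>) * famB d b ?Y)"
        using trinomial_homogeneous[OF roots] z pq by simp
      also have "\<dots> = chart_family_web d \<rho> c \<kappa> dual_chart z \<xi>"
        unfolding chart_family_web_def dual_chart_mult by (simp add: fam_web_def famA_def pq ab algebra_simps)
      finally show ?thesis by simp
    qed
  qed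
  then show ?thesis using that[of V \<theta>] V(1,2) by blast
qed

text \<open>If flat, the curvature vanishes on an open set of values of \<open>p\<close>, hence identically as a rational
  function of \<open>p\<close>, and both of its coefficients vanish.\<close>

theorem flat_family:
  assumes d: "d \<ge> 3" and c: "c \<noteq> 0" and \<kappa>: "\<kappa> \<noteq> 0" and K: "invertible K"
    and W: "\<And>l \<xi>. W l \<xi> = \<kappa> * fam_web d \<rho> c (K *v l) (K *v \<xi>)"
  shows "flat_web d W \<longleftrightarrow>
    \<rho> * (\<rho> + of_nat (d - 1)) = 0 \<and> (\<rho> + c - 2) * (\<rho> + c + 1) = 0"
proof
  have chart: "chart_web W N = chart_family_web d \<rho> c \<kappa> (K ** N)" for N
    by (simp add: chart_web_def chart_family_web_def W fun_eq_iff matrix_vector_mul_assoc)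
  {
    assume cond: "\<rho> * (\<rho> + of_nat (d - 1)) = 0 \<and> (\<rho> + c - 2) * (\<rho> + c + 1) = 0"
    show "flat_web d W" unfolding flat_web_def
    proof (intro allI impI ballI)
      fix N U \<theta> z assume N: "invertible N" and sp: "web_splits d (chart_web W N) U \<theta>" and z: "z \<in> U"
      have "invertible (K ** N)" using K N by (rule invertible_mult)
      then have "det (K ** N) \<noteq> 0" by (simp add: invertible_det_nz)
      then interpret split_family d \<rho> c \<kappa> "K ** N" U \<theta>
        using d c \<kappa> sp unfolding chart by unfold_locales
      show "curvature d \<theta> z = 0" unfolding curvature_family(3)[OF z]
        by (simp only: conjunct1[OF cond] conjunct2[OF cond]) simp
    qed
  }
  assume flat: "flat_web d W"
  obtain V \<theta> where V: "open V" "V \<noteq> {}" and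
    sp: "web_splits d (chart_family_web d \<rho> c \<kappa> dual_chart) (V \<times> (- {0})) \<theta>"
    by (rule family_web_splits_somewhere[OF d c \<kappa>])
  obtain K' where K': "K ** K' = mat 1" "K' ** K = mat 1" using K by (auto simp: invertible_def)
  have "invertible K'" using K' by (auto simp: invertible_def)
  moreover have "invertible dual_chart" by (simp add: invertible_det_nz det_dual_chart)
  ultimately have N: "invertible (K' ** dual_chart)" by (rule invertible_mult)
  have KN: "K ** (K' ** dual_chart) = dual_chart" by (simp add: matrix_mul_assoc K')
  have zero: "curvature d \<theta> z = 0" if "z \<in> V \<times> (- {0})" for z
  proof -
    have "web_splits d (chart_web W (K' ** dual_chart)) (V \<times> (- {0})) \<theta>"
      unfolding chart KN by (rule sp)
    from flat[unfolded flat_web_def, rule_format, OF N this that] show ?thesis .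
  qed
  interpret split_family d \<rho> c \<kappa> dual_chart "V \<times> (- {0})" \<theta>
    using d c \<kappa> sp by unfold_locales (auto simp: det_dual_chart)
  define R0 R1 where "R0 = - (\<rho> * (\<rho> + of_nat (d - 1)))" and "R1 = (\<rho> + c - 2) * (\<rho> + c + 1)"
  \<comment> \<open>The numerator \<open>R0 (c + g)\<^sup>2 + R1 g\<^sup>2\<close> of \<open>R0/g\<^sup>2 + R1/(c + g)\<^sup>2\<close> as a polynomial in \<open>g\<close>.\<close>
  define f where "f = [:R0 * c\<^sup>2, 2 * R0 * c, R0 + R1:]"
  have "poly f (x + \<rho>) = 0" if x: "x \<in> V" for x
  proof -
    have z: "(x, 1) \<in> V \<times> (- {0::complex})" using x by simp
    have px: "p (x, 1) = x"
      unfolding p_def l_def by (simp add: dual_chart_def)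
    define g where "g = x + \<rho>"
    note cf = curvature_family[OF z, unfolded px, folded g_def]
    have "d - 2 \<noteq> 0" using d by simp
    then have d2: "(of_nat (d - 2) :: complex) \<noteq> 0" by (simp only: of_nat_eq_0_iff not_False_eq_True)
    have "R0 / g\<^sup>2 + R1 / (c + g)\<^sup>2 = 0"
      using zero[OF z] J_nz[OF z] d2 unfolding cf(3) R0_def R1_def by simp
    then have "R0 * (c + g)\<^sup>2 + R1 * g\<^sup>2 = 0" using cf(1,2) by (simp add: field_simps)
    then have "poly f g = 0" by (simp add: f_def power2_eq_square algebra_simps)
    then show ?thesis by (simp add: g_def)
  qed
  then have sub: "(\<lambda>x. x + \<rho>) ` V \<subseteq> {x. poly f x = 0}" by auto
  have "infinite V" using V finite_imp_not_open by blast
  then have "infinite ((\<lambda>x. x + \<rho>) ` V)" by (subst finite_image_iff) auto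
  then have "f = 0" using sub poly_roots_finite finite_subset by blast
  then have "R0 * c\<^sup>2 = 0" "R0 + R1 = 0" unfolding f_def by auto
  then have "R0 = 0" "R1 = 0" using c by auto
  then show "\<rho> * (\<rho> + of_nat (d - 1)) = 0 \<and> (\<rho> + c - 2) * (\<rho> + c + 1) = 0"
    unfolding R0_def R1_def by simp
qed

section \<open>Germs and intersection numbers with lines\<close>

text \<open>Hadamard's lemma: the quotient is \<open>a(u,v) = \<integral>\<^sub>0\<^sup>1 h\<^sub>v(u, s v) ds\<close>, which is holomorphic because one may
  differentiate under the integral sign.\<close>

lemma holomorphic_divide_snd:
  assumes "h \<in> \<O>"
  shows "\<exists>a\<in>\<O>. \<forall>\<^sub>F z in nhds (0, 0). h z = h (fst z, 0) + snd z * a z"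
proof -
  obtain U where U: "open U" "(0, 0) \<in> U" "holomorphic2 h U" using assms by (auto simp: \<O>_def)
  obtain r where r: "r > 0" "cball 0 r \<times> cball 0 r \<subseteq> U" using cball_polydisc[OF U(1,2)] by metis
  let ?V = "ball 0 r \<times> ball 0 r :: c2 set"
  let ?k = "deriv_v h"
  define a where "a = (\<lambda>z. integral (cbox 0 1) (\<lambda>s. ?k (fst z, of_real s * snd z)))"
  have inU: "(u, of_real s * v) \<in> U" if "u \<in> ball 0 r" "v \<in> ball 0 r" "s \<in> cbox 0 (1::real)" for u v s
  proof -
    have "\<bar>s\<bar> * norm v \<le> 1 * norm v" using that by (intro mult_right_mono) auto
    then have "norm (of_real s * v) \<le> r" using that by (simp add: norm_mult)
    then show ?thesis using r that by auto
  qed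
  have k: "holomorphic2 ?k U" by (rule holomorphic2_deriv_v[OF U(3,1)])
  have ksep: "separately_holomorphic ?k U" using k by (rule holomorphic2_imp_separately)
  have kc: "continuous_on U ?k" using ksep by (simp add: separately_holomorphic_def)
  have kuc: "continuous_on U (deriv_u ?k)" and kvc: "continuous_on U (deriv_v ?k)"
    using continuous_deriv_u[OF ksep U(1)] continuous_deriv_v[OF ksep U(1)] by auto
  have int: "(\<lambda>s. ?k (u, of_real s * v)) integrable_on cbox 0 1" if "u \<in> ball 0 r" "v \<in> ball 0 r" for u v
    by (intro integrable_continuous continuous_on_compose2[OF kc] continuous_intros)
       (use inU that in auto)
  have "continuous_on ?V a"
    unfolding a_def
    by (rule integral_continuous_on_param, unfold case_prod_beta')
       (intro continuous_on_compose2[OF kc] continuous_intros, use inU in auto)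
  moreover have "(\<lambda>t. a (t, v)) field_differentiable (at u)"
    if uv: "u \<in> ball 0 r" "v \<in> ball 0 r" for u v
  proof -
    have "(\<lambda>t. integral (cbox 0 1) (\<lambda>s. ?k (t, of_real s * v))) holomorphic_on ball 0 r"
    proof (rule leibniz_rule_holomorphic)
      show "((\<lambda>t. ?k (t, of_real s * v)) has_field_derivative deriv_u ?k (t, of_real s * v))
          (at t within ball 0 r)" if "t \<in> ball 0 r" "s \<in> cbox 0 1" for t s
        by (rule has_field_derivative_at_within[OF has_deriv_u[OF ksep inU]]) (use that uv in auto)
      show "continuous_on (ball 0 r \<times> cbox 0 1) (\<lambda>(t, s). deriv_u ?k (t, of_real s * v))"
        unfolding case_prod_beta'
        by (intro continuous_on_compose2[OF kuc] continuous_intros) (use inU uv in auto)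
    qed (use int uv in auto)
    then show ?thesis using uv by (simp add: a_def holomorphic_on_imp_differentiable_at)
  qed
  moreover have "(\<lambda>t. a (u, t)) field_differentiable (at v)"
    if uv: "u \<in> ball 0 r" "v \<in> ball 0 r" for u v
  proof -
    have "(\<lambda>t. integral (cbox 0 1) (\<lambda>s. ?k (u, of_real s * t))) holomorphic_on ball 0 r"
    proof (rule leibniz_rule_holomorphic)
      show "((\<lambda>t. ?k (u, of_real s * t)) has_field_derivative deriv_v ?k (u, of_real s * t) * of_real s)
          (at t within ball 0 r)" if t: "t \<in> ball 0 r" "s \<in> cbox 0 1" for t s
      proof (rule has_field_derivative_at_within)
        have "(u, of_real s * t) \<in> U" using inU uv t by blast
        then have "((\<lambda>x. ?k (u, x)) has_field_derivative deriv_v ?k (u, of_real s * t)) (at (of_real s * t))"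
          by (rule has_deriv_v[OF ksep])
        from DERIV_chain2[where f="\<lambda>x. ?k (u, x)" and g="\<lambda>t. of_real s * t", OF this]
        show "((\<lambda>t. ?k (u, of_real s * t)) has_field_derivative deriv_v ?k (u, of_real s * t) * of_real s) (at t)"
          by (simp add: DERIV_cmult_Id)
      qed
      show "continuous_on (ball 0 r \<times> cbox 0 1) (\<lambda>(t, s). deriv_v ?k (u, of_real s * t) * of_real s)"
        unfolding case_prod_beta'
        by (intro continuous_intros continuous_on_compose2[OF kvc]) (use inU uv in auto)
    qed (use int uv in auto)
    then show ?thesis using uv by (simp add: a_def holomorphic_on_imp_differentiable_at)
  qed
  ultimately have "separately_holomorphic a ?V" by (auto simp: separately_holomorphic_def)
  then have "holomorphic2 a ?V" by (rule separately_imp_holomorphic2) (simp add: open_Times)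
  then have "a \<in> \<O>" using r by (auto simp: \<O>_def intro!: exI[of _ ?V] open_Times)
  moreover have "h z = h (fst z, 0) + snd z * a z" if zV: "z \<in> ?V" for z
  proof -
    obtain u v where z: "z = (u, v)" by fastforce
    have uv: "u \<in> ball 0 r" "v \<in> ball 0 r" using zV z by auto
    have hsep: "separately_holomorphic h U" using U(3) by (rule holomorphic2_imp_separately)
    have "((\<lambda>s. v * ?k (u, of_real s * v)) has_integral h (u, of_real 1 * v) - h (u, of_real 0 * v)) {0..1}"
    proof (rule fundamental_theorem_of_calculus)
      fix s :: real assume s: "s \<in> {0..1}"
      have "(u, of_real s * v) \<in> U" using inU uv s by simp
      then have 1: "((\<lambda>x. h (u, x)) has_field_derivative ?k (u, of_real s * v)) (at (of_real s * v))"
        by (rule has_deriv_v[OF hsep])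
      have "((\<lambda>s. of_real s * v) has_vector_derivative v) (at s within {0..1})"
        by (auto intro!: derivative_eq_intros)
      from field_vector_diff_chain_within[OF this has_field_derivative_at_within[OF 1]]
      show "((\<lambda>s. h (u, of_real s * v)) has_vector_derivative v * ?k (u, of_real s * v)) (at s within {0..1})"
        by (simp add: o_def)
    qed simp
    from integral_unique[OF this]
    have "integral {0..1} (\<lambda>s. v * ?k (u, of_real s * v)) = h (u, v) - h (u, 0)" by simp
    then have "h (u, v) - h (u, 0) = integral {0..1} (\<lambda>s. v * ?k (u, of_real s * v))" by (rule sym)
    also have "\<dots> = v * a (u, v)" by (simp add: a_def)
    finally show ?thesis using z by (simp add: algebra_simps)
  qed
  then have "\<forall>\<^sub>F z in nhds (0, 0). h z = h (fst z, 0) + snd z * a z"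
    using r by (auto simp: eventually_nhds intro!: exI[of _ ?V] open_Times)
  ultimately show ?thesis by blast
qed

text \<open>Gaussian elimination: a homogeneous linear system with more unknowns than equations has a
  nontrivial solution.\<close>

lemma homogeneous_system_solvable:
  fixes a :: "'i \<Rightarrow> 'j \<Rightarrow> complex"
  assumes "finite J" "finite I" "card J < card I"
  shows "\<exists>c. (\<exists>i\<in>I. c i \<noteq> 0) \<and> (\<forall>j\<in>J. (\<Sum>i\<in>I. c i * a i j) = 0)"
  using assms
proof (induction J arbitrary: I a rule: finite_induct)
  case empty
  then have "I \<noteq> {}" by auto
  then show ?case by (intro exI[of _ "\<lambda>_. 1"]) auto
next
  case (insert j J)
  show ?case
  proof (cases "\<forall>i\<in>I. a i j = 0")
    case True
    have "card J < card I" using insert by simp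
    from insert.IH[OF insert.prems(1) this, of a] obtain c where
      c: "\<exists>i\<in>I. c i \<noteq> 0" "\<forall>j\<in>J. (\<Sum>i\<in>I. c i * a i j) = 0" by blast
    then show ?thesis using True by (intro exI[of _ c]) auto
  next
    case False
    then obtain k where k: "k \<in> I" "a k j \<noteq> 0" by auto
    let ?I = "I - {k}"
    let ?a = "\<lambda>i j'. a i j' - a i j / a k j * a k j'"
    have "card J < card ?I" "finite ?I" using insert k by auto
    from insert.IH[OF this(2,1), of ?a] obtain c where
      c: "\<exists>i\<in>?I. c i \<noteq> 0" "\<forall>j'\<in>J. (\<Sum>i\<in>?I. c i * ?a i j') = 0" by blast
    define c' where "c' = (\<lambda>i. if i = k then - (\<Sum>i\<in>?I. c i * a i j) / a k j else c i)"
    have sum: "(\<Sum>i\<in>I. c' i * a i j') = (\<Sum>i\<in>?I. c i * ?a i j')" for j'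
    proof -
      have "(\<Sum>i\<in>I. c' i * a i j') = c' k * a k j' + (\<Sum>i\<in>?I. c' i * a i j')"
        using insert.prems(1) k by (simp add: sum.remove)
      also have "(\<Sum>i\<in>?I. c' i * a i j') = (\<Sum>i\<in>?I. c i * a i j')"
        by (intro sum.cong) (auto simp: c'_def)
      also have "c' k * a k j' = - (\<Sum>i\<in>?I. c i * (a i j / a k j * a k j'))"
        by (simp add: c'_def sum_divide_distrib sum_distrib_right sum_distrib_left mult_ac)
      finally show ?thesis by (simp add: right_diff_distrib sum_subtractf)
    qed
    have "(\<Sum>i\<in>I. c' i * a i j') = 0" if "j' \<in> insert j J" for j'
      using that c(2) k(2) unfolding sum by (cases "j' = j") auto
    moreover have "\<exists>i\<in>I. c' i \<noteq> 0" using c(1) by (auto simp: c'_def)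
    ultimately show ?thesis by blast
  qed
qed

lemma germ_cong_nhds: "filterlim \<phi> (nhds (0,0)) (nhds (0,0)) \<Longrightarrow> \<forall>\<^sub>F z in nhds (0,0). P z \<Longrightarrow>
   \<forall>\<^sub>F z in nhds (0,0). P (\<phi> z)"
  by (rule eventually_compose_filterlim)

lemma germ_compose_linear:
  assumes "h \<in> \<O>"
  shows "(\<lambda>z. h (a * fst z + b * snd z, c * fst z + e * snd z)) \<in> \<O>"
proof -
  obtain U where U: "open U" "(0, 0) \<in> U" "holomorphic2 h U" using assms by (auto simp: \<O>_def)
  let ?\<phi> = "\<lambda>z::c2. (a * fst z + b * snd z, c * fst z + e * snd z)"
  have "continuous_on UNIV ?\<phi>" by (intro continuous_intros)
  then have "open (?\<phi> -` U)" using U(1) by (simp add: open_vimage)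
  moreover have "holomorphic2 (\<lambda>z. h (a * fst z + b * snd z, c * fst z + e * snd z)) (?\<phi> -` U)"
    by (rule holomorphic2_compose2[OF U(3)]) (auto intro!: holomorphic2_intros)
  ultimately show ?thesis using U(2) unfolding \<O>_def by (intro CollectI exI[of _ "?\<phi> -` U"]) auto
qed

lemma germ_mult: assumes "f \<in> \<O>" "g \<in> \<O>" shows "(\<lambda>z. f z * g z) \<in> \<O>"
proof -
  obtain U V where "open U" "(0, 0) \<in> U" "holomorphic2 f U" "open V" "(0, 0) \<in> V" "holomorphic2 g V"
    using assms unfolding \<O>_def by blast
  then show ?thesis unfolding \<O>_def
    by (intro CollectI exI[of _ "U \<inter> V"]) (auto intro!: holomorphic2_mult intro: holomorphic2_subset)
qed

lemma germ_diff: assumes "f \<in> \<O>" "g \<in> \<O>" shows "(\<lambda>z. f z - g z) \<in> \<O>"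
proof -
  obtain U V where "open U" "(0, 0) \<in> U" "holomorphic2 f U" "open V" "(0, 0) \<in> V" "holomorphic2 g V"
    using assms unfolding \<O>_def by blast
  then show ?thesis unfolding \<O>_def
    by (intro CollectI exI[of _ "U \<inter> V"]) (auto intro!: holomorphic2_diff intro: holomorphic2_subset)
qed

lemma germ_sum:
  assumes "finite I" "\<And>i. i \<in> I \<Longrightarrow> f i \<in> \<O>"
  shows "(\<lambda>z. \<Sum>i\<in>I. c i * f i z) \<in> \<O>"
  using assms
proof (induction I rule: finite_induct)
  case empty
  show ?case unfolding \<O>_def by (auto intro!: exI[of _ UNIV] holomorphic2_const)
next
  case (insert i I)
  obtain U V where "open U" "(0, 0) \<in> U" "holomorphic2 (f i) U" "open V" "(0, 0) \<in> V"
     "holomorphic2 (\<lambda>z. \<Sum>i\<in>I. c i * f i z) V"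
    using insert unfolding \<O>_def by blast
  then show ?case using insert unfolding \<O>_def
    by (intro CollectI exI[of _ "U \<inter> V"])
       (auto intro!: holomorphic2_add holomorphic2_mult holomorphic2_const intro: holomorphic2_subset)
qed

lemma germ_of_linear:
  assumes "k holomorphic_on ball 0 r" "r > 0"
  shows "(\<lambda>z. k (a * fst z + b * snd z)) \<in> \<O>"
proof -
  let ?\<phi> = "\<lambda>z::c2. a * fst z + b * snd z"
  have "continuous_on UNIV ?\<phi>" by (intro continuous_intros)
  then have "open (?\<phi> -` ball 0 r)" by (simp add: open_vimage)
  moreover have "holomorphic2 (\<lambda>z. k (?\<phi> z)) (?\<phi> -` ball 0 r)"
    by (rule holomorphic2_compose1[OF _ assms(1)]) (auto intro!: holomorphic2_intros)
  ultimately show ?thesis using assms(2) unfolding \<O>_def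
    by (intro CollectI exI[of _ "?\<phi> -` ball 0 r"]) auto
qed

lemma germ_slice:
  assumes "h \<in> \<O>"
  shows "\<exists>r>0. (\<lambda>s. h (s * a, s * b)) holomorphic_on ball 0 r"
proof -
  obtain U where U: "open U" "(0, 0) \<in> U" "holomorphic2 h U" using assms by (auto simp: \<O>_def)
  let ?\<phi> = "\<lambda>s::complex. (s * a, s * b)"
  have "continuous_on UNIV ?\<phi>" by (intro continuous_intros)
  then have op: "open (?\<phi> -` U)" using U(1) by (simp add: open_vimage)
  then obtain r where r: "r > 0" "ball 0 r \<subseteq> ?\<phi> -` U"
    using U(2) open_contains_ball_eq[OF op, of 0] by auto
  have "(\<lambda>s. h (s * a, s * b)) field_differentiable (at s within ball 0 r)" if "s \<in> ball 0 r" for s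
  proof -
    have "(s * a, s * b) \<in> U" using that r by auto
    from holomorphic2_has_dd[OF U(3) this]
    have "has_d h (dd h (s * a, s * b)) ((\<lambda>z. fst z * a) (s, 0), (\<lambda>z. fst z * b) (s, 0))" by simp
    from has_d_compose2[OF this has_d_mult[OF has_d_fst has_d_const] has_d_mult[OF has_d_fst has_d_const]]
    obtain w where "has_d (\<lambda>z. h (fst z * a, fst z * b)) w (s, 0)" by blast
    from has_d_slices(1)[OF this] have "(\<lambda>s. h (s * a, s * b)) field_differentiable (at s)"
      by (auto simp: field_differentiable_def)
    then show ?thesis by (rule field_differentiable_at_within)
  qed
  then show ?thesis using r(1) by (auto simp: holomorphic_on_def)
qed

text \<open>The quotient has the shifted power series; the value at \<open>0\<close> must be prescribed.\<close>

lemma power_series_divide: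
  assumes r: "r > 0" and s: "\<And>w. w \<in> ball 0 r \<Longrightarrow> (\<lambda>n. a n * w ^ n) sums f w"
    and z: "\<And>j. j < N \<Longrightarrow> a j = (0::complex)"
  shows "\<exists>k. k holomorphic_on ball 0 r \<and> (\<forall>w\<in>ball 0 r. f w = w ^ N * k w)"
proof -
  define k where "k = (\<lambda>w. if w = 0 then a N else f w / w ^ N)"
  have ks: "(\<lambda>n. a (n + N) * (w - 0) ^ n) sums k w" if w: "w \<in> ball 0 r" for w
  proof (cases "w = 0")
    case True
    then show ?thesis using powser_sums_zero[of "\<lambda>n. a (n + N)"] by (simp add: k_def)
  next
    case False
    have "(\<lambda>n. a (n + N) * w ^ (n + N)) sums (f w - (\<Sum>i<N. a i * w ^ i))"
      using sums_split_initial_segment[OF s[OF w], of N] by simp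
    moreover have "(\<Sum>i<N. a i * w ^ i) = 0" using z by simp
    ultimately have "(\<lambda>n. a (n + N) * w ^ (n + N) / w ^ N) sums (f w / w ^ N)"
      using sums_divide[of _ "f w" "w ^ N"] by simp
    then show ?thesis using False by (simp add: k_def power_add)
  qed
  have "k holomorphic_on ball 0 r" by (rule power_series_holomorphic) (rule ks)
  moreover have "f w = w ^ N * k w" if w: "w \<in> ball 0 r" for w
  proof (cases "w = 0")
    case True
    have "f 0 = a 0" using sums_unique2[OF s[of 0] powser_sums_zero] r by simp
    then show ?thesis using True z[of 0] by (cases N) (auto simp: k_def)
  qed (simp add: k_def)
  ultimately show ?thesis by blast
qed

text \<open>Vanishing to order \<open>N\<close> along the line imposes \<open>N\<close> linear conditions on the \<open>N + 1\<close> coefficients, namely on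
  the Taylor coefficients of the restrictions.\<close>

lemma combination_vanishing_on_line:
  assumes "\<And>i. i \<le> N \<Longrightarrow> h i \<in> \<O>"
  obtains c k r where "\<exists>i\<le>N. c i \<noteq> (0::complex)" "r > 0" "k holomorphic_on ball 0 r"
    "\<And>s. s \<in> ball 0 r \<Longrightarrow> (\<Sum>i\<le>N. c i * h i (s * a, s * b)) = s ^ N * k s"
proof -
  define f where "f = (\<lambda>i s. h i (s * a, s * b))"
  define A where "A = (\<lambda>i n. (deriv ^^ n) (f i) 0 / fact n)"
  have "\<forall>\<^sub>F s in nhds 0. (\<lambda>n. A i n * s ^ n) sums f i s" if i: "i \<le> N" for i
  proof -
    obtain r where r: "r > 0" "f i holomorphic_on ball 0 r"
      using germ_slice[OF assms[OF i], of a b] by (auto simp: f_def)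
    have "(\<lambda>n. A i n * s ^ n) sums f i s" if "s \<in> ball 0 r" for s
      using holomorphic_power_series[OF r(2) that] by (simp add: A_def)
    then show ?thesis using r(1) by (auto simp: eventually_nhds intro!: exI[of _ "ball 0 r"])
  qed
  then have "\<forall>\<^sub>F s in nhds 0. \<forall>i\<in>{..N}. (\<lambda>n. A i n * s ^ n) sums f i s"
    by (intro eventually_ball_finite) auto
  then obtain r where r: "r > 0" "\<And>s i. s \<in> ball 0 r \<Longrightarrow> i \<le> N \<Longrightarrow> (\<lambda>n. A i n * s ^ n) sums f i s"
    unfolding eventually_nhds_metric by (auto simp: dist_commute)
  obtain c where c: "\<exists>i\<in>{..N}. c i \<noteq> 0" "\<forall>j\<in>{..<N}. (\<Sum>i\<in>{..N}. c i * A i j) = 0"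
    using homogeneous_system_solvable[of "{..<N}" "{..N}" A] by auto
  have "(\<lambda>n. (\<Sum>i\<le>N. c i * A i n) * s ^ n) sums (\<Sum>i\<le>N. c i * f i s)" if "s \<in> ball 0 r" for s
  proof -
    have "(\<lambda>n. \<Sum>i\<le>N. c i * (A i n * s ^ n)) sums (\<Sum>i\<le>N. c i * f i s)"
      using r(2)[OF that] by (intro sums_sum sums_mult) auto
    then show ?thesis by (simp add: sum_distrib_right mult.assoc)
  qed
  from power_series_divide[OF r(1) this, of N] c(2) obtain k where
    "k holomorphic_on ball 0 r" "\<forall>s\<in>ball 0 r. (\<Sum>i\<le>N. c i * f i s) = s ^ N * k s" by auto
  then show ?thesis using that[of c r k] c(1) r(1) by (auto simp: f_def)
qed

text \<open>The linear coordinates \<open>b u - a v\<close> and \<open>l u + m v\<close> are inverse to the basis \<open>(m, - l)\<close>, \<open>(a, b)\<close>: the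
  first one parametrizes the line, the second one is its equation.\<close>

lemma line_coordinates:
  assumes ab: "l * a + m * b = (1 :: complex)"
  shows "(b * u - a * v) * m + (l * u + m * v) * a = u"
    and "(b * u - a * v) * - l + (l * u + m * v) * b = v"
proof -
  have "(b * u - a * v) * m + (l * u + m * v) * a = u * (l * a + m * b)" by (simp add: algebra_simps)
  then show "(b * u - a * v) * m + (l * u + m * v) * a = u" using ab by simp
  have "(b * u - a * v) * - l + (l * u + m * v) * b = v * (l * a + m * b)" by (simp add: algebra_simps)
  then show "(b * u - a * v) * - l + (l * u + m * v) * b = v" using ab by simp
qed

lemma complementary_vector:
  assumes "(l, m) \<noteq> (0, 0 :: complex)"
  obtains a b where "l * a + m * b = 1"
  using assms that[of "1 / l" 0] that[of 0 "1 / m"] by (cases "l = 0") auto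

lemma divide_by_line:
  assumes "h \<in> \<O>"
    and 1: "\<And>u v. (b * u - a * v) * m + (l * u + m * v) * a = u"
    and 2: "\<And>u v. (b * u - a * v) * - l + (l * u + m * v) * b = v"
  shows "\<exists>k\<in>\<O>. \<forall>\<^sub>F z in nhds (0, 0). h z =
     h ((b * fst z - a * snd z) * m, (b * fst z - a * snd z) * - l) + (l * fst z + m * snd z) * k z"
proof -
  let ?g = "\<lambda>z. h (m * fst z + a * snd z, - l * fst z + b * snd z)"
  have "?g \<in> \<O>" by (rule germ_compose_linear[OF assms(1)])
  from holomorphic_divide_snd[OF this] obtain k where k: "k \<in> \<O>"
    "\<forall>\<^sub>F z in nhds (0, 0). ?g z = ?g (fst z, 0) + snd z * k z" by blast
  let ?\<phi> = "\<lambda>z::c2. (b * fst z + (- a) * snd z, l * fst z + m * snd z)"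
  have "filterlim ?\<phi> (nhds (?\<phi> (0,0))) (nhds (0, 0))"
    by (auto intro!: tendsto_eq_intros filterlim_ident)
  then have "filterlim ?\<phi> (nhds (0,0)) (nhds (0, 0))" by simp
  from germ_cong_nhds[OF this k(2)]
  have "\<forall>\<^sub>F z in nhds (0, 0). h z =
     h ((b * fst z - a * snd z) * m, (b * fst z - a * snd z) * - l) + (l * fst z + m * snd z) * k (?\<phi> z)"
  proof (rule eventually_mono)
    fix z :: c2
    have e: "m * fst (?\<phi> z) + a * snd (?\<phi> z) = fst z" "- l * fst (?\<phi> z) + b * snd (?\<phi> z) = snd z"
      using 1[of "fst z" "snd z"] 2[of "fst z" "snd z"] by (simp_all add: mult.commute)
    assume "?g (?\<phi> z) = ?g (fst (?\<phi> z), 0) + snd (?\<phi> z) * k (?\<phi> z)"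
    then show "h z = h ((b * fst z - a * snd z) * m, (b * fst z - a * snd z) * - l)
       + (l * fst z + m * snd z) * k (?\<phi> z)"
      unfolding e by (simp add: mult.commute)
  qed
  moreover have "(\<lambda>z. k (?\<phi> z)) \<in> \<O>" by (rule germ_compose_linear[OF k(1)])
  ultimately show ?thesis by (intro bexI[of _ "\<lambda>z. k (?\<phi> z)"])
qed

text \<open>Modulo the equation \<open>f\<close> of the line every germ is determined by its restriction to the line, on which
  \<open>g\<close> becomes \<open>s\<^bsup>N\<^esup>\<close> times a unit. Hence \<open>\<O>/\<langle>f, g\<rangle>\<close> is isomorphic to \<open>\<complex>{s}/\<langle>s\<^bsup>N\<^esup>\<rangle>\<close>, of dimension \<open>N\<close>.\<close>

theorem quot_dim_line:
  assumes lm: "(l, m) \<noteq> (0, 0)" and g: "g \<in> \<O>"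
    and R: "R holomorphic_on ball 0 \<epsilon>" "\<epsilon> > 0" "R 0 \<noteq> 0"
    and gR: "\<And>s. s \<in> ball 0 \<epsilon> \<Longrightarrow> g (s * m, s * - l) = s ^ N * R s"
  shows "quot_dim \<O> (germ_ideal (line_fun l m) g) = enat N"
proof -
  obtain a b where ab: "l * a + m * b = 1" by (rule complementary_vector[OF lm])
  note 1 = line_coordinates(1)[OF ab] and 2 = line_coordinates(2)[OF ab]
  define x where "x = (\<lambda>z::c2. b * fst z - a * snd z)"
  have f: "line_fun l m z = l * fst z + m * snd z" for z by (simp add: line_fun_def case_prod_beta)
  have x_lim: "(x \<longlongrightarrow> 0) (nhds (0, 0))"
  proof -
    have "(x \<longlongrightarrow> x (0, 0)) (nhds (0, 0))" unfolding x_def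
      by (auto intro!: tendsto_eq_intros filterlim_ident)
    then show ?thesis by (simp add: x_def)
  qed
  have near: "\<forall>\<^sub>F z in nhds (0, 0). x z \<in> ball 0 e" if "e > 0" for e
    using topological_tendstoD[OF x_lim, of "ball 0 e"] that by simp
  have x_germ: "(\<lambda>z. k (x z)) \<in> \<O>" if "k holomorphic_on ball 0 e" "e > 0" for k e
    using germ_of_linear[OF that, of b "- a"] by (simp add: x_def)
  \<comment> \<open>Among \<open>N + 1\<close> germs some combination vanishes to order \<open>N\<close> on the line; its restriction is then
     a multiple of that of \<open>g\<close>, and the difference is divisible by \<open>f\<close>.\<close>
  have upper: "n \<le> N" if h: "\<forall>i<n. h i \<in> \<O>" and ind: "\<forall>c :: nat \<Rightarrow> complex.
      (\<lambda>z. \<Sum>i<n. c i * h i z) \<in> germ_ideal (line_fun l m) g \<longrightarrow> (\<forall>i<n. c i = 0)" for h n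
  proof (rule ccontr)
    assume "\<not> n \<le> N"
    then have nN: "N < n" by simp
    then have hO: "h i \<in> \<O>" if "i \<le> N" for i using h that by auto
    obtain c k r where c: "\<exists>i\<le>N. c i \<noteq> (0::complex)" "r > 0" "k holomorphic_on ball 0 r"
      "\<And>s. s \<in> ball 0 r \<Longrightarrow> (\<Sum>i\<le>N. c i * h i (s * m, s * - l)) = s ^ N * k s"
      by (rule combination_vanishing_on_line[of N h m "- l", OF hO]) (assumption | rule that; assumption)+
    define H where "H = (\<lambda>z. \<Sum>i\<le>N. c i * h i z)"
    have H: "H \<in> \<O>" unfolding H_def using germ_sum[of "{..N}" h c] hO by simp
    have "\<exists>K\<in>\<O>. \<forall>\<^sub>F z in nhds (0, 0). H z = H (x z * m, x z * - l) + line_fun l m z * K z"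
      unfolding x_def f by (rule divide_by_line[OF H 1 2])
    then obtain K where K: "K \<in> \<O>" "\<forall>\<^sub>F z in nhds (0, 0). H z = H (x z * m, x z * - l) + line_fun l m z * K z"
      by blast
    have "\<exists>K\<in>\<O>. \<forall>\<^sub>F z in nhds (0, 0). g z = g (x z * m, x z * - l) + line_fun l m z * K z"
      unfolding x_def f by (rule divide_by_line[OF g 1 2])
    then obtain G where G: "G \<in> \<O>" "\<forall>\<^sub>F z in nhds (0, 0). g z = g (x z * m, x z * - l) + line_fun l m z * G z"
      by blast
    have "isCont R 0" using R(1,2)
      by (meson centre_in_ball continuous_on_eq_continuous_at holomorphic_on_imp_continuous_on open_ball)
    then have "(R \<longlongrightarrow> R 0) (nhds 0)" by (simp add: isCont_def tendsto_at_iff_tendsto_nhds)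
    from tendsto_imp_eventually_ne[OF this R(3)] obtain e1 where
      e1: "e1 > 0" "\<And>s. s \<in> ball 0 e1 \<Longrightarrow> R s \<noteq> 0"
      unfolding eventually_nhds_metric by (auto simp: dist_commute)
    define e where "e = min (min r \<epsilon>) e1"
    have e: "e > 0" "ball 0 e \<subseteq> ball 0 r" "ball 0 e \<subseteq> ball 0 \<epsilon>" "ball 0 e \<subseteq> ball (0::complex) e1"
      using c(2) R(2) e1(1) by (auto simp: e_def)
    have kR: "(\<lambda>s. k s / R s) holomorphic_on ball 0 e"
      using e e1(2) c(3) R(1) by (intro holomorphic_on_divide) (auto intro: holomorphic_on_subset)
    define Q where "Q = (\<lambda>z. k (x z) / R (x z))"
    have Q: "Q \<in> \<O>" unfolding Q_def using x_germ[OF kR e(1)] by simp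
    have A: "\<forall>\<^sub>F z in nhds (0, 0). H z = (K z - Q z * G z) * line_fun l m z + Q z * g z"
      using K(2) G(2) near[OF e(1)]
    proof eventually_elim
      case (elim z)
      have xr: "x z \<in> ball 0 r" "x z \<in> ball 0 \<epsilon>" using elim(3) e by blast+
      have "R (x z) \<noteq> 0" using elim(3) e by (intro e1(2)) blast
      note xr = xr this
      have H_eq: "H z = x z ^ N * k (x z) + line_fun l m z * K z"
        using elim(1) c(4)[OF xr(1)] by (simp add: H_def)
      have g_eq: "g z = x z ^ N * R (x z) + line_fun l m z * G z"
        using elim(2) gR[OF xr(2)] by simp
      have QR: "Q z * R (x z) = k (x z)" using xr(3) by (simp add: Q_def)
      have "Q z * g z = x z ^ N * (Q z * R (x z)) + Q z * G z * line_fun l m z"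
        unfolding g_eq by (simp add: algebra_simps)
      then show ?case unfolding QR H_eq by (simp add: algebra_simps)
    qed
    have B: "(\<lambda>z. K z - Q z * G z) \<in> \<O>" by (intro germ_diff germ_mult K(1) Q G(1))
    have "\<exists>\<alpha>\<in>\<O>. \<exists>\<beta>\<in>\<O>. \<forall>\<^sub>F z in nhds (0, 0). H z = \<alpha> z * line_fun l m z + \<beta> z * g z"
    proof (rule bexI[OF _ B])
      show "\<exists>\<beta>\<in>\<O>. \<forall>\<^sub>F z in nhds (0, 0). H z = (K z - Q z * G z) * line_fun l m z + \<beta> z * g z"
        by (rule bexI[OF _ Q]) (rule A)
    qed
    then have HI: "H \<in> germ_ideal (line_fun l m) g" using H unfolding germ_ideal_def by simp
    define c' where "c' = (\<lambda>i. if i \<le> N then c i else 0)"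
    have "(\<lambda>z. \<Sum>i<n. c' i * h i z) = H"
    proof
      fix z
      have "(\<Sum>i<n. c' i * h i z) = (\<Sum>i\<le>N. c' i * h i z)"
        by (rule sum.mono_neutral_right) (use nN in \<open>auto simp: c'_def\<close>)
      also have "\<dots> = H z" unfolding H_def by (rule sum.cong) (auto simp: c'_def)
      finally show "(\<Sum>i<n. c' i * h i z) = H z" .
    qed
    then have "\<forall>i<n. c' i = 0" using ind HI by metis
    moreover obtain i where i: "i \<le> N" "c i \<noteq> 0" using c(1) by blast
    ultimately have "c' i = 0" using nN by simp
    then show False using i by (simp add: c'_def)
  qed
  \<comment> \<open>The powers \<open>1, x, \<dots>, x\<^bsup>N-1\<^esup>\<close> of the parameter of the line are independent: a combination in the
     ideal restricts to a polynomial of degree \<open>< N\<close> in \<open>s\<close> that is divisible by \<open>s\<^bsup>N\<^esup>\<close>.\<close>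
  have lower: "\<exists>h :: nat \<Rightarrow> c2 \<Rightarrow> complex. (\<forall>i<N. h i \<in> \<O>) \<and> (\<forall>c :: nat \<Rightarrow> complex.
      (\<lambda>z. \<Sum>i<N. c i * h i z) \<in> germ_ideal (line_fun l m) g \<longrightarrow> (\<forall>i<N. c i = 0))"
  proof (intro exI[of _ "\<lambda>i z. x z ^ i"] conjI allI impI)
    show "(\<lambda>z. x z ^ i) \<in> \<O>" for i
      by (rule x_germ[of "\<lambda>s. s ^ i" 1]) (auto intro!: holomorphic_intros)
    fix c i
    assume I: "(\<lambda>z. \<Sum>i<N. c i * x z ^ i) \<in> germ_ideal (line_fun l m) g" and i: "i < N"
    from I obtain \<alpha> \<beta> where \<alpha>\<beta>: "\<beta> \<in> \<O>"
      "\<forall>\<^sub>F z in nhds (0, 0). (\<Sum>i<N. c i * x z ^ i) = \<alpha> z * line_fun l m z + \<beta> z * g z"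
      by (auto simp: germ_ideal_def)
    have "((\<lambda>s. (s * m, s * - l)) \<longlongrightarrow> (0 * m, 0 * - l)) (nhds 0)"
      by (intro tendsto_intros filterlim_ident)
    then have "filterlim (\<lambda>s. (s * m, s * - l)) (nhds (0, 0)) (nhds 0)" by simp
    note ev0 = eventually_compose_filterlim[OF \<alpha>\<beta>(2) this]
    have "\<forall>\<^sub>F s in nhds 0. s \<in> ball (0::complex) \<epsilon>"
      by (rule eventually_nhds_in_open) (use R(2) in auto)
    with ev0 have ev: "\<forall>\<^sub>F s in nhds 0. (\<Sum>i<N. c i * s ^ i) = \<beta> (s * m, s * - l) * (s ^ N * R s)"
    proof (eventually_elim)
      case (elim s)
      have "x (s * m, s * - l) = s * (l * a + m * b)" by (simp add: x_def algebra_simps)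
      moreover have "line_fun l m (s * m, s * - l) = 0" by (simp add: f)
      ultimately show ?case using elim(1) gR[OF elim(2)] ab by simp
    qed
    obtain r1 where r1: "r1 > 0" "(\<lambda>s. \<beta> (s * m, s * - l)) holomorphic_on ball 0 r1"
      using germ_slice[OF \<alpha>\<beta>(1), of m "- l"] by blast
    have isC: "isCont f 0" if "f holomorphic_on ball 0 e" "e > 0" for f :: "complex \<Rightarrow> complex" and e
      using that by (meson centre_in_ball continuous_on_eq_continuous_at holomorphic_on_imp_continuous_on open_ball)
    show "c i = 0" using i
    proof (induction i rule: less_induct)
      case (less i)
      let ?L = "\<lambda>s. \<Sum>j<N - i. c (i + j) * s ^ j"
      let ?M = "\<lambda>s. \<beta> (s * m, s * - l) * (s ^ (N - i) * R s)"
      have "\<forall>\<^sub>F s in at 0. (\<Sum>i<N. c i * s ^ i) = \<beta> (s * m, s * - l) * (s ^ N * R s)"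
        using ev unfolding eventually_nhds_conv_at by blast
      then have LM: "\<forall>\<^sub>F s in at 0. ?L s = ?M s"
        using eventually_neq_at_within[of 0 0 UNIV]
      proof eventually_elim
        case (elim s)
        have "(\<Sum>j<N. c j * s ^ j) = (\<Sum>j<i. c j * s ^ j) + (\<Sum>j\<in>{i..<N}. c j * s ^ j)"
          using sum.atLeastLessThan_concat[of 0 i N "\<lambda>j. c j * s ^ j"] less.prems
          by (simp add: atLeast0LessThan)
        also have "(\<Sum>j<i. c j * s ^ j) = 0" using less by (intro sum.neutral) auto
        also have "(\<Sum>j\<in>{i..<N}. c j * s ^ j) = (\<Sum>j<N - i. c (i + j) * s ^ (i + j))"
          by (rule sum.reindex_bij_witness[of _ "\<lambda>j. i + j" "\<lambda>j. j - i"]) auto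
        also have "\<dots> = s ^ i * ?L s" by (simp add: sum_distrib_left power_add mult_ac)
        finally have "s ^ i * ?L s = \<beta> (s * m, s * - l) * (s ^ N * R s)" using elim(1) by simp
        moreover have "s ^ N = s ^ i * s ^ (N - i)" using less.prems by (simp add: power_add[symmetric])
        ultimately have "s ^ i * ?L s = s ^ i * ?M s" by (simp add: mult_ac)
        then show ?case using elim(2) by simp
      qed
      have "(?M \<longlongrightarrow> ?M 0) (at 0)"
        by (intro tendsto_mult tendsto_power tendsto_ident_at isC[OF r1(2,1), unfolded isCont_def]
            isC[OF R(1,2), unfolded isCont_def])
      from iffD2[OF tendsto_cong[OF LM] this] have "(?L \<longlongrightarrow> ?M 0) (at 0)" .
      moreover have "(?L \<longlongrightarrow> ?L 0) (at 0)" by (intro tendsto_intros)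
      ultimately have "?L 0 = ?M 0" by (intro LIM_unique)
      moreover have "?L 0 = c i" using less.prems
        by (subst sum.remove[of _ 0]) (auto intro!: sum.neutral)
      ultimately show ?case using less.prems by (simp add: power_0_left)
    qed
  qed
  show ?thesis unfolding quot_dim_def
  proof (rule antisym)
    show "Sup {enat n | n. \<exists>b :: nat \<Rightarrow> c2 \<Rightarrow> complex. (\<forall>i<n. b i \<in> \<O>) \<and>
     (\<forall>c :: nat \<Rightarrow> complex. (\<lambda>z. \<Sum>i<n. c i * b i z) \<in> germ_ideal (line_fun l m) g \<longrightarrow> (\<forall>i<n. c i = 0))} \<le> enat N"
      by (rule Sup_least) (use upper in auto)
    show "enat N \<le> Sup {enat n | n. \<exists>b :: nat \<Rightarrow> c2 \<Rightarrow> complex. (\<forall>i<n. b i \<in> \<O>) \<and>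
     (\<forall>c :: nat \<Rightarrow> complex. (\<lambda>z. \<Sum>i<n. c i * b i z) \<in> germ_ideal (line_fun l m) g \<longrightarrow> (\<forall>i<n. c i = 0))}"
      by (rule Sup_upper) (use lower in blast)
  qed
qed

section \<open>Homogeneous foliations and their radial points\<close>

definition binary_form :: "nat \<Rightarrow> (complex \<Rightarrow> complex \<Rightarrow> complex) \<Rightarrow> bool" where
  "binary_form d F \<longleftrightarrow> (\<exists>\<alpha>. \<forall>x y. F x y = (\<Sum>j\<le>d. \<alpha> j * x ^ j * y ^ (d - j)))"

lemma binary_formI: "(\<And>x y. F x y = (\<Sum>j\<le>d. \<alpha> j * x ^ j * y ^ (d - j))) \<Longrightarrow> binary_form d F"
  by (auto simp: binary_form_def)

lemma binary_form_add:
  assumes "binary_form d F" "binary_form d G" shows "binary_form d (\<lambda>x y. F x y + G x y)"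
proof -
  obtain \<alpha> \<beta> where "\<And>x y. F x y = (\<Sum>j\<le>d. \<alpha> j * x ^ j * y ^ (d - j))"
    "\<And>x y. G x y = (\<Sum>j\<le>d. \<beta> j * x ^ j * y ^ (d - j))"
    using assms by (auto simp: binary_form_def)
  then show ?thesis
    by (intro binary_formI[where \<alpha>="\<lambda>j. \<alpha> j + \<beta> j"]) (simp add: sum.distrib[symmetric] algebra_simps)
qed

lemma binary_form_cmult:
  assumes "binary_form d F" shows "binary_form d (\<lambda>x y. c * F x y)"
proof -
  obtain \<alpha> where "\<And>x y. F x y = (\<Sum>j\<le>d. \<alpha> j * x ^ j * y ^ (d - j))"
    using assms by (auto simp: binary_form_def)
  then show ?thesis
    by (intro binary_formI[where \<alpha>="\<lambda>j. c * \<alpha> j"]) (simp add: sum_distrib_left algebra_simps)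
qed

lemma binary_form_zero: "binary_form d (\<lambda>x y. 0)"
  by (rule binary_formI[where \<alpha>="\<lambda>_. 0"]) simp

lemma binary_form_sum:
  "(\<And>i. i \<in> I \<Longrightarrow> binary_form d (F i)) \<Longrightarrow> binary_form d (\<lambda>x y. \<Sum>i\<in>I. F i x y)"
  by (induction I rule: infinite_finite_induct) (auto intro: binary_form_zero binary_form_add)

lemma binary_form_const: "binary_form 0 (\<lambda>x y. c)"
  by (rule binary_formI[where \<alpha>="\<lambda>_. c"]) simp

lemma binary_form_mult_linear:
  assumes "binary_form d F" shows "binary_form (Suc d) (\<lambda>x y. (p * x + q * y) * F x y)"
proof -
  obtain \<alpha> where F: "\<And>x y. F x y = (\<Sum>j\<le>d. \<alpha> j * x ^ j * y ^ (d - j))"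
    using assms by (auto simp: binary_form_def)
  have "binary_form (Suc d) (\<lambda>x y. x * F x y)"
  proof (rule binary_formI[where \<alpha>="\<lambda>j. case j of 0 \<Rightarrow> 0 | Suc i \<Rightarrow> \<alpha> i"])
    fix x y
    show "x * F x y = (\<Sum>j\<le>Suc d. (case j of 0 \<Rightarrow> 0 | Suc i \<Rightarrow> \<alpha> i) * x ^ j * y ^ (Suc d - j))"
      unfolding F by (subst sum.atMost_Suc_shift) (simp add: sum_distrib_left mult_ac)
  qed
  moreover have "binary_form (Suc d) (\<lambda>x y. y * F x y)"
  proof (rule binary_formI[where \<alpha>="\<lambda>j. if j \<le> d then \<alpha> j else 0"])
    fix x y
    have "(\<Sum>j\<le>Suc d. (if j \<le> d then \<alpha> j else 0) * x ^ j * y ^ (Suc d - j))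
      = (\<Sum>j\<le>d. \<alpha> j * x ^ j * y ^ (Suc d - j))"
      by (simp add: sum.atMost_Suc)
    also have "\<dots> = y * F x y" unfolding F sum_distrib_left
      by (intro sum.cong) (auto simp: Suc_diff_le)
    finally show "y * F x y = (\<Sum>j\<le>Suc d. (if j \<le> d then \<alpha> j else 0) * x ^ j * y ^ (Suc d - j))" ..
  qed
  ultimately have "binary_form (Suc d) (\<lambda>x y. p * (x * F x y) + q * (y * F x y))"
    by (intro binary_form_add binary_form_cmult)
  then show ?thesis by (simp add: algebra_simps)
qed

lemma binary_form_linear_power_mult:
  assumes "binary_form d F" shows "binary_form (n + d) (\<lambda>x y. (p * x + q * y) ^ n * F x y)"
proof (induction n)
  case (Suc n)
  from binary_form_mult_linear[OF this, of p q] show ?case by (simp add: mult_ac)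
qed (use assms in simp)

lemma binary_form_compose:
  assumes "binary_form d F"
  shows "binary_form d (\<lambda>X Y. F (X * p + Y * q) (X * r + Y * s))"
proof -
  obtain \<alpha> where F: "\<And>x y. F x y = (\<Sum>j\<le>d. \<alpha> j * x ^ j * y ^ (d - j))"
    using assms by (auto simp: binary_form_def)
  have "binary_form d (\<lambda>X Y. \<alpha> j * ((p * X + q * Y) ^ j * ((r * X + s * Y) ^ (d - j) * 1)))" if "j \<le> d" for j
    using binary_form_cmult[OF binary_form_linear_power_mult[OF binary_form_linear_power_mult
        [OF binary_form_const[of 1], of "d - j" r s], of j p q], of "\<alpha> j"] that by simp
  then have "binary_form d (\<lambda>X Y. \<Sum>j\<le>d. \<alpha> j * ((p * X + q * Y) ^ j * ((r * X + s * Y) ^ (d - j) * 1)))"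
    by (intro binary_form_sum) auto
  then show ?thesis unfolding F by (simp add: mult_ac)
qed

lemma binary_form_scale:
  assumes "binary_form d F" shows "F (k * x) (k * y) = k ^ d * F x y"
proof -
  obtain \<alpha> where F: "\<And>x y. F x y = (\<Sum>j\<le>d. \<alpha> j * x ^ j * y ^ (d - j))"
    using assms by (auto simp: binary_form_def)
  have "(k * x) ^ j * (k * y) ^ (d - j) = k ^ d * (x ^ j * y ^ (d - j))" if "j \<le> d" for j
    using that by (simp add: power_mult_distrib power_add[symmetric] mult_ac)
  then show ?thesis unfolding F sum_distrib_left
    by (intro sum.cong) (auto simp: mult.assoc mult.left_commute)
qed

lemma binary_form_holomorphic2:
  assumes "binary_form d F" "holomorphic2 f U" "holomorphic2 g U"
  shows "holomorphic2 (\<lambda>z. F (f z) (g z)) U"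
proof -
  obtain \<alpha> where F: "\<And>x y. F x y = (\<Sum>j\<le>d. \<alpha> j * x ^ j * y ^ (d - j))"
    using assms by (auto simp: binary_form_def)
  show ?thesis unfolding F by (intro holomorphic2_intros assms)
qed

text \<open>The 1-form \<open>z a dx + z b dy - (x a + y b) dz\<close> on \<open>\<complex>\<^sup>3\<close>, the homogenization of \<open>a dx + b dy\<close>, at the point \<open>p\<close>
  and the tangent vector \<open>w\<close>.\<close>

definition cone_form :: "(complex \<Rightarrow> complex \<Rightarrow> complex) \<Rightarrow> (complex \<Rightarrow> complex \<Rightarrow> complex) \<Rightarrow>
    complex^3 \<Rightarrow> complex^3 \<Rightarrow> complex" where
  "cone_form a b p w = p$3 * (a (p$1) (p$2) * w$1 + b (p$1) (p$2) * w$2)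
     - (p$1 * a (p$1) (p$2) + p$2 * b (p$1) (p$2)) * w$3"

lemma cone_form_self: "cone_form a b p p = 0"
  by (simp add: cone_form_def algebra_simps)

lemma cone_form_add: "cone_form a b p (v + w) = cone_form a b p v + cone_form a b p w"
  by (simp add: cone_form_def algebra_simps)

lemma cone_form_scale: "cone_form a b p (c *s w) = c * cone_form a b p w"
  by (simp add: cone_form_def algebra_simps)

lemma cone_form_minus: "cone_form a b p (- w) = - cone_form a b p w"
  by (simp add: cone_form_def algebra_simps)

lemma cone_form_combo: "cone_form a b p w * l - cone_form a b p v * m = - cone_form a b p (m *s v - l *s w)"
  by (simp add: cone_form_def algebra_simps)

lemma iterated_deriv_u: "(deriv_u ^^ i) g (x, 0) = (deriv ^^ i) (\<lambda>t. g (t, 0)) x"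
proof (induction i arbitrary: x)
  case (Suc i)
  then show ?case by (simp add: deriv_u_def)
qed simp

lemma iterated_deriv_v: "(deriv_v ^^ j) g (u, y) = (deriv ^^ j) (\<lambda>t. g (u, t)) y"
proof (induction j arbitrary: y)
  case (Suc j)
  then show ?case by (simp add: deriv_v_def)
qed simp

lemma entire_zero:
  assumes "f holomorphic_on UNIV" "\<And>n. (deriv ^^ n) f 0 = 0" shows "f z = (0::complex)"
proof -
  have "f holomorphic_on ball 0 (norm z + 1)" using assms(1) holomorphic_on_subset by blast
  then show ?thesis
    by (rule holomorphic_fun_eq_0_on_ball[of _ 0 "norm z + 1"]) (use assms(2) in auto)
qed

text \<open>The identity theorem, first for the functions \<open>\<partial>\<^sub>v\<^sup>j f\<close> on the axis \<open>v = 0\<close> and then for \<open>f\<close> on vertical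
  slices.\<close>

lemma all_derivs_zero:
  assumes f: "holomorphic2 f UNIV" and z: "\<And>i j. (deriv_u ^^ i) ((deriv_v ^^ j) f) (0, 0) = 0"
  shows "f (u, v) = 0"
proof -
  have hj: "holomorphic2 ((deriv_v ^^ j) f) UNIV" for j
    by (induction j) (auto intro: f holomorphic2_deriv_v)
  have sl: "(\<lambda>t. g (t, y)) holomorphic_on UNIV" "(\<lambda>t. g (x, t)) holomorphic_on UNIV"
    if "holomorphic2 g UNIV" for g x y
    using holomorphic2_imp_separately[OF that]
    by (auto simp: separately_holomorphic_def holomorphic_on_def field_differentiable_at_within)
  have "(deriv_v ^^ j) f (x, 0) = 0" for j x
    using entire_zero[OF sl(1)[OF hj[of j], of 0]] z[of _ j] unfolding iterated_deriv_u by blast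
  then show ?thesis using entire_zero[OF sl(2)[OF f, of u]] unfolding iterated_deriv_v by blast
qed

lemma proj_vector_mult:
  fixes N :: "complex^3^3"
  shows "N *v (vector [x, y, w] :: complex^3)
   = vector [N$1$1 * x + N$1$2 * y + N$1$3 * w, N$2$1 * x + N$2$2 * y + N$2$3 * w, N$3$1 * x + N$3$2 * y + N$3$3 * w]"
  by (simp add: vec_eq_iff forall_3 matrix_vector_mult_def sum_3)

text \<open>A homogeneous foliation in suitable homogeneous coordinates \<open>M\<close>, with the polynomials replaced by the
  functions that they define.\<close>

locale cone_foliation =
  fixes d :: nat and a b :: "complex \<Rightarrow> complex \<Rightarrow> complex" and \<Omega> :: form3 and M :: "complex^3^3"
  assumes d: "d \<ge> 2" and a: "binary_form d a" and b: "binary_form d b"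
    and M: "invertible M" and rep: "\<And>p w. form_at \<Omega> (M *v p) (M *v w) = cone_form a b p w"
    and no_common_zero: "\<And>x y. a x y = 0 \<Longrightarrow> b x y = 0 \<Longrightarrow> x = 0 \<and> y = 0"
begin

text \<open>The coefficients of the pullback of \<open>a dx + b dy\<close> under the linear change of coordinates
  \<open>(x, y) = X (a1, b1) + Y (a2, b2)\<close>.\<close>

definition pullA :: "complex \<Rightarrow> complex \<Rightarrow> complex \<Rightarrow> complex \<Rightarrow> complex \<Rightarrow> complex \<Rightarrow> complex" where
  "pullA a1 b1 a2 b2 X Y = a1 * a (X * a1 + Y * a2) (X * b1 + Y * b2) + b1 * b (X * a1 + Y * a2) (X * b1 + Y * b2)"

definition pullB :: "complex \<Rightarrow> complex \<Rightarrow> complex \<Rightarrow> complex \<Rightarrow> complex \<Rightarrow> complex \<Rightarrow> complex" where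
  "pullB a1 b1 a2 b2 X Y = a2 * a (X * a1 + Y * a2) (X * b1 + Y * b2) + b2 * b (X * a1 + Y * a2) (X * b1 + Y * b2)"

text \<open>A radial singularity may be given in any chart centred at it; passing to another chart replaces the
  coordinates of the cone form by linear functions.\<close>

lemma chart_rep:
  assumes "invertible M'"
  obtains N where "invertible N" "\<And>p w. form_at \<Omega> (M' *v p) (M' *v w) = cone_form a b (N *v p) (N *v w)"
proof -
  obtain M1 where M1: "M ** M1 = mat 1" "M1 ** M = mat 1" using M by (auto simp: invertible_def)
  have e: "M' *v p = M *v ((M1 ** M') *v p)" for p
    by (simp add: matrix_vector_mul_assoc matrix_mul_assoc M1)
  show ?thesis
  proof (rule that)
    show "invertible (M1 ** M')" using M1 assms invertible_mult by (metis invertible_def)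
    show "form_at \<Omega> (M' *v p) (M' *v w) = cone_form a b ((M1 ** M') *v p) ((M1 ** M') *v w)" for p w
      unfolding e by (rule rep)
  qed
qed

text \<open>The origin of the affine chart is too degenerate to be a radial singularity: the coefficients of
  \<open>\<theta>\<close> vanish there to order at least \<open>d \<ge> 2\<close>. Since \<open>vanishing_order\<close> is a least number, one also has to
  see that some derivative does not vanish, for otherwise the form would be zero.\<close>

lemma vanishing_order_at_origin:
  fixes N :: "complex^3^3"
  assumes N: "invertible N" and N0: "N$1$3 = 0" "N$2$3 = 0"
    and \<theta>: "\<And>x y. \<theta> (x, y) = (cone_form a b (N *v vector [x, y, 1]) (N *v vector [1, 0, 0]),
       cone_form a b (N *v vector [x, y, 1]) (N *v vector [0, 1, 0]))"
  shows "vanishing_order (form_field \<theta>) \<noteq> 1"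
proof
  assume vo: "vanishing_order (form_field \<theta>) = 1"
  let ?P = "\<lambda>n. \<exists>i j. i + j = n \<and>
     ((deriv_u ^^ i) ((deriv_v ^^ j) (\<lambda>z. fst (form_field \<theta> z))) (0, 0) \<noteq> 0 \<or>
      (deriv_u ^^ i) ((deriv_v ^^ j) (\<lambda>z. snd (form_field \<theta> z))) (0, 0) \<noteq> 0)"
  define G where "G = (\<lambda>w (z::c2). cone_form a b (N *v vector [fst z, snd z, 1]) w)"
  have det: "det N \<noteq> 0" using N by (simp add: invertible_det_nz)
  have Geq: "G w = (\<lambda>z. (N$3$1 * fst z + N$3$2 * snd z + N$3$3) *
      (a (N$1$1 * fst z + N$1$2 * snd z) (N$2$1 * fst z + N$2$2 * snd z) * w$1
        + b (N$1$1 * fst z + N$1$2 * snd z) (N$2$1 * fst z + N$2$2 * snd z) * w$2)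
      - ((N$1$1 * fst z + N$1$2 * snd z) * a (N$1$1 * fst z + N$1$2 * snd z) (N$2$1 * fst z + N$2$2 * snd z)
        + (N$2$1 * fst z + N$2$2 * snd z) * b (N$1$1 * fst z + N$1$2 * snd z) (N$2$1 * fst z + N$2$2 * snd z)) * w$3)"
    for w unfolding G_def proj_vector_mult by (simp add: cone_form_def N0)
  have Ghol: "holomorphic2 (G w) UNIV" for w
    unfolding Geq by (intro holomorphic2_intros binary_form_holomorphic2[OF a] binary_form_holomorphic2[OF b])
  \<comment> \<open>On the coordinate axes the coefficients have this shape because \<open>a\<close> and \<open>b\<close> are homogeneous.\<close>
  have axis: "((\<lambda>t. t ^ d * (A + B * t)) has_field_derivative 0) (at 0)" for A B :: complex
  proof -
    have "((\<lambda>t. t ^ d * (A + B * t)) has_field_derivative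
        of_nat d * 0 ^ (d - 1) * (A + B * 0) + 0 ^ d * B) (at 0)"
      by (auto intro!: derivative_eq_intros)
    then show ?thesis using d by (simp add: power_0_left)
  qed
  have du: "deriv_u (G w) (0, 0) = 0" for w
  proof -
    have "G w (t, 0) = t ^ d * (N$3$3 * (a (N$1$1) (N$2$1) * w$1 + b (N$1$1) (N$2$1) * w$2)
       + (N$3$1 * (a (N$1$1) (N$2$1) * w$1 + b (N$1$1) (N$2$1) * w$2)
       - (N$1$1 * a (N$1$1) (N$2$1) + N$2$1 * b (N$1$1) (N$2$1)) * w$3) * t)" for t
      using binary_form_scale[OF a, of t "N$1$1" "N$2$1"] binary_form_scale[OF b, of t "N$1$1" "N$2$1"]
      by (simp add: Geq mult.commute[of _ t] algebra_simps)
    then show ?thesis unfolding deriv_u_def by (simp only: prod.case) (rule DERIV_imp_deriv[OF axis])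
  qed
  have dv: "deriv_v (G w) (0, 0) = 0" for w
  proof -
    have "G w (0, t) = t ^ d * (N$3$3 * (a (N$1$2) (N$2$2) * w$1 + b (N$1$2) (N$2$2) * w$2)
       + (N$3$2 * (a (N$1$2) (N$2$2) * w$1 + b (N$1$2) (N$2$2) * w$2)
       - (N$1$2 * a (N$1$2) (N$2$2) + N$2$2 * b (N$1$2) (N$2$2)) * w$3) * t)" for t
      using binary_form_scale[OF a, of t "N$1$2" "N$2$2"] binary_form_scale[OF b, of t "N$1$2" "N$2$2"]
      by (simp add: Geq mult.commute[of _ t] algebra_simps)
    then show ?thesis unfolding deriv_v_def by (simp only: prod.case) (rule DERIV_imp_deriv[OF axis])
  qed
  have zd: "(0::complex) ^ d = 0" using d by simp
  have G00: "G w (0, 0) = 0" for w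
    using binary_form_scale[OF a, of 0 0 0] binary_form_scale[OF b, of 0 0 0] zd by (simp add: Geq)
  let ?e1 = "N *v vector [1, 0, 0]" and ?e2 = "N *v vector [0, 1, 0]" and ?e3 = "N *v vector [0, 0, 1]"
  have F1: "(\<lambda>z. fst (form_field \<theta> z)) = G ?e2"
    using \<theta> by (auto simp: fun_eq_iff form_field_def G_def)
  have F2: "(\<lambda>z. snd (form_field \<theta> z)) = G (- ?e1)"
    using \<theta> by (auto simp: fun_eq_iff form_field_def G_def cone_form_minus)
  have "\<exists>n. ?P n"
  proof (rule ccontr)
    assume "\<not> (\<exists>n. ?P n)"
    then have n: "(deriv_u ^^ i) ((deriv_v ^^ j) (G ?e2)) (0, 0) = 0"
       "(deriv_u ^^ i) ((deriv_v ^^ j) (G (- ?e1))) (0, 0) = 0" for i j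
      unfolding F1 F2 by blast+
    have z2: "G ?e2 (x, y) = 0" for x y by (rule all_derivs_zero[OF Ghol n(1)])
    have "G (- ?e1) (x, y) = 0" for x y by (rule all_derivs_zero[OF Ghol n(2)])
    then have z1: "G ?e1 (x, y) = 0" for x y
      by (simp add: G_def cone_form_minus)
    have z3: "G ?e3 (x, y) = 0" for x y
    proof -
      have "N *v vector [x, y, 1] = x *s ?e1 + (y *s ?e2 + ?e3)"
        by (simp add: proj_vector_mult vec_eq_iff forall_3 algebra_simps)
      then have "0 = x * G ?e1 (x, y) + (y * G ?e2 (x, y) + G ?e3 (x, y))"
        using cone_form_self[of a b "N *v vector [x, y, 1]"]
        by (simp only: G_def fst_conv snd_conv cone_form_add[symmetric] cone_form_scale[symmetric])
      then show ?thesis using z1 z2 by simp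
    qed
    obtain N1 where N1: "N ** N1 = mat 1" using N by (auto simp: invertible_def)
    have zw: "G w (x, y) = 0" for w x y
    proof -
      define w' where "w' = N1 *v w"
      have "w = N *v w'" by (simp add: w'_def matrix_vector_mul_assoc N1)
      also have "w' = vector [w'$1, w'$2, w'$3]" by (simp add: vec_eq_iff forall_3)
      also have "N *v vector [w'$1, w'$2, w'$3] = w'$1 *s ?e1 + (w'$2 *s ?e2 + w'$3 *s ?e3)"
        by (simp add: proj_vector_mult vec_eq_iff forall_3 algebra_simps)
      finally show ?thesis
        using z1[of x y] z2[of x y] z3[of x y] by (simp add: G_def cone_form_add cone_form_scale)
    qed
    \<comment> \<open>A point of the axis \<open>v = 0\<close> other than its origin and not on the line at infinity of the cone.\<close>
    define t :: complex where "t = (if N$3$1 + N$3$3 \<noteq> 0 then 1 else 2)"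
    have n33: "N$3$3 \<noteq> 0" using det by (auto simp: det_3 N0)
    have p3: "N$3$1 * t + N$3$3 \<noteq> 0"
      using n33 by (auto simp: t_def) (metis add_eq_0_iff2 add_left_cancel mult_2_right add.assoc add_0)
    have t0: "t \<noteq> 0" by (simp add: t_def)
    have "G (vector [1, 0, 0]) (t, 0) = (N$3$1 * t + N$3$3) * a (N$1$1 * t) (N$2$1 * t)"
      "G (vector [0, 1, 0]) (t, 0) = (N$3$1 * t + N$3$3) * b (N$1$1 * t) (N$2$1 * t)"
      by (simp_all add: Geq)
    then have "a (N$1$1 * t) (N$2$1 * t) = 0" "b (N$1$1 * t) (N$2$1 * t) = 0"
      using zw p3 by simp_all
    then have "N$1$1 * t = 0 \<and> N$2$1 * t = 0" by (rule no_common_zero)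
    then have "N$1$1 = 0 \<and> N$2$1 = 0" using t0 by simp
    then show False using det by (simp add: det_3 N0)
  qed
  then have "?P (LEAST n. ?P n)" by (rule LeastI_ex)
  then have "?P 1" using vo unfolding vanishing_order_def by simp
  then obtain i j where ij: "i + j = 1" "(deriv_u ^^ i) ((deriv_v ^^ j) (G ?e2)) (0, 0) \<noteq> 0 \<or>
      (deriv_u ^^ i) ((deriv_v ^^ j) (G (- ?e1))) (0, 0) \<noteq> 0" unfolding F1 F2 by blast
  from ij(1) have "(i = 1 \<and> j = 0) \<or> (i = 0 \<and> j = 1)" by auto
  then show False using ij(2) du dv by auto
qed

text \<open>A radial singularity is a point \<open>[v1 : v2 : 0]\<close> at infinity. On each line through it that is
  not invariant, the derivative of the equation of the line along the foliation is a nonzero multiple of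
  \<open>\<Phi> = v1 a + v2 b\<close>, and its vanishing order is the order of \<open>\<Phi>\<close> at the direction \<open>v\<close>. As this does not depend
  on the line, it equals \<open>\<tau>\<close>. With a complementary vector \<open>e\<close>, the function \<open>pullB e v\<close> is \<open>\<Phi>\<close> in
  the basis \<open>e\<close>, \<open>v\<close>, and its order at \<open>v\<close> is its order in \<open>X\<close>.\<close>

lemma radial_point:
  assumes rad: "radial_of_order \<Omega> s k"
  obtains v1 v2 where "(v1, v2) \<noteq> (0, 0)"
    "\<And>e1 e2. e1 * v2 - e2 * v1 \<noteq> 0 \<Longrightarrow> \<exists>\<phi>. (\<forall>X Y. pullB e1 e2 v1 v2 X Y = (\<Sum>j\<le>d. \<phi> j * X ^ j * Y ^ (d - j)))
      \<and> (\<forall>j\<le>k. \<phi> j = 0) \<and> k + 1 \<le> d \<and> \<phi> (k + 1) \<noteq> 0"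
proof -
  from rad obtain M' where M': "invertible M'" and s: "singular_point \<Omega> s" "M' *v vector [0, 0, 1] \<in> s"
    and vo: "vanishing_order (form_field (chart_form \<Omega> M')) = 1"
    and tau: "tau_order (form_field (chart_form \<Omega> M')) = enat (k + 1)"
    unfolding radial_of_order_def by blast
  obtain N where N: "invertible N"
    and Nrep: "\<And>p w. form_at \<Omega> (M' *v p) (M' *v w) = cone_form a b (N *v p) (N *v w)"
    using chart_rep[OF M'] by metis
  define \<theta> where "\<theta> = chart_form \<Omega> M'"
  have \<theta>: "\<theta> (x, y) = (cone_form a b (N *v vector [x, y, 1]) (N *v vector [1, 0, 0]),
       cone_form a b (N *v vector [x, y, 1]) (N *v vector [0, 1, 0]))" for x y
    unfolding \<theta>_def chart_form_def by (simp add: Nrep)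
  have det: "det N \<noteq> 0" using N by (simp add: invertible_det_nz)
  let ?s = "N *v vector [0, 0, 1]"
  have s_eq: "?s = vector [N$1$3, N$2$3, N$3$3]" by (simp add: proj_vector_mult)
  obtain N1 where N1: "N ** N1 = mat 1" using N by (auto simp: invertible_def)
  have sing: "cone_form a b ?s w = 0" for w
  proof -
    have "form_at \<Omega> (M' *v vector [0, 0, 1]) (M' *v (N1 *v w)) = 0"
      using s by (auto simp: singular_point_def)
    then show ?thesis unfolding Nrep by (simp add: matrix_vector_mul_assoc N1)
  qed
  define v1 v2 where "v1 = N$1$3" and "v2 = N$2$3"
  have n33: "N$3$3 = 0"
  proof (rule ccontr)
    assume n: "N$3$3 \<noteq> 0"
    have "a v1 v2 = 0" "b v1 v2 = 0"
      using sing[of "vector [1, 0, 0]"] sing[of "vector [0, 1, 0]"] n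
      by (auto simp: s_eq cone_form_def v1_def v2_def)
    then have "v1 = 0 \<and> v2 = 0" by (rule no_common_zero)
    then have "N$1$3 = 0" "N$2$3 = 0" by (auto simp: v1_def v2_def)
    from vanishing_order_at_origin[OF N this \<theta>] show False using vo by (simp add: \<theta>_def)
  qed
  have v: "(v1, v2) \<noteq> (0, 0)" using det by (auto simp: det_3 n33 v1_def v2_def)
  have \<Phi>v: "v1 * a v1 v2 + v2 * b v1 v2 = 0"
    using sing[of "vector [0, 0, 1]"] by (simp add: s_eq cone_form_def v1_def v2_def n33 neg_eq_iff_add_eq_0)
  show ?thesis
  proof (rule that[OF v])
    fix e1 e2 assume E: "e1 * v2 - e2 * v1 \<noteq> 0"
    define \<Phi> where "\<Phi> = (\<lambda>x y. v1 * a x y + v2 * b x y)"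
    have "binary_form d \<Phi>" unfolding \<Phi>_def by (intro binary_form_add binary_form_cmult a b)
    from binary_form_compose[OF this, of e1 v1 e2 v2] obtain \<phi> where
      \<phi>: "\<And>X Y. \<Phi> (X * e1 + Y * v1) (X * e2 + Y * v2) = (\<Sum>j\<le>d. \<phi> j * X ^ j * Y ^ (d - j))"
      by (auto simp: binary_form_def)
    define n where "n = (LEAST j. \<phi> j \<noteq> 0)"
    have \<phi>0: "\<phi> 0 = 0"
    proof -
      have "\<Phi> v1 v2 = (\<Sum>j\<le>d. \<phi> j * 0 ^ j * 1 ^ (d - j))" using \<phi>[of 0 1] by simp
      also have "\<dots> = \<phi> 0" by (subst sum.remove[of _ 0]) (auto intro!: sum.neutral)
      finally show ?thesis using \<Phi>v by (simp add: \<Phi>_def)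
    qed
    define g where "g = (\<lambda>l m (z::c2). - cone_form a b (N *v vector [fst z, snd z, 1]) (N *v vector [m, - l, 0]))"
    have der: "derivation (form_field \<theta>) (line_fun l m) = g l m" for l m
    proof
      fix z :: c2
      obtain x y where z: "z = (x, y)" by fastforce
      have "deriv (\<lambda>t. l * t + m * y) x = l" "deriv (\<lambda>t. l * x + m * t) y = m"
        by (auto intro!: DERIV_imp_deriv derivative_eq_intros)
      then have "derivation (form_field \<theta>) (line_fun l m) z = snd (\<theta> z) * l - fst (\<theta> z) * m"
        by (simp add: derivation_def form_field_def deriv_u_def deriv_v_def line_fun_def z)
      also have "\<dots> = - cone_form a b (N *v vector [x, y, 1]) (m *s (N *v vector [1, 0, 0]) - l *s (N *v vector [0, 1, 0]))"
        unfolding z \<theta> fst_conv snd_conv by (rule cone_form_combo)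
      also have "m *s (N *v vector [1, 0, 0]) - l *s (N *v vector [0, 1, 0]) = N *v vector [m, - l, 0]"
        by (simp add: proj_vector_mult vec_eq_iff forall_3 algebra_simps)
      finally show "derivation (form_field \<theta>) (line_fun l m) z = g l m z" by (simp add: g_def z)
    qed
    have key: "tang_order (form_field \<theta>) (line_fun l m) = enat n \<and> (\<exists>j\<le>d. \<phi> j \<noteq> 0)"
      if lm: "(l, m) \<noteq> (0, 0)" and ni: "\<not> invariant_line (form_field \<theta>) (line_fun l m)" for l m
    proof -
      \<comment> \<open>The direction of the line in homogeneous coordinates, and the coordinates of its affine part in
         the basis \<open>e\<close>, \<open>v\<close>.\<close>
      define D1 D2 D3 where "D1 = N$1$1 * m - N$1$2 * l" and "D2 = N$2$1 * m - N$2$2 * l"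
        and "D3 = N$3$1 * m - N$3$2 * l"
      define \<delta> \<epsilon> where "\<delta> = (D1 * v2 - D2 * v1) / (e1 * v2 - e2 * v1)"
        and "\<epsilon> = (e1 * D2 - e2 * D1) / (e1 * v2 - e2 * v1)"
      have D: "D1 = \<delta> * e1 + \<epsilon> * v1" "D2 = \<delta> * e2 + \<epsilon> * v2"
      proof -
        have "(e1 * v2 - e2 * v1) * D1 = (D1 * v2 - D2 * v1) * e1 + (e1 * D2 - e2 * D1) * v1"
          "(e1 * v2 - e2 * v1) * D2 = (D1 * v2 - D2 * v1) * e2 + (e1 * D2 - e2 * D1) * v2"
          by (simp_all add: algebra_simps)
        then show "D1 = \<delta> * e1 + \<epsilon> * v1" "D2 = \<delta> * e2 + \<epsilon> * v2"
          unfolding \<delta>_def \<epsilon>_def using E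
          by (simp_all add: add_divide_distrib[symmetric] nonzero_eq_divide_eq mult.commute)
      qed
      have gs: "g l m (s * m, s * - l) = D3 * (\<Sum>j\<le>d. \<phi> j * (s * \<delta>) ^ j * (1 + s * \<epsilon>) ^ (d - j))" for s
      proof -
        have P: "N *v vector [s * m, s * - l, 1] = vector [v1 + s * D1, v2 + s * D2, s * D3]"
          by (simp add: proj_vector_mult vec_eq_iff forall_3 D1_def D2_def D3_def v1_def v2_def n33 algebra_simps)
        have Q: "N *v vector [m, - l, 0] = vector [D1, D2, D3]"
          by (simp add: proj_vector_mult vec_eq_iff forall_3 D1_def D2_def D3_def)
        have "g l m (s * m, s * - l) = D3 * \<Phi> (v1 + s * D1) (v2 + s * D2)"
          unfolding g_def fst_conv snd_conv P Q by (simp add: cone_form_def \<Phi>_def algebra_simps)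
        also have "v1 + s * D1 = (s * \<delta>) * e1 + (1 + s * \<epsilon>) * v1" unfolding D by (simp add: algebra_simps)
        also have "v2 + s * D2 = (s * \<delta>) * e2 + (1 + s * \<epsilon>) * v2" unfolding D by (simp add: algebra_simps)
        finally show ?thesis unfolding \<phi> .
      qed
      obtain z where z: "line_fun l m z = 0" "g l m z \<noteq> 0"
        using ni unfolding invariant_line_def der by blast
      obtain a' b' where ab: "l * a' + m * b' = 1" by (rule complementary_vector[OF lm])
      define s0 where "s0 = b' * fst z - a' * snd z"
      have "z = (s0 * m, s0 * - l)"
        using line_coordinates[OF ab, of "fst z" "snd z"] z(1)
        by (simp add: prod_eq_iff s0_def line_fun_def case_prod_beta)
      then have nz: "D3 * (\<Sum>j\<le>d. \<phi> j * (s0 * \<delta>) ^ j * (1 + s0 * \<epsilon>) ^ (d - j)) \<noteq> 0"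
        using z(2) gs by metis
      then have D3: "D3 \<noteq> 0" by auto
      have ex: "\<exists>j\<le>d. \<phi> j \<noteq> 0"
      proof (rule ccontr)
        assume "\<not> (\<exists>j\<le>d. \<phi> j \<noteq> 0)"
        then have "(\<Sum>j\<le>d. \<phi> j * (s0 * \<delta>) ^ j * (1 + s0 * \<epsilon>) ^ (d - j)) = 0" by (intro sum.neutral) auto
        then show False using nz by simp
      qed
      have \<delta>: "\<delta> \<noteq> 0"
      proof
        assume \<delta>: "\<delta> = 0"
        have "(\<Sum>j\<le>d. \<phi> j * (s0 * \<delta>) ^ j * (1 + s0 * \<epsilon>) ^ (d - j)) = 0"
        proof (rule sum.neutral, rule ballI)
          fix j show "\<phi> j * (s0 * \<delta>) ^ j * (1 + s0 * \<epsilon>) ^ (d - j) = 0"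
            using \<delta> \<phi>0 by (cases j) auto
        qed
        then show False using nz by simp
      qed
      have \<phi>n: "\<phi> n \<noteq> 0" unfolding n_def using ex by (metis (mono_tags, lifting) LeastI)
      have below: "\<phi> j = 0" if "j < n" for j using not_less_Least that unfolding n_def by blast
      have nd: "n \<le> d" using ex below by (meson le_trans linorder_not_less)
      define R where "R = (\<lambda>s. D3 * \<delta> ^ n * (\<Sum>j\<in>{n..d}. \<phi> j * (s * \<delta>) ^ (j - n) * (1 + s * \<epsilon>) ^ (d - j)))"
      have gR: "g l m (s * m, s * - l) = s ^ n * R s" for s
      proof -
        have "(\<Sum>j\<le>d. \<phi> j * (s * \<delta>) ^ j * (1 + s * \<epsilon>) ^ (d - j))
          = (\<Sum>j\<in>{n..d}. \<phi> j * (s * \<delta>) ^ j * (1 + s * \<epsilon>) ^ (d - j))"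
          by (rule sum.mono_neutral_right) (auto intro!: below)
        also have "\<dots> = (\<Sum>j\<in>{n..d}. (s * \<delta>) ^ n * (\<phi> j * (s * \<delta>) ^ (j - n) * (1 + s * \<epsilon>) ^ (d - j)))"
        proof (rule sum.cong[OF refl])
          fix j assume "j \<in> {n..d}"
          then have "(s * \<delta>) ^ j = (s * \<delta>) ^ n * (s * \<delta>) ^ (j - n)" by (simp add: power_add[symmetric])
          then show "\<phi> j * (s * \<delta>) ^ j * (1 + s * \<epsilon>) ^ (d - j)
             = (s * \<delta>) ^ n * (\<phi> j * (s * \<delta>) ^ (j - n) * (1 + s * \<epsilon>) ^ (d - j))" by (simp only: mult_ac)
        qed
        finally show ?thesis unfolding gs R_def sum_distrib_left[symmetric] by (simp add: power_mult_distrib mult_ac)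
      qed
      have "R 0 = D3 * \<delta> ^ n * (\<Sum>j\<in>{n..d}. \<phi> j * 0 ^ (j - n))" by (simp add: R_def)
      also have "(\<Sum>j\<in>{n..d}. \<phi> j * 0 ^ (j - n)) = \<phi> n"
        using nd by (subst sum.remove[of _ n]) (auto intro!: sum.neutral)
      finally have R0: "R 0 \<noteq> 0" using D3 \<delta> \<phi>n by simp
      have Rh: "R holomorphic_on ball 0 1" unfolding R_def by (intro holomorphic_intros)
      have "holomorphic2 (g l m) UNIV"
        unfolding g_def cone_form_def proj_vector_mult
        by (simp, intro holomorphic2_intros binary_form_holomorphic2[OF a] binary_form_holomorphic2[OF b])
      then have "g l m \<in> \<O>" unfolding \<O>_def by auto
      from quot_dim_line[OF lm this Rh _ R0 gR]
      show ?thesis using ex by (simp add: tang_order_def der)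
    qed
    let ?S = "{tang_order (form_field \<theta>) (line_fun l m) | l m.
     (l, m) \<noteq> (0, 0) \<and> \<not> invariant_line (form_field \<theta>) (line_fun l m)}"
    have inf: "Inf ?S = enat (k + 1)" using tau by (simp add: \<theta>_def tau_order_def)
    have "?S \<noteq> {}"
    proof
      assume "?S = {}"
      then show False using inf by (simp only: Inf_empty top_enat_def) simp
    qed
    then obtain l m where lm: "(l, m) \<noteq> (0, 0)" "\<not> invariant_line (form_field \<theta>) (line_fun l m)" by blast
    have "?S \<subseteq> {enat n}" using key by auto
    then have "?S = {enat n}" using \<open>?S \<noteq> {}\<close> by (simp only: subset_singleton_iff) simp
    then have n: "n = k + 1" using inf by simp
    have ex: "\<exists>j\<le>d. \<phi> j \<noteq> 0" using key[OF lm] by blast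
    have "\<phi> n \<noteq> 0" unfolding n_def using ex by (metis (mono_tags, lifting) LeastI)
    moreover have below: "\<phi> j = 0" if "j < n" for j using not_less_Least that unfolding n_def by blast
    moreover have "n \<le> d" using ex below by (meson le_trans linorder_not_less)
    ultimately show "\<exists>\<phi>. (\<forall>X Y. pullB e1 e2 v1 v2 X Y = (\<Sum>j\<le>d. \<phi> j * X ^ j * Y ^ (d - j)))
      \<and> (\<forall>j\<le>k. \<phi> j = 0) \<and> k + 1 \<le> d \<and> \<phi> (k + 1) \<noteq> 0"
      using \<phi> unfolding \<Phi>_def pullB_def n by (intro exI[of _ \<phi>]) auto
  qed
qed

end

section \<open>Evaluation of homogeneous polynomials\<close>

lemma eval2_add: "eval2 (P + Q) x y = eval2 P x y + eval2 Q x y" by (simp add: eval2_def)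
lemma eval2_diff: "eval2 (P - Q) x y = eval2 P x y - eval2 Q x y" by (simp add: eval2_def)
lemma eval2_mult: "eval2 (P * Q) x y = eval2 P x y * eval2 Q x y" by (simp add: eval2_def)
lemma eval2_power: "eval2 (P ^ n) x y = eval2 P x y ^ n" by (simp add: eval2_def)
lemma eval2_X2: "eval2 X2 x y = x" by (simp add: eval2_def X2_def)
lemma eval2_Y2: "eval2 Y2 x y = y" by (simp add: eval2_def Y2_def)
lemma eval2_of_nat: "eval2 (of_nat n) x y = of_nat n"
  by (induction n) (auto simp: eval2_def)
lemma eval2_numeral: "eval2 (numeral n) x y = numeral n"
  using eval2_of_nat[of "numeral n"] by simp
lemma eval2_pCons: "eval2 (pCons q P) x y = poly q x + y * eval2 P x y"
  by (simp add: eval2_def)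
lemma eval2_0: "eval2 0 x y = 0" by (simp add: eval2_def)

lemmas eval2_simps = eval2_add eval2_diff eval2_mult eval2_power eval2_X2 eval2_Y2 eval2_of_nat eval2_numeral

lemma eval2_line_poly: "eval2 (line_poly l m) x y = l * x + m * y"
  unfolding line_poly_def eval2_simps by (simp add: eval2_def)

lemma eval2_sum_coeffs: "eval2 A x y = (\<Sum>j\<le>degree A. poly (coeff A j) x * y ^ j)"
  by (simp add: eval2_def poly_altdef[of A] poly_sum poly_const_pow mult.commute)

lemma homogeneous2_coeff:
  assumes "homogeneous2 d A"
  shows "coeff A j = (if j \<le> d then monom (coeff (coeff A j) (d - j)) (d - j) else 0)"
proof (rule poly_eqI)
  fix i
  have "coeff (coeff A j) i = 0" if "i + j \<noteq> d" using assms that by (auto simp: homogeneous2_def)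
  then show "coeff (coeff A j) i = coeff (if j \<le> d then monom (coeff (coeff A j) (d - j)) (d - j) else 0) i"
    by (cases "i + j = d") auto
qed

lemma binary_form_eval2:
  assumes "homogeneous2 d A" shows "binary_form d (eval2 A)"
proof -
  have "binary_form d (\<lambda>x y. poly (coeff A j) x * y ^ j)" for j
  proof (cases "j \<le> d")
    case True
    let ?c = "coeff (coeff A j) (d - j)"
    have "binary_form (d - j + (j + 0)) (\<lambda>x y. (1 * x + 0 * y) ^ (d - j) * ((0 * x + 1 * y) ^ j * ?c))"
      by (intro binary_form_linear_power_mult binary_form_const)
    moreover have "poly (coeff A j) x = ?c * x ^ (d - j)" for x
      by (subst homogeneous2_coeff[OF assms]) (simp add: True poly_monom)
    ultimately show ?thesis using True by (simp add: mult_ac)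
  next
    case False
    have "coeff A j = 0" by (subst homogeneous2_coeff[OF assms]) (simp add: False)
    then show ?thesis by (simp add: binary_form_zero)
  qed
  then have "binary_form d (\<lambda>x y. \<Sum>j\<le>degree A. poly (coeff A j) x * y ^ j)"
    by (intro binary_form_sum) auto
  then show ?thesis by (simp add: eval2_sum_coeffs[abs_def])
qed

lemma eval2_has_d:
  "has_d (\<lambda>z. eval2 A (fst z) (snd z))
     (eval2 (poly_dx A) (fst z) (snd z), eval2 (poly_dy A) (fst z) (snd z)) z"
proof (induction A rule: pCons_induct)
  case 0
  show ?case using has_d_const[of 0 z] by (simp add: poly_dx_def poly_dy_def eval2_0)
next
  case (pCons q P)
  have 1: "has_d (\<lambda>z. poly q (fst z)) (poly (pderiv q) (fst z), 0) z"
    using has_d_compose1[OF has_d_fst poly_DERIV, of q z] by simp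
  have dx: "poly_dx (pCons q P) = pCons (pderiv q) (poly_dx P)"
    by (simp add: poly_dx_def map_poly_pCons)
  have dy: "poly_dy (pCons q P) = P + pCons 0 (poly_dy P)"
    by (simp add: poly_dy_def pderiv_pCons)
  show ?case
    using has_d_add[OF 1 has_d_mult[OF has_d_snd pCons.IH]]
    unfolding dx dy eval2_pCons eval2_add by (simp add: eval2_pCons algebra_simps)
qed

lemma eval2_directional:
  "((\<lambda>t. eval2 A (x + t * u) (y + t * v)) has_field_derivative
     eval2 (poly_dx A) (x + t * u) (y + t * v) * u + eval2 (poly_dy A) (x + t * u) (y + t * v) * v) (at t)"
proof -
  have 1: "has_d (\<lambda>z. x + fst z * u) (u, 0) (t, 0)" "has_d (\<lambda>z. y + fst z * v) (v, 0) (t, 0)"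
    using has_d_add[OF has_d_const has_d_mult[OF has_d_fst has_d_const], of x u "(t, 0)"]
      has_d_add[OF has_d_const has_d_mult[OF has_d_fst has_d_const], of y v "(t, 0)"] by simp_all
  from has_d_slices(1)[OF has_d_compose2[OF eval2_has_d 1, of A, unfolded fst_conv snd_conv]]
  show ?thesis by simp
qed

text \<open>Differentiation of \<open>A(t x, t y) = t\<^bsup>d\<^esup> A(x, y)\<close> at \<open>t = 1\<close>.\<close>

lemma euler_relation:
  assumes "homogeneous2 d A"
  shows "of_nat d * eval2 A x y = x * eval2 (poly_dx A) x y + y * eval2 (poly_dy A) x y"
proof -
  have "((\<lambda>t. t ^ d * eval2 A x y) has_field_derivative of_nat d * 1 ^ (d - 1) * eval2 A x y) (at 1)"
    by (auto intro!: derivative_eq_intros)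
  moreover have "eval2 A (0 + t * x) (0 + t * y) = t ^ d * eval2 A x y" for t
    using binary_form_scale[OF binary_form_eval2[OF assms]] by simp
  ultimately show ?thesis
    using DERIV_unique[OF eval2_directional[of A 0 x 0 y 1]] by (simp add: mult.commute)
qed

lemma eval2_along_line:
  "\<exists>R. \<forall>t. eval2 Q (x + t * u) (y + t * v) = poly R t"
proof (induction Q rule: pCons_induct)
  case 0
  show ?case by (intro exI[of _ 0]) (simp add: eval2_0)
next
  case (pCons q P)
  then obtain R where R: "\<And>t. eval2 P (x + t * u) (y + t * v) = poly R t" by blast
  show ?case
    by (intro exI[of _ "pcompose q [:x, u:] + [:y, v:] * R"])
       (simp add: eval2_pCons R poly_pcompose algebra_simps)
qed

text \<open>A homogeneous polynomial that vanishes at \<open>(x, y) \<noteq> 0\<close> is divisible by the linear form that vanishes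
  there, normalized here as a monic polynomial in \<open>Y\<close> if \<open>x \<noteq> 0\<close>, and as \<open>X\<close> otherwise.\<close>

lemma no_common_zero_of_coprime:
  assumes A: "homogeneous2 d A" and B: "homogeneous2 d B" and cop: "coprime A B"
    and z: "eval2 A x y = 0" "eval2 B x y = 0"
  shows "x = 0 \<and> y = 0"
proof (rule ccontr)
  assume ne: "\<not> (x = 0 \<and> y = 0)"
  obtain L where L: "\<not> is_unit L" "\<And>P. homogeneous2 d P \<Longrightarrow> eval2 P x y = 0 \<Longrightarrow> L dvd P"
  proof (cases "x = 0")
    case False
    let ?L = "[:- [:0, y / x:], 1:] :: poly2"
    have "?L dvd P" if P: "homogeneous2 d P" "eval2 P x y = 0" for P
    proof -
      have "poly (poly P [:0, y / x:]) s = eval2 P s (s * (y / x))" for s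
        by (simp add: eval2_def poly_altdef[of P] poly_sum poly_power mult.commute)
      moreover have "eval2 P s (s * (y / x)) = 0" for s
      proof -
        have "eval2 P ((s / x) * x) ((s / x) * y) = 0"
          unfolding binary_form_scale[OF binary_form_eval2[OF P(1)]] P(2) by simp
        then show ?thesis using False by simp
      qed
      ultimately have "poly P [:0, y / x:] = 0" by (intro poly_eqI_degree_lead_coeff poly_ext) simp
      then show ?thesis by (simp add: poly_eq_0_iff_dvd)
    qed
    moreover have "\<not> is_unit ?L" by (simp add: is_unit_poly_iff)
    ultimately show ?thesis using that by blast
  next
    case True
    then have y: "y \<noteq> 0" using ne by simp
    let ?L = "[:[:0, 1:]:] :: poly2"
    have "?L dvd P" if P: "homogeneous2 d P" "eval2 P x y = 0" for P
      unfolding const_poly_dvd_iff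
    proof
      fix j
      have "y ^ d * eval2 P 0 1 = 0"
        using binary_form_scale[OF binary_form_eval2[OF P(1)], of y 0 1] P(2) True by simp
      then have e: "eval2 P 0 1 = 0" using y by simp
      have "poly (coeff P j) 0 = 0"
      proof (cases "j = d")
        case False
        then show ?thesis using P(1) by (simp add: poly_0_coeff_0 homogeneous2_def) (metis add_0)
      next
        case j: True
        have "poly (coeff P i) 0 = 0" if "i \<noteq> d" for i
          using P(1) that by (simp add: poly_0_coeff_0 homogeneous2_def) (metis add_0)
        then have "(\<Sum>i\<le>degree P. poly (coeff P i) 0) = (\<Sum>i\<le>degree P. if i = d then poly (coeff P d) 0 else 0)"
          by (intro sum.cong) auto
        also have "\<dots> = poly (coeff P d) 0" by (auto simp: coeff_eq_0)
        finally show ?thesis using e j by (simp add: eval2_sum_coeffs)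
      qed
      then show "[:0, 1:] dvd coeff P j" using poly_eq_0_iff_dvd[of "coeff P j" 0] by simp
    qed
    moreover have "\<not> is_unit ?L" by (simp add: is_unit_poly_iff)
    ultimately show ?thesis using that by blast
  qed
  then show False using cop A B z by (meson coprime_common_divisor)
qed

lemma eval3_sum_coeffs:
  "eval3 P v = (\<Sum>k\<le>degree P. (\<Sum>j\<le>degree (coeff P k). (\<Sum>i\<le>degree (coeff (coeff P k) j).
     coeff (coeff (coeff P k) j) i * (v$1) ^ i) * (v$2) ^ j) * (v$3) ^ k)"
proof -
  have "eval3 P v = (\<Sum>k\<le>degree P. eval2 (coeff P k * [:[:v$3:]:] ^ k) (v$1) (v$2))"
    unfolding eval3_def poly_altdef[of P] by (simp add: eval2_def poly_sum)
  also have "\<dots> = (\<Sum>k\<le>degree P. eval2 (coeff P k) (v$1) (v$2) * (v$3) ^ k)"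
    unfolding eval2_mult eval2_power by (simp add: eval2_def)
  finally show ?thesis by (simp add: eval2_sum_coeffs poly_altdef)
qed

lemma homogeneous3_scale:
  assumes "homogeneous3 n P" shows "eval3 P (t *s v) = t ^ n * eval3 P v"
proof -
  have *: "coeff (coeff (coeff P k) j) i * (t * x) ^ i * (t * y) ^ j * (t * z) ^ k
     = t ^ n * (coeff (coeff (coeff P k) j) i * x ^ i * y ^ j * z ^ k)" for i j k x y z
  proof (cases "i + j + k = n")
    case True
    have "t ^ i * t ^ j * t ^ k = t ^ n" unfolding True[symmetric] by (simp add: power_add)
    then show ?thesis by (simp add: power_mult_distrib mult_ac)
  next
    case False
    then show ?thesis using assms by (auto simp: homogeneous3_def)
  qed
  show ?thesis unfolding eval3_sum_coeffs sum_distrib_left sum_distrib_right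
    by (intro sum.cong refl) (use * in simp)
qed

lemma eval3_add: "eval3 (P + Q) v = eval3 P v + eval3 Q v" by (simp add: eval3_def eval2_def)
lemma eval3_mult: "eval3 (P * Q) v = eval3 P v * eval3 Q v" by (simp add: eval3_def eval2_def)
lemma eval3_vars: "eval3 X3 v = v$1" "eval3 Y3 v = v$2" "eval3 Z3 v = v$3"
  by (simp_all add: eval3_def eval2_def X3_def Y3_def Z3_def X2_def Y2_def)

lemma foliation_form_self:
  assumes "foliation d \<Omega>" shows "form_at \<Omega> p p = 0"
proof -
  have "eval3 (X3 * \<Omega>$1 + Y3 * \<Omega>$2 + Z3 * \<Omega>$3) p = 0"
    using assms by (simp add: foliation_def eval3_def eval2_def)
  then show ?thesis by (simp add: form_at_def sum_3 eval3_add eval3_mult eval3_vars mult.commute)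
qed

lemma foliation_form_scale:
  assumes "foliation d \<Omega>" shows "form_at \<Omega> (t *s p) w = t ^ (d + 1) * form_at \<Omega> p w"
proof -
  have "eval3 (\<Omega>$i) (t *s p) = t ^ (d + 1) * eval3 (\<Omega>$i) p" for i
    using assms homogeneous3_scale unfolding foliation_def by blast
  then show ?thesis by (simp add: form_at_def sum_distrib_left mult.assoc)
qed

lemma form_at_linear: "form_at \<Omega> p (c1 *s w1 + c2 *s w2) = c1 * form_at \<Omega> p w1 + c2 * form_at \<Omega> p w2"
  by (simp add: form_at_def sum_3 algebra_simps)

lemma form_at_homog_form: "form_at (homog_form A B) p w = cone_form (eval2 A) (eval2 B) p w"
  by (simp add: form_at_def homog_form_def sum_3 eval3_def eval2_def X3_def Y3_def Z3_def
        X2_def Y2_def cone_form_def algebra_simps)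

lemma cone_form_base_scale:
  assumes "binary_form d a" "binary_form d b"
  shows "cone_form a b (t *s p) w = t ^ (d + 1) * cone_form a b p w"
  using binary_form_scale[OF assms(1), of t "p$1" "p$2"] binary_form_scale[OF assms(2), of t "p$1" "p$2"]
  by (simp add: cone_form_def algebra_simps)

text \<open>The form is determined by its affine chart: contraction with the radial vector field vanishes, which
  gives the coefficient of \<open>dz\<close>; homogeneity extends the equality to all points off the line at infinity,
  and continuity to the remaining ones.\<close>

lemma described_by_form:
  assumes fol: "foliation d \<Omega>" and desc: "described_by d \<Omega> M A B"
  shows "form_at \<Omega> (M *v p) (M *v w) = cone_form (eval2 A) (eval2 B) p w"
proof -
  have A: "binary_form d (eval2 A)" and B: "binary_form d (eval2 B)"
    using desc binary_form_eval2 by (auto simp: described_by_def)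
  have ch: "chart_form \<Omega> M = form2 A B" using desc by (simp add: described_by_def)
  let ?e1 = "vector [1, 0, 0] :: complex^3" and ?e2 = "vector [0, 1, 0] :: complex^3"
  have affine: "form_at \<Omega> (M *v vector [x, y, 1]) (M *v w) = cone_form (eval2 A) (eval2 B) (vector [x, y, 1]) w"
    for x y w
  proof -
    let ?p = "vector [x, y, 1] :: complex^3"
    have e: "form_at \<Omega> (M *v ?p) (M *v ?e1) = eval2 A x y" "form_at \<Omega> (M *v ?p) (M *v ?e2) = eval2 B x y"
      using fun_cong[OF ch, of "(x, y)"] by (simp_all add: chart_form_def form2_def)
    have "w = w$3 *s ?p + 1 *s ((w$1 - x * w$3) *s ?e1 + (w$2 - y * w$3) *s ?e2)"
      by (simp add: vec_eq_iff forall_3)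
    then have "M *v w = w$3 *s (M *v ?p) + 1 *s ((w$1 - x * w$3) *s (M *v ?e1) + (w$2 - y * w$3) *s (M *v ?e2))"
      by (metis (no_types, lifting) matrix_vector_right_distrib vector_scalar_commute)
    then have "form_at \<Omega> (M *v ?p) (M *v w) = w$3 * form_at \<Omega> (M *v ?p) (M *v ?p)
      + 1 * ((w$1 - x * w$3) * form_at \<Omega> (M *v ?p) (M *v ?e1) + (w$2 - y * w$3) * form_at \<Omega> (M *v ?p) (M *v ?e2))"
      by (simp only: form_at_linear)
    then show ?thesis unfolding e foliation_form_self[OF fol] by (simp add: cone_form_def algebra_simps)
  qed
  have generic: "form_at \<Omega> (M *v q) (M *v w) = cone_form (eval2 A) (eval2 B) q w" if "q$3 \<noteq> 0" for q
  proof -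
    have q: "q = q$3 *s vector [q$1 / q$3, q$2 / q$3, 1]" using that by (simp add: vec_eq_iff forall_3)
    have "form_at \<Omega> (M *v (q$3 *s vector [q$1 / q$3, q$2 / q$3, 1])) (M *v w)
      = cone_form (eval2 A) (eval2 B) (q$3 *s vector [q$1 / q$3, q$2 / q$3, 1]) w"
      unfolding vector_scalar_commute foliation_form_scale[OF fol] affine cone_form_base_scale[OF A B] ..
    then show ?thesis using q by simp
  qed
  show ?thesis
  proof (cases "p$3 = 0")
    case False then show ?thesis by (rule generic)
  next
    case True
    let ?q = "\<lambda>t. vector [p$1, p$2, t] :: complex^3"
    have p: "p = ?q 0" using True by (simp add: vec_eq_iff forall_3)
    have c1: "continuous_on UNIV (\<lambda>t. form_at \<Omega> (M *v ?q t) (M *v w))"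
      unfolding form_at_def sum_3 eval3_sum_coeffs proj_vector_mult vector_3 by (intro continuous_intros)
    have c2: "continuous_on UNIV (\<lambda>t. cone_form (eval2 A) (eval2 B) (?q t) w)"
      unfolding cone_form_def vector_3 by (intro continuous_intros)
    have "((\<lambda>t. form_at \<Omega> (M *v ?q t) (M *v w)) \<longlongrightarrow> form_at \<Omega> (M *v ?q 0) (M *v w)) (at 0)"
      using c1 by (simp add: continuous_on_eq_continuous_at isCont_def)
    moreover have "\<forall>\<^sub>F t in at 0. form_at \<Omega> (M *v ?q t) (M *v w) = cone_form (eval2 A) (eval2 B) (?q t) w"
      using eventually_neq_at_within[of 0 0 UNIV] by eventually_elim (rule generic, simp)
    ultimately have "((\<lambda>t. cone_form (eval2 A) (eval2 B) (?q t) w) \<longlongrightarrow> form_at \<Omega> (M *v ?q 0) (M *v w)) (at 0)"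
      using tendsto_cong by fastforce
    moreover have "((\<lambda>t. cone_form (eval2 A) (eval2 B) (?q t) w) \<longlongrightarrow> cone_form (eval2 A) (eval2 B) (?q 0) w) (at 0)"
      using c2 by (simp add: continuous_on_eq_continuous_at isCont_def)
    ultimately show ?thesis unfolding p[symmetric] by (rule LIM_unique)
  qed
qed

section \<open>The Legendre transform of a homogeneous foliation\<close>

lemma cross_transpose:
  fixes M :: "complex^3^3"
  shows "M *v cross (transpose M *v l) (transpose M *v \<xi>) = det M *s cross l \<xi>"
  by (simp add: vec_eq_iff forall_3 matrix_vector_mult_def sum_3 cross_def transpose_def det_3 algebra_simps)

lemma dot_transpose:
  fixes M :: "complex^3^3"
  shows "(\<Sum>i\<in>UNIV. (transpose M *v l)$i * w$i) = (\<Sum>i\<in>UNIV. l$i * (M *v w)$i)"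
  by (simp add: matrix_vector_mult_def sum_3 transpose_def algebra_simps)

text \<open>At the point \<open>P = L \<times> \<Xi>\<close> about which the line \<open>L\<close> turns, the cone form annihilates \<open>P\<close> and so is a
  combination of \<open>L\<close> and \<open>\<Xi>\<close>. The coefficient of \<open>\<Xi>\<close> is the value of the Legendre web.\<close>

lemma cone_form_on_pencil:
  fixes L \<Xi> :: "complex^3"
  defines "P \<equiv> cross L \<Xi>"
  shows "cone_form a b P w = (L$1 * b (P$1) (P$2) - L$2 * a (P$1) (P$2)) * (\<Sum>i\<in>UNIV. \<Xi>$i * w$i)
     + (a (P$1) (P$2) * \<Xi>$2 - b (P$1) (P$2) * \<Xi>$1) * (\<Sum>i\<in>UNIV. L$i * w$i)"
  unfolding cone_form_def P_def cross_def sum_3 vector_3 by (simp add: algebra_simps)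

lemma cross_independent:
  fixes l \<xi> :: "complex^3"
  assumes "cross l \<xi> \<noteq> 0" "\<And>w. (\<Sum>i\<in>UNIV. (c * \<xi>$i + e * l$i) * w$i) = 0"
  shows "c = 0"
proof (rule ccontr)
  assume c: "c \<noteq> 0"
  have e: "c * \<xi>$1 + e * l$1 = 0" "c * \<xi>$2 + e * l$2 = 0" "c * \<xi>$3 + e * l$3 = 0"
    using assms(2)[of "vector [1, 0, 0]"] assms(2)[of "vector [0, 1, 0]"] assms(2)[of "vector [0, 0, 1]"]
    by (simp_all add: sum_3)
  have x: "\<xi>$i = (- e / c) * l$i" if "c * \<xi>$i + e * l$i = 0" for i
    using that c by (simp add: field_simps add_eq_0_iff)
  show False using assms(1) unfolding cross_def x[OF e(1)] x[OF e(2)] x[OF e(3)]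
    by (simp add: vec_eq_iff forall_3)
qed

text \<open>A linear change \<open>M\<close> of the plane acts on lines by the transpose and multiplies the vector product by
  \<open>det M\<close> (\<open>cross_transpose\<close>); since the form is homogeneous of degree \<open>d + 1\<close> in the point, this
  produces the constant factor.\<close>

lemma leg_web_cone:
  assumes a: "binary_form d a" and b: "binary_form d b" and d: "d \<ge> 1" and M: "invertible M"
    and rep: "\<And>p w. form_at \<Omega> (M *v p) (M *v w) = K * cone_form a b p w"
  shows "leg_web \<Omega> l \<xi> = K / det M ^ (d + 1) *
     ((transpose M *v l)$1 * b (cross (transpose M *v l) (transpose M *v \<xi>) $ 1) (cross (transpose M *v l) (transpose M *v \<xi>) $ 2)
      - (transpose M *v l)$2 * a (cross (transpose M *v l) (transpose M *v \<xi>) $ 1) (cross (transpose M *v l) (transpose M *v \<xi>) $ 2))"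
proof -
  define L \<Xi> P where "L = transpose M *v l" and "\<Xi> = transpose M *v \<xi>" and "P = cross L \<Xi>"
  have det: "det M \<noteq> 0" using M by (simp add: invertible_det_nz)
  obtain M1 where M1: "M ** M1 = mat 1" "M1 ** M = mat 1" using M by (auto simp: invertible_def)
  have MP: "M *v P = det M *s cross l \<xi>" unfolding P_def L_def \<Xi>_def by (rule cross_transpose)
  let ?a = "a (P$1) (P$2)" and ?b = "b (P$1) (P$2)"
  define k where "k = K / det M ^ (d + 1)"
  define C E where "C = k * (L$1 * ?b - L$2 * ?a)" and "E = k * (?a * \<Xi>$2 - ?b * \<Xi>$1)"
  have form: "form_at \<Omega> (cross l \<xi>) w = (\<Sum>i\<in>UNIV. (C * \<xi>$i + E * l$i) * w$i)" for w
  proof -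
    have "cross l \<xi> = M *v ((1 / det M) *s P)"
      unfolding vector_scalar_commute MP using det by (simp add: vec_eq_iff)
    moreover have w: "w = M *v (M1 *v w)" by (simp add: matrix_vector_mul_assoc M1)
    ultimately have "form_at \<Omega> (cross l \<xi>) w = K * cone_form a b ((1 / det M) *s P) (M1 *v w)"
      using rep by metis
    also have "\<dots> = k * cone_form a b P (M1 *v w)"
      unfolding cone_form_base_scale[OF a b] k_def by (simp add: power_divide)
    also have "cone_form a b P (M1 *v w) = (L$1 * ?b - L$2 * ?a) * (\<Sum>i\<in>UNIV. \<xi>$i * w$i)
       + (?a * \<Xi>$2 - ?b * \<Xi>$1) * (\<Sum>i\<in>UNIV. l$i * w$i)"
      unfolding P_def cone_form_on_pencil unfolding L_def \<Xi>_def dot_transpose w[symmetric] ..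
    also have "k * \<dots> = (\<Sum>i\<in>UNIV. (C * \<xi>$i + E * l$i) * w$i)"
      by (simp add: C_def E_def sum_3 algebra_simps)
    finally show ?thesis .
  qed
  have "leg_web \<Omega> l \<xi> = C"
  proof (cases "cross l \<xi> = 0")
    case True
    have "P = M1 *v (M *v P)" by (simp add: matrix_vector_mul_assoc M1)
    then have P0: "P = 0" unfolding MP True by simp
    have z: "(0::complex) ^ d = 0" using d by simp
    have "?a = 0" "?b = 0"
      using binary_form_scale[OF a, of 0 0 0] binary_form_scale[OF b, of 0 0 0] by (simp_all add: P0 z)
    then show ?thesis using True by (simp add: leg_web_def C_def)
  next
    case False
    have "(THE c. \<exists>e. \<forall>w. form_at \<Omega> (cross l \<xi>) w = (\<Sum>i\<in>UNIV. (c * \<xi>$i + e * l$i) * w$i)) = C"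
    proof (rule the_equality)
      show "\<exists>e. \<forall>w. form_at \<Omega> (cross l \<xi>) w = (\<Sum>i\<in>UNIV. (C * \<xi>$i + e * l$i) * w$i)"
        using form by blast
      fix c assume "\<exists>e. \<forall>w. form_at \<Omega> (cross l \<xi>) w = (\<Sum>i\<in>UNIV. (c * \<xi>$i + e * l$i) * w$i)"
      then obtain e where e: "\<And>w. form_at \<Omega> (cross l \<xi>) w = (\<Sum>i\<in>UNIV. (c * \<xi>$i + e * l$i) * w$i)" by blast
      have "(\<Sum>i\<in>UNIV. ((c - C) * \<xi>$i + (e - E) * l$i) * w$i) = 0" for w
        using e[of w] form[of w] by (simp add: sum_3 algebra_simps)
      from cross_independent[OF False this] show "c = C" by simp
    qed
    then show ?thesis using False by (simp add: leg_web_def)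
  qed
  then show ?thesis unfolding C_def k_def P_def L_def \<Xi>_def .
qed

lemma famB_form: "d \<ge> 1 \<Longrightarrow> binary_form d (famB d)"
proof -
  assume d: "d \<ge> 1"
  have "binary_form (d - 1 + Suc 0) (\<lambda>x y. (1 * x + 0 * y) ^ (d - 1) * ((- of_nat (d - 1) * x + of_nat d * y) * 1))"
    by (intro binary_form_linear_power_mult binary_form_mult_linear binary_form_const)
  then show ?thesis using d by (simp add: famB_def[abs_def] algebra_simps)
qed

lemma famA_form: "d \<ge> 1 \<Longrightarrow> binary_form d (famA d \<rho> c)"
proof -
  assume d: "d \<ge> 1"
  have "binary_form (d + 0) (\<lambda>x y. (0 * x + 1 * y) ^ d * c)"
    by (intro binary_form_linear_power_mult binary_form_const)
  then have "binary_form d (\<lambda>x y. c * y ^ d)" by (simp add: mult.commute)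
  then show ?thesis unfolding famA_def[abs_def]
    by (rule binary_form_add[OF binary_form_cmult[OF famB_form[OF d]]])
qed

theorem flat_leg_family:
  assumes d: "d \<ge> 3" and c: "c \<noteq> 0" and K: "K \<noteq> 0" and M: "invertible M"
    and rep: "\<And>p w. form_at \<Omega> (M *v p) (M *v w) = K * cone_form (famA d \<rho> c) (famB d) p w"
  shows "flat_web d (leg_web \<Omega>) \<longleftrightarrow>
    \<rho> * (\<rho> + of_nat (d - 1)) = 0 \<and> (\<rho> + c - 2) * (\<rho> + c + 1) = 0"
proof (rule flat_family[OF d c])
  have d1: "d \<ge> 1" using d by simp
  have det: "det M \<noteq> 0" using M by (simp add: invertible_det_nz)
  show "K / det M ^ (d + 1) \<noteq> 0" using K det by simp
  show "invertible (transpose M)" using det by (simp add: invertible_det_nz det_transpose)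
  show "leg_web \<Omega> l \<xi> = K / det M ^ (d + 1) * fam_web d \<rho> c (transpose M *v l) (transpose M *v \<xi>)" for l \<xi>
    unfolding leg_web_cone[OF famA_form[OF d1] famB_form[OF d1] d1 M rep] fam_web_def
    by (simp add: cross_def)
qed

section \<open>Normal forms of the two types\<close>

context cone_foliation
begin

lemma pull_swap: "pullB a2 b2 a1 b1 Y X = pullA a1 b1 a2 b2 X Y"
  by (simp add: pullA_def pullB_def add.commute)

lemma pull_radial:
  "(X * a1 + Y * a2) * a (X * a1 + Y * a2) (X * b1 + Y * b2) + (X * b1 + Y * b2) * b (X * a1 + Y * a2) (X * b1 + Y * b2)
   = X * pullA a1 b1 a2 b2 X Y + Y * pullB a1 b1 a2 b2 X Y"
  by (simp add: pullA_def pullB_def algebra_simps)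

lemma pull_no_common_zero:
  assumes \<Delta>: "a1 * b2 - b1 * a2 \<noteq> 0" and z: "pullA a1 b1 a2 b2 X Y = 0" "pullB a1 b1 a2 b2 X Y = 0"
  shows "X = 0 \<and> Y = 0"
proof -
  let ?x = "X * a1 + Y * a2" and ?y = "X * b1 + Y * b2"
  have "(a1 * b2 - b1 * a2) * a ?x ?y = b2 * pullA a1 b1 a2 b2 X Y - b1 * pullB a1 b1 a2 b2 X Y"
    "(a1 * b2 - b1 * a2) * b ?x ?y = a1 * pullB a1 b1 a2 b2 X Y - a2 * pullA a1 b1 a2 b2 X Y"
    by (simp_all add: pullA_def pullB_def algebra_simps)
  then have "a ?x ?y = 0" "b ?x ?y = 0" using z \<Delta> by simp_all
  then have xy: "?x = 0 \<and> ?y = 0" by (rule no_common_zero)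
  have "(a1 * b2 - b1 * a2) * X = b2 * ?x - a2 * ?y" "(a1 * b2 - b1 * a2) * Y = a1 * ?y - b1 * ?x"
    by (simp_all add: algebra_simps)
  then show ?thesis using xy \<Delta> by simp
qed

lemma binary_form_pullA: "binary_form d (pullA a1 b1 a2 b2)"
  unfolding pullA_def[abs_def]
  by (intro binary_form_add binary_form_cmult binary_form_compose a b)

lemma pull_scale:
  "pullA (s * a1) (s * b1) a2 b2 X Y = s * pullA a1 b1 a2 b2 (s * X) Y"
  "pullB (s * a1) (s * b1) a2 b2 X Y = pullB a1 b1 a2 b2 (s * X) Y"
  by (simp_all add: pullA_def pullB_def algebra_simps)

text \<open>The remaining freedom is the scaling of the first basis vector.\<close>

lemma normalize_pull:
  assumes d3: "d \<ge> 3"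
    and B: "\<And>X Y. pullB a1 b1 a2 b2 X Y = X ^ (d - 1) * (\<beta> * Y + \<gamma> * X)"
    and A: "\<And>X Y. pullA a1 b1 a2 b2 X Y = \<rho>0 * pullB a1 b1 a2 b2 X Y + c0 * Y ^ d"
    and nz: "\<beta> \<noteq> 0" "\<gamma> \<noteq> 0" "c0 \<noteq> 0"
  obtains s K c where "s \<noteq> 0" "K \<noteq> 0" "c \<noteq> 0"
    "\<And>X Y. pullB (s * a1) (s * b1) a2 b2 X Y = K * famB d X Y"
    "\<And>X Y. pullA (s * a1) (s * b1) a2 b2 X Y = K * famA d (s * \<rho>0) c X Y"
proof -
  define n D where "n = (of_nat (d - 1) :: complex)" and "D = (of_nat d :: complex)"
  have nD: "n \<noteq> 0" "D \<noteq> 0" using d3 by (auto simp: n_def D_def)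
  \<comment> \<open>This \<open>s\<close> makes \<open>\<beta> Y + \<gamma> s X\<close> proportional to \<open>d Y - (d-1) X\<close>.\<close>
  define s where "s = - n * \<beta> / (D * \<gamma>)"
  define K where "K = s ^ (d - 1) * \<beta> / D"
  have s: "s \<noteq> 0" using nD nz by (simp add: s_def)
  have K: "K \<noteq> 0" using s nD nz by (simp add: K_def)
  have sg: "\<gamma> * s = - n * \<beta> / D" using nz nD by (simp add: s_def field_simps)
  have B': "pullB (s * a1) (s * b1) a2 b2 X Y = K * famB d X Y" for X Y
  proof -
    have "pullB (s * a1) (s * b1) a2 b2 X Y = s ^ (d - 1) * X ^ (d - 1) * (\<beta> * Y + (\<gamma> * s) * X)"
      unfolding pull_scale B by (simp add: power_mult_distrib mult.assoc)
    also have "\<beta> * Y + (\<gamma> * s) * X = \<beta> / D * (D * Y - n * X)"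
      unfolding sg using nD by (simp add: field_simps)
    finally show ?thesis unfolding K_def famB_def n_def[symmetric] D_def[symmetric] by (simp add: mult_ac)
  qed
  have A': "pullA (s * a1) (s * b1) a2 b2 X Y = K * famA d (s * \<rho>0) (s * c0 / K) X Y" for X Y
  proof -
    have "pullA (s * a1) (s * b1) a2 b2 X Y = s * (\<rho>0 * (K * famB d X Y) + c0 * Y ^ d)"
      unfolding pull_scale(1) A pull_scale(2)[symmetric] B' ..
    then show ?thesis using K by (simp add: famA_def field_simps)
  qed
  show ?thesis by (rule that[of s K "s * c0 / K"]) (use s K nz A' B' in auto)
qed

lemma family_rep:
  assumes \<Delta>: "a1 * b2 - b1 * a2 \<noteq> 0"
    and B: "\<And>X Y. pullB a1 b1 a2 b2 X Y = K * b' X Y"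
    and A: "\<And>X Y. pullA a1 b1 a2 b2 X Y = K * a' X Y"
  shows "\<exists>M'. invertible M' \<and> (\<forall>p w. form_at \<Omega> (M' *v p) (M' *v w) = K * cone_form a' b' p w)"
proof -
  define g :: "complex^3^3" where "g = vector [vector [a1, a2, 0], vector [b1, b2, 0], vector [0, 0, 1]]"
  have gv: "g *v v = vector [a1 * v$1 + a2 * v$2, b1 * v$1 + b2 * v$2, v$3]" for v
    by (simp add: vec_eq_iff forall_3 matrix_vector_mult_def sum_3 g_def)
  have "det g = a1 * b2 - b1 * a2" by (simp add: det_3 g_def)
  then have "invertible g" using \<Delta> by (simp add: invertible_det_nz)
  then have "invertible (M ** g)" using M by (intro invertible_mult)
  moreover have "form_at \<Omega> ((M ** g) *v p) ((M ** g) *v w) = K * cone_form a' b' p w" for p w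
  proof -
    have "form_at \<Omega> ((M ** g) *v p) ((M ** g) *v w) = cone_form a b (g *v p) (g *v w)"
      using rep by (simp add: matrix_vector_mul_assoc[symmetric])
    also have "\<dots> = cone_form (pullA a1 b1 a2 b2) (pullB a1 b1 a2 b2) p w"
      unfolding gv cone_form_def vector_3 pullA_def pullB_def by (simp add: algebra_simps)
    also have "\<dots> = K * cone_form a' b' p w" unfolding cone_form_def A B by (simp add: algebra_simps)
    finally show ?thesis .
  qed
  ultimately show ?thesis by blast
qed

text \<open>For a radial singularity of order \<open>d - 2\<close> only two monomials of \<open>pullB\<close> are left.\<close>

lemma radial_pull:
  assumes rad: "radial_of_order \<Omega> s k" and k: "k + 2 = d"
  obtains v1 v2 where "(v1, v2) \<noteq> (0, 0)" "\<And>e1 e2. e1 * v2 - e2 * v1 \<noteq> 0 \<Longrightarrow>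
     \<exists>\<beta> \<gamma>. \<beta> \<noteq> 0 \<and> (\<forall>X Y. pullB e1 e2 v1 v2 X Y = X ^ (d - 1) * (\<beta> * Y + \<gamma> * X))"
proof -
  obtain v1 v2 where v: "(v1, v2) \<noteq> (0, 0)" and
    e: "\<And>e1 e2. e1 * v2 - e2 * v1 \<noteq> 0 \<Longrightarrow> \<exists>\<phi>. (\<forall>X Y. pullB e1 e2 v1 v2 X Y = (\<Sum>j\<le>d. \<phi> j * X ^ j * Y ^ (d - j)))
      \<and> (\<forall>j\<le>k. \<phi> j = 0) \<and> k + 1 \<le> d \<and> \<phi> (k + 1) \<noteq> 0"
    using radial_point[OF rad] by blast
  show ?thesis
  proof (rule that[OF v])
    fix e1 e2 assume "e1 * v2 - e2 * v1 \<noteq> 0"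
    from e[OF this] obtain \<phi> where \<phi>: "\<And>X Y. pullB e1 e2 v1 v2 X Y = (\<Sum>j\<le>d. \<phi> j * X ^ j * Y ^ (d - j))"
      "\<And>j. j \<le> k \<Longrightarrow> \<phi> j = 0" "\<phi> (k + 1) \<noteq> 0" by blast
    have "pullB e1 e2 v1 v2 X Y = X ^ (d - 1) * (\<phi> (k + 1) * Y + \<phi> d * X)" for X Y
    proof -
      have "(\<Sum>j\<le>d. \<phi> j * X ^ j * Y ^ (d - j)) = (\<Sum>j\<in>{d - 1, d}. \<phi> j * X ^ j * Y ^ (d - j))"
        by (rule sum.mono_neutral_right) (use \<phi>(2) k in auto)
      also have "\<dots> = \<phi> (d - 1) * X ^ (d - 1) * Y ^ (d - (d - 1)) + \<phi> d * X ^ d * Y ^ (d - d)"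
        using k by (subst sum.insert) auto
      also have "d - (d - 1) = 1" using k by simp
      also have "X ^ d = X ^ (d - 1) * X" using k by (cases d) auto
      also have "d - 1 = k + 1" using k by simp
      finally show ?thesis unfolding \<phi>(1) by (simp add: algebra_simps flip: k)
    qed
    then show "\<exists>\<beta> \<gamma>. \<beta> \<noteq> 0 \<and> (\<forall>X Y. pullB e1 e2 v1 v2 X Y = X ^ (d - 1) * (\<beta> * Y + \<gamma> * X))"
      using \<phi>(3) by blast
  qed
qed

lemma radial_pull_max:
  assumes rad: "radial_of_order \<Omega> s k" and k: "k + 1 = d"
  obtains v1 v2 where "(v1, v2) \<noteq> (0, 0)" "\<And>e1 e2. e1 * v2 - e2 * v1 \<noteq> 0 \<Longrightarrow>
     \<exists>\<gamma>. \<gamma> \<noteq> 0 \<and> (\<forall>X Y. pullB e1 e2 v1 v2 X Y = \<gamma> * X ^ d)"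
proof -
  obtain v1 v2 where v: "(v1, v2) \<noteq> (0, 0)" and
    e: "\<And>e1 e2. e1 * v2 - e2 * v1 \<noteq> 0 \<Longrightarrow> \<exists>\<phi>. (\<forall>X Y. pullB e1 e2 v1 v2 X Y = (\<Sum>j\<le>d. \<phi> j * X ^ j * Y ^ (d - j)))
      \<and> (\<forall>j\<le>k. \<phi> j = 0) \<and> k + 1 \<le> d \<and> \<phi> (k + 1) \<noteq> 0"
    using radial_point[OF rad] by blast
  show ?thesis
  proof (rule that[OF v])
    fix e1 e2 assume "e1 * v2 - e2 * v1 \<noteq> 0"
    from e[OF this] obtain \<phi> where \<phi>: "\<And>X Y. pullB e1 e2 v1 v2 X Y = (\<Sum>j\<le>d. \<phi> j * X ^ j * Y ^ (d - j))"
      "\<And>j. j \<le> k \<Longrightarrow> \<phi> j = 0" "\<phi> (k + 1) \<noteq> 0" by blast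
    have "pullB e1 e2 v1 v2 X Y = \<phi> d * X ^ d" for X Y
    proof -
      have "(\<Sum>j\<le>d. \<phi> j * X ^ j * Y ^ (d - j)) = (\<Sum>j\<in>{d}. \<phi> j * X ^ j * Y ^ (d - j))"
        by (rule sum.mono_neutral_right) (use \<phi>(2) k in auto)
      then show ?thesis unfolding \<phi>(1) by simp
    qed
    then show "\<exists>\<gamma>. \<gamma> \<noteq> 0 \<and> (\<forall>X Y. pullB e1 e2 v1 v2 X Y = \<gamma> * X ^ d)"
      using \<phi>(3) k by auto
  qed
qed

end

text \<open>The polynomials are needed besides their values, since inflection lines are defined by divisibility of
  \<open>D_poly A B\<close>.\<close>

locale polynomial_foliation =
  fixes d :: nat and A B :: poly2 and \<Omega> :: form3 and M :: "complex^3^3"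
  assumes d3: "d \<ge> 3" and fol: "foliation d \<Omega>" and desc: "described_by d \<Omega> M A B"
begin

lemma homA: "homogeneous2 d A" and homB: "homogeneous2 d B" and cop: "coprime A B" and M: "invertible M"
  using desc by (auto simp: described_by_def)

sublocale cone_foliation d "eval2 A" "eval2 B" \<Omega> M
proof
  show "eval2 A x y = 0 \<Longrightarrow> eval2 B x y = 0 \<Longrightarrow> x = 0 \<and> y = 0" for x y
    by (rule no_common_zero_of_coprime[OF homA homB cop])
qed (use d3 M described_by_form[OF fol desc] binary_form_eval2 homA homB in auto)

text \<open>By Euler's relation the Wronskian of the two coefficients along \<open>X = const\<close> is a multiple of \<open>D_poly A B\<close>.
  Thus the directions in which \<open>D_poly A B\<close> vanishes are the critical points of the Gauss map \<open>- A/B\<close>,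
  with the same multiplicities away from \<open>X = 0\<close>.\<close>

lemma pull_jacobian:
  assumes dA: "((\<lambda>Y. pullA a1 b1 a2 b2 X Y) has_field_derivative A') (at Y)"
    and dB: "((\<lambda>Y. pullB a1 b1 a2 b2 X Y) has_field_derivative B') (at Y)"
  shows "of_nat d * (pullA a1 b1 a2 b2 X Y * B' - A' * pullB a1 b1 a2 b2 X Y)
    = (a1 * b2 - b1 * a2)\<^sup>2 * X * eval2 (D_poly A B) (X * a1 + Y * a2) (X * b1 + Y * b2)"
proof -
  let ?x = "X * a1 + Y * a2" and ?y = "X * b1 + Y * b2"
  define Av Bv where "Av = eval2 A ?x ?y" and "Bv = eval2 B ?x ?y"
  define Ax Ay Bx By where "Ax = eval2 (poly_dx A) ?x ?y" and "Ay = eval2 (poly_dy A) ?x ?y"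
    and "Bx = eval2 (poly_dx B) ?x ?y" and "By = eval2 (poly_dy B) ?x ?y"
  define DA DB where "DA = Ax * a2 + Ay * b2" and "DB = Bx * a2 + By * b2"
  have 1: "((\<lambda>Y. eval2 A (X * a1 + Y * a2) (X * b1 + Y * b2)) has_field_derivative DA) (at Y)"
    "((\<lambda>Y. eval2 B (X * a1 + Y * a2) (X * b1 + Y * b2)) has_field_derivative DB) (at Y)"
    using eval2_directional[of A "X * a1" a2 "X * b1" b2 Y] eval2_directional[of B "X * a1" a2 "X * b1" b2 Y]
    by (simp_all add: DA_def DB_def Ax_def Ay_def Bx_def By_def)
  have "((\<lambda>Y. pullA a1 b1 a2 b2 X Y) has_field_derivative a1 * DA + b1 * DB) (at Y)"
    unfolding pullA_def by (intro DERIV_add DERIV_cmult 1)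
  then have A': "A' = a1 * DA + b1 * DB" by (rule DERIV_unique[OF dA])
  have "((\<lambda>Y. pullB a1 b1 a2 b2 X Y) has_field_derivative a2 * DA + b2 * DB) (at Y)"
    unfolding pullB_def by (intro DERIV_add DERIV_cmult 1)
  then have B': "B' = a2 * DA + b2 * DB" by (rule DERIV_unique[OF dB])
  have euler: "of_nat d * Av = ?x * Ax + ?y * Ay" "of_nat d * Bv = ?x * Bx + ?y * By"
    unfolding Av_def Bv_def Ax_def Ay_def Bx_def By_def
    by (rule euler_relation[OF homA], rule euler_relation[OF homB])
  have "of_nat d * (pullA a1 b1 a2 b2 X Y * B' - A' * pullB a1 b1 a2 b2 X Y)
    = (a1 * b2 - b1 * a2) * ((of_nat d * Av) * DB - DA * (of_nat d * Bv))"
    unfolding A' B' pullA_def pullB_def Av_def[symmetric] Bv_def[symmetric] by (simp add: algebra_simps)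
  also have "(of_nat d * Av) * DB - DA * (of_nat d * Bv) = (?x * b2 - ?y * a2) * (Ax * By - Ay * Bx)"
    unfolding euler DA_def DB_def by (simp add: algebra_simps)
  also have "?x * b2 - ?y * a2 = (a1 * b2 - b1 * a2) * X" by (simp add: algebra_simps)
  also have "Ax * By - Ay * Bx = eval2 (D_poly A B) ?x ?y"
    by (simp add: D_poly_def eval2_diff eval2_mult Ax_def Ay_def Bx_def By_def)
  finally show ?thesis by (simp add: power2_eq_square mult_ac)
qed

text \<open>In the normal form \<open>D_poly A B\<close> is a multiple of \<open>X\<^bsup>d-2\<^esup> Y\<^bsup>d-1\<^esup> (X - Y)\<close>. The direction \<open>X = 0\<close> is
  invariant and \<open>Y = 0\<close> is excluded by assumption, so \<open>(w1, w2)\<close> is the direction \<open>X = Y\<close>. It is invariant iff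
  \<open>\<rho> + c + 1 = 0\<close>.\<close>

lemma third_critical_direction:
  assumes \<Delta>: "a1 * b2 - b1 * a2 \<noteq> 0" and K: "K \<noteq> 0" and c: "c \<noteq> 0"
    and PB: "\<And>X Y. pullB a1 b1 a2 b2 X Y = K * famB d X Y"
    and PA: "\<And>X Y. pullA a1 b1 a2 b2 X Y = K * famA d \<rho> c X Y"
    and J: "eval2 (D_poly A B) w1 w2 = 0" and nonfixed: "w1 * eval2 A w1 w2 + w2 * eval2 B w1 w2 \<noteq> 0"
    and other: "\<And>k. (w1, w2) \<noteq> (k * a1, k * b1)"
  shows "\<rho> + c + 1 \<noteq> 0"
proof -
  define X Y where "X = (w1 * b2 - w2 * a2) / (a1 * b2 - b1 * a2)" and "Y = (a1 * w2 - b1 * w1) / (a1 * b2 - b1 * a2)"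
  have w: "w1 = X * a1 + Y * a2" "w2 = X * b1 + Y * b2"
  proof -
    have "(a1 * b2 - b1 * a2) * w1 = (w1 * b2 - w2 * a2) * a1 + (a1 * w2 - b1 * w1) * a2"
      "(a1 * b2 - b1 * a2) * w2 = (w1 * b2 - w2 * a2) * b1 + (a1 * w2 - b1 * w1) * b2"
      by (simp_all add: algebra_simps)
    then show "w1 = X * a1 + Y * a2" "w2 = X * b1 + Y * b2" unfolding X_def Y_def using \<Delta>
      by (simp_all add: add_divide_distrib[symmetric] nonzero_eq_divide_eq mult.commute)
  qed
  have fixed: "X * (K * famA d \<rho> c X Y) + Y * (K * famB d X Y) \<noteq> 0"
    using nonfixed pull_radial[of X a1 Y a2 b1 b2] unfolding w PA PB by simp
  have n0: "d - 1 \<noteq> 0" using d3 by simp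
  let ?n = "of_nat (d - 1) :: complex" and ?D = "of_nat d :: complex"
  have nD: "?n \<noteq> 0" "?D \<noteq> 0" "?D = ?n + 1" using d3 by (auto simp: of_nat_diff)
  have dB: "((\<lambda>Y. pullB a1 b1 a2 b2 X Y) has_field_derivative K * (X ^ (d - 1) * ?D)) (at Y)"
    unfolding PB famB_def by (auto intro!: derivative_eq_intros)
  have dA: "((\<lambda>Y. pullA a1 b1 a2 b2 X Y) has_field_derivative K * (\<rho> * (X ^ (d - 1) * ?D) + c * (?D * Y ^ (d - 1)))) (at Y)"
    unfolding PA famA_def famB_def by (auto intro!: derivative_eq_intros)
  have z: "?D * (K * famA d \<rho> c X Y * (K * (X ^ (d - 1) * ?D))
      - K * (\<rho> * (X ^ (d - 1) * ?D) + c * (?D * Y ^ (d - 1))) * (K * famB d X Y)) = 0"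
    using pull_jacobian[OF dA dB] J unfolding w PA PB by simp
  have "Y ^ d = Y ^ (d - 1) * Y" using d3 by (cases d) auto
  then have z': "?D * (K * famA d \<rho> c X Y * (K * (X ^ (d - 1) * ?D))
      - K * (\<rho> * (X ^ (d - 1) * ?D) + c * (?D * Y ^ (d - 1))) * (K * famB d X Y))
    = K * K * ?D * ?D * c * ?n * X ^ (d - 1) * Y ^ (d - 1) * (X - Y)"
    unfolding famA_def famB_def nD(3) by (simp add: algebra_simps)
  from z have "K * K * ?D * ?D * c * ?n * X ^ (d - 1) * Y ^ (d - 1) * (X - Y) = 0" unfolding z' .
  then have "X = 0 \<or> Y = 0 \<or> X = Y" using K c nD(1,2) by auto
  moreover have "X \<noteq> 0"
  proof
    assume "X = 0"
    then show False using fixed n0 by (simp add: famB_def)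
  qed
  moreover have "Y \<noteq> 0" using w other[of X] by auto
  ultimately have XY: "X = Y" by simp
  have XX: "famB d X X = X ^ d"
  proof -
    have "X ^ d = X ^ (d - 1) * X" using d3 by (cases d) auto
    then show ?thesis unfolding famB_def nD(3) by (simp add: algebra_simps)
  qed
  have "X * (K * famA d \<rho> c X Y) + Y * (K * famB d X Y) = X * K * X ^ d * (\<rho> + c + 1)"
    unfolding XY[symmetric] famA_def XX by (simp add: algebra_simps)
  then show ?thesis using fixed by auto
qed

text \<open>With \<open>P(t)\<close> and \<open>t \<mapsto> \<gamma> + \<beta> t\<close> the two coefficients on \<open>X = 1\<close>, the divisibility says that
  \<open>\<beta> P - (\<gamma> + \<beta> t) P'\<close> vanishes to order \<open>d - 1\<close> at \<open>t = 0\<close>. This is a recursion for the coefficients of \<open>P\<close> which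
  leaves only a multiple of \<open>\<gamma> + \<beta> t\<close> and the monomial \<open>t\<^bsup>d\<^esup>\<close>.\<close>

lemma maximal_inflection_pull:
  assumes \<Delta>: "m * b2 + l * a2 \<noteq> 0"
    and dvd: "line_poly l m ^ (d - 1) dvd D_poly A B"
    and PB: "\<And>X Y. pullB m (- l) a2 b2 X Y = X ^ (d - 1) * (\<beta> * Y + \<gamma> * X)"
    and \<beta>: "\<beta> \<noteq> 0" and a0: "pullA m (- l) a2 b2 1 0 \<noteq> 0"
  shows "\<gamma> \<noteq> 0 \<and> (\<exists>\<alpha>. \<forall>X Y. pullA m (- l) a2 b2 X Y =
    pullA m (- l) a2 b2 1 0 / \<gamma> * pullB m (- l) a2 b2 X Y + \<alpha> * Y ^ d)"
proof -
  let ?A = "pullA m (- l) a2 b2" and ?B = "pullB m (- l) a2 b2"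
  have "binary_form d (\<lambda>X Y. ?A Y X)"
    using binary_form_compose[OF binary_form_pullA[of m "- l" a2 b2], of 0 1 1 0] by simp
  then obtain s where s: "\<And>X Y. ?A X Y = (\<Sum>j\<le>d. s j * Y ^ j * X ^ (d - j))"
    unfolding binary_form_def by blast
  define P where "P = (\<Sum>j\<le>d. monom (s j) j)"
  have Pt: "poly P t = ?A 1 t" for t by (simp add: P_def s poly_sum poly_monom)
  have cP: "coeff P j = s j" if "j \<le> d" for j
    using that by (simp add: P_def coeff_sum)
  obtain Q where Q: "D_poly A B = line_poly l m ^ (d - 1) * Q" using dvd by blast
  obtain R where R: "\<And>t. eval2 Q (m + t * a2) (- l + t * b2) = poly R t" using eval2_along_line by blast
  define e where "e = m * b2 + l * a2"
  have jac: "of_nat d * (poly P t * \<beta> - poly (pderiv P) t * (\<gamma> + \<beta> * t))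
     = e\<^sup>2 * (t * e) ^ (d - 1) * poly R t" for t
  proof -
    have dB: "((\<lambda>Y. ?B 1 Y) has_field_derivative \<beta>) (at t)"
      unfolding PB by (auto intro!: derivative_eq_intros)
    have dA: "((\<lambda>Y. ?A 1 Y) has_field_derivative poly (pderiv P) t) (at t)"
      unfolding Pt[symmetric] by (rule poly_DERIV)
    have "l * (1 * m + t * a2) + m * (1 * - l + t * b2) = t * e" by (simp add: e_def algebra_simps)
    then have "eval2 (D_poly A B) (1 * m + t * a2) (1 * - l + t * b2) = (t * e) ^ (d - 1) * poly R t"
      unfolding Q eval2_mult eval2_power eval2_line_poly using R[of t] by simp
    then have "of_nat d * (?A 1 t * \<beta> - poly (pderiv P) t * ?B 1 t) = (m * b2 - - l * a2)\<^sup>2 * 1 * ((t * e) ^ (d - 1) * poly R t)"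
      using pull_jacobian[OF dA dB] by simp
    then show ?thesis by (simp add: Pt PB e_def algebra_simps)
  qed
  have "smult (of_nat d) (smult \<beta> P - [:\<gamma>, \<beta>:] * pderiv P) = monom (e\<^sup>2 * e ^ (d - 1)) (d - 1) * R"
    (is "?L = ?R")
  proof (rule iffD1[OF poly_eq_poly_eq_iff], rule ext)
    fix t
    have "poly ?L t = of_nat d * (poly P t * \<beta> - poly (pderiv P) t * (\<gamma> + \<beta> * t))"
      by (simp add: algebra_simps)
    also have "\<dots> = poly ?R t" unfolding jac by (simp add: poly_monom power_mult_distrib mult_ac)
    finally show "poly ?L t = poly ?R t" .
  qed
  then have coeffs: "coeff ?L i = coeff ?R i" for i by simp
  have rec: "\<beta> * (1 - of_nat i) * s i = \<gamma> * of_nat (Suc i) * s (Suc i)" if i: "i < d - 1" for i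
  proof -
    have "coeff ([:\<gamma>, \<beta>:] * pderiv P) i = \<gamma> * of_nat (Suc i) * s (Suc i) + \<beta> * of_nat i * s i"
      using i cP[of i] cP[of "Suc i"]
      by (cases i) (auto simp: coeff_pderiv mult.assoc)
    then have "of_nat d * (\<beta> * s i - (\<gamma> * of_nat (Suc i) * s (Suc i) + \<beta> * of_nat i * s i)) = 0"
      using coeffs[of i] i cP[of i] by (simp add: coeff_monom_mult)
    then have "\<beta> * s i - (\<gamma> * of_nat (Suc i) * s (Suc i) + \<beta> * of_nat i * s i) = 0"
      using d3 by simp
    then show ?thesis by (simp add: algebra_simps)
  qed
  have s0: "s 0 = ?A 1 0"
    unfolding s by (subst sum.remove[of _ 0]) (auto intro!: sum.neutral)
  have s1: "\<beta> * s 0 = \<gamma> * s 1" using rec[of 0] d3 by simp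
  then have \<gamma>: "\<gamma> \<noteq> 0" using \<beta> a0 s0 by auto
  have mid: "s j = 0" if "2 \<le> j" "j \<le> d - 1" for j
    using that
  proof (induction j rule: dec_induct)
    case base
    have "0 = \<gamma> * of_nat 2 * s 2" using rec[of 1] base d3 by (simp add: numeral_2_eq_2)
    then show ?case using \<gamma> by simp
  next
    case (step j)
    have "0 = \<gamma> * of_nat (Suc j) * s (Suc j)" using rec[of j] step by simp
    then show ?case using \<gamma> by (simp only: mult_eq_0_iff of_nat_eq_0_iff eq_commute[of 0]) simp
  qed
  have "?A X Y = ?A 1 0 / \<gamma> * ?B X Y + s d * Y ^ d" for X Y
  proof -
    have "?A X Y = (\<Sum>j\<in>{0, 1, d}. s j * Y ^ j * X ^ (d - j))"
      unfolding s
    proof (rule sum.mono_neutral_right)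
      show "\<forall>j\<in>{..d} - {0, 1, d}. s j * Y ^ j * X ^ (d - j) = 0"
      proof
        fix j assume "j \<in> {..d} - {0, 1, d}"
        then have "2 \<le> j" "j \<le> d - 1" by auto
        then show "s j * Y ^ j * X ^ (d - j) = 0" using mid by simp
      qed
    qed (use d3 in auto)
    also have "\<dots> = s 0 * X ^ d + (s 1 * Y * X ^ (d - 1) + s d * Y ^ d)" using d3 by simp
    also have "X ^ d = X ^ (d - 1) * X" using d3 by (cases d) auto
    also have "s 1 = \<beta> * s 0 / \<gamma>" using s1 \<gamma> by (simp add: field_simps)
    finally show ?thesis unfolding PB s0[symmetric] using \<gamma> by (simp add: field_simps)
  qed
  then show ?thesis using \<gamma> by blast
qed

text \<open>The line \<open>l x + m y = 0\<close> has the direction \<open>(m, - l)\<close>, and it is invariant iff \<open>x A + y B\<close> vanishes there.\<close>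

lemma transverse_direction:
  assumes "transverse_inflection_line A B k L"
  obtains l m where "(l, m) \<noteq> (0, 0)" "m * eval2 A m (- l) + (- l) * eval2 B m (- l) \<noteq> 0"
    "line_poly l m ^ k dvd D_poly A B" "\<not> line_poly l m ^ (k + 1) dvd D_poly A B"
proof -
  obtain l m where lm: "(l, m) \<noteq> (0, 0)" and ni: "\<not> invariant_line (form_field (form2 A B)) (line_fun l m)"
    and dv: "line_poly l m ^ k dvd D_poly A B" "\<not> line_poly l m ^ (k + 1) dvd D_poly A B"
    using assms unfolding transverse_inflection_line_def by blast
  obtain z where z: "line_fun l m z = 0" "derivation (form_field (form2 A B)) (line_fun l m) z \<noteq> 0"
    using ni unfolding invariant_line_def by blast
  obtain x y where xy: "z = (x, y)" by fastforce
  have "deriv (\<lambda>t. l * t + m * y) x = l" "deriv (\<lambda>t. l * x + m * t) y = m"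
    by (auto intro!: DERIV_imp_deriv derivative_eq_intros)
  then have der: "eval2 B x y * l - eval2 A x y * m \<noteq> 0"
    using z(2) by (simp add: derivation_def form_field_def deriv_u_def deriv_v_def line_fun_def form2_def xy)
  obtain a' b' where ab: "l * a' + m * b' = 1" by (rule complementary_vector[OF lm])
  define s where "s = b' * x - a' * y"
  have xs: "x = s * m" "y = s * (- l)"
    using line_coordinates[OF ab, of x y] z(1) by (simp_all add: xy s_def line_fun_def)
  have "eval2 B x y * l - eval2 A x y * m = - (s ^ d) * (m * eval2 A m (- l) + (- l) * eval2 B m (- l))"
    unfolding xs binary_form_scale[OF a] binary_form_scale[OF b] by (simp add: algebra_simps)
  then have "m * eval2 A m (- l) + (- l) * eval2 B m (- l) \<noteq> 0" using der by auto
  then show ?thesis using that lm dv by blast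
qed

lemma parallel_multiple:
  assumes "x1 * y2 - y1 * x2 = (0::complex)" "(x2, y2) \<noteq> (0, 0)"
  obtains k where "x1 = k * x2" "y1 = k * y2"
proof (cases "x2 = 0")
  case True
  then show ?thesis using assms that[of "y1 / y2"] by auto
next
  case False
  then show ?thesis using assms(1) that[of "x1 / x2"] by (simp add: field_simps)
qed

lemma transverse_zero:
  assumes "line_poly l m ^ k dvd D_poly A B" "k \<ge> 1"
  shows "eval2 (D_poly A B) m (- l) = 0"
proof -
  obtain Q where "D_poly A B = line_poly l m ^ k * Q" using assms(1) by blast
  then show ?thesis using assms(2) by (simp add: eval2_mult eval2_power eval2_line_poly)
qed

text \<open>In the basis formed by the directions of the two radial singularities, \<open>R\<^bsub>d-2\<^esub>\<close> determines the second
  coefficient and \<open>R\<^bsub>d-1\<^esub>\<close> the first one, which becomes a multiple of \<open>Y\<^bsup>d\<^esup>\<close>; so \<open>\<rho> = 0\<close>.\<close>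

lemma normal_form_two_radial:
  assumes R2: "radial_of_order \<Omega> s2 (d - 2)" and R1: "radial_of_order \<Omega> s1 (d - 1)"
    and T: "transverse_inflection_line A B 1 L"
  obtains M' K c where "invertible M'" "K \<noteq> 0" "c \<noteq> 0" "c + 1 \<noteq> 0"
    "\<And>p w. form_at \<Omega> (M' *v p) (M' *v w) = K * cone_form (famA d 0 c) (famB d) p w"
proof -
  have k2: "d - 2 + 2 = d" and k1: "d - 1 + 1 = d" using d3 by auto
  obtain x2 y2 where v2: "(x2, y2) \<noteq> (0, 0)" and p2: "\<And>e1 e2. e1 * y2 - e2 * x2 \<noteq> 0 \<Longrightarrow>
     \<exists>\<beta> \<gamma>. \<beta> \<noteq> 0 \<and> (\<forall>X Y. pullB e1 e2 x2 y2 X Y = X ^ (d - 1) * (\<beta> * Y + \<gamma> * X))"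
    using radial_pull[OF R2 k2] by blast
  obtain x1 y1 where v1: "(x1, y1) \<noteq> (0, 0)" and p1: "\<And>e1 e2. e1 * y1 - e2 * x1 \<noteq> 0 \<Longrightarrow>
     \<exists>\<gamma>. \<gamma> \<noteq> 0 \<and> (\<forall>X Y. pullB e1 e2 x1 y1 X Y = \<gamma> * X ^ d)"
    using radial_pull_max[OF R1 k1] by blast
  \<comment> \<open>The two singularities are distinct because the multiplicities \<open>d - 1\<close> and \<open>d\<close> differ.\<close>
  have \<Delta>: "x1 * y2 - y1 * x2 \<noteq> 0"
  proof
    assume "x1 * y2 - y1 * x2 = 0"
    then obtain k where k: "x1 = k * x2" "y1 = k * y2" using parallel_multiple v2 by blast
    have k0: "k \<noteq> 0" using k v1 by auto
    obtain e1 e2 where e: "e1 * y2 - e2 * x2 \<noteq> 0"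
      using v2 that[of 1 0] that[of 0 1] by (cases "y2 = 0") auto
    have "e1 * y1 - e2 * x1 = k * (e1 * y2 - e2 * x2)" by (simp add: k algebra_simps)
    then have e': "e1 * y1 - e2 * x1 \<noteq> 0" using k0 e by simp
    obtain \<beta> \<gamma> where bg: "\<beta> \<noteq> 0" "\<And>X Y. pullB e1 e2 x2 y2 X Y = X ^ (d - 1) * (\<beta> * Y + \<gamma> * X)"
      using p2[OF e] by blast
    obtain \<gamma>' where g': "\<And>X Y. pullB e1 e2 x1 y1 X Y = \<gamma>' * X ^ d" using p1[OF e'] by blast
    have "pullB e1 e2 x1 y1 X Y = k * pullB e1 e2 x2 y2 X (k * Y)" for X Y
      unfolding k by (simp add: pullB_def algebra_simps)
    then have eq: "\<gamma>' * X ^ d = k * (X ^ (d - 1) * (\<beta> * (k * Y) + \<gamma> * X))" for X Y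
      unfolding g' bg(2) .
    have "k * (\<beta> * (k * 1) + \<gamma>) = k * \<gamma>" using eq[of 1 0] eq[of 1 1] by simp
    then show False using k0 bg(1) by simp
  qed
  obtain \<beta> \<gamma> where bg: "\<beta> \<noteq> 0" and B: "\<And>X Y. pullB x1 y1 x2 y2 X Y = X ^ (d - 1) * (\<beta> * Y + \<gamma> * X)"
    using p2[OF \<Delta>] by blast
  have "x2 * y1 - y2 * x1 \<noteq> 0" using \<Delta> by (simp add: mult.commute)
  then obtain c0 where c0: "c0 \<noteq> 0" "\<And>X Y. pullB x2 y2 x1 y1 Y X = c0 * Y ^ d" using p1 by blast
  have A: "pullA x1 y1 x2 y2 X Y = c0 * Y ^ d" for X Y using c0(2) by (simp add: pull_swap)
  have \<gamma>: "\<gamma> \<noteq> 0"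
  proof
    assume "\<gamma> = 0"
    then have z: "pullA x1 y1 x2 y2 1 0 = 0" "pullB x1 y1 x2 y2 1 0 = 0" using d3 by (simp_all add: A B)
    from pull_no_common_zero[OF \<Delta> z] show False by simp
  qed
  have A0: "pullA x1 y1 x2 y2 X Y = 0 * pullB x1 y1 x2 y2 X Y + c0 * Y ^ d" for X Y by (simp add: A)
  obtain s K c where s: "s \<noteq> 0" and K: "K \<noteq> 0" and c: "c \<noteq> 0"
    and B': "\<And>X Y. pullB (s * x1) (s * y1) x2 y2 X Y = K * famB d X Y"
    and A0': "\<And>X Y. pullA (s * x1) (s * y1) x2 y2 X Y = K * famA d (s * 0) c X Y"
    by (rule normalize_pull[OF d3 B A0 bg \<gamma> c0(1)]) (rule that; assumption)
  have A': "pullA (s * x1) (s * y1) x2 y2 X Y = K * famA d 0 c X Y" for X Y using A0' by simp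
  have "(s * x1) * y2 - (s * y1) * x2 = s * (x1 * y2 - y1 * x2)" by (simp add: algebra_simps)
  then have \<Delta>': "(s * x1) * y2 - (s * y1) * x2 \<noteq> 0" using s \<Delta> by simp
  obtain l m where lm: "(l, m) \<noteq> (0, 0)" and nf: "m * eval2 A m (- l) + (- l) * eval2 B m (- l) \<noteq> 0"
    and dv: "line_poly l m ^ 1 dvd D_poly A B" by (rule transverse_direction[OF T])
  have other: "(m, - l) \<noteq> (k * (s * x1), k * (s * y1))" for k
  proof
    assume e: "(m, - l) = (k * (s * x1), k * (s * y1))"
    have "m * eval2 A m (- l) + (- l) * eval2 B m (- l) = k * pullA (s * x1) (s * y1) x2 y2 k 0"
      using pull_radial[of k "s * x1" 0 x2 "s * y1" y2] e by simp
    also have "\<dots> = 0" using d3 by (simp add: A' famA_def)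
    finally show False using nf by simp
  qed
  have "0 + c + 1 \<noteq> 0"
    by (rule third_critical_direction[OF \<Delta>' K c B' A' transverse_zero[OF dv] nf other]) simp
  then show ?thesis using family_rep[OF \<Delta>' B' A'] that K c by auto
qed

text \<open>The basis consists of the direction of the inflection line of order \<open>d - 1\<close> and that of the radial
  singularity. As the inflection line is not invariant, the first coefficient does not vanish on it, and
  so \<open>\<rho> \<noteq> 0\<close>.\<close>

lemma normal_form_two_transverse:
  assumes R2: "radial_of_order \<Omega> s2 (d - 2)" and T': "transverse_inflection_line A B (d - 1) L'"
    and T: "transverse_inflection_line A B 1 L"
  obtains M' K \<rho> c where "invertible M'" "K \<noteq> 0" "\<rho> \<noteq> 0" "c \<noteq> 0" "\<rho> + c + 1 \<noteq> 0"
    "\<And>p w. form_at \<Omega> (M' *v p) (M' *v w) = K * cone_form (famA d \<rho> c) (famB d) p w"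
proof -
  have k2: "d - 2 + 2 = d" and k1: "d - 1 + 1 = d" using d3 by auto
  obtain x2 y2 where v2: "(x2, y2) \<noteq> (0, 0)" and p2: "\<And>e1 e2. e1 * y2 - e2 * x2 \<noteq> 0 \<Longrightarrow>
     \<exists>\<beta> \<gamma>. \<beta> \<noteq> 0 \<and> (\<forall>X Y. pullB e1 e2 x2 y2 X Y = X ^ (d - 1) * (\<beta> * Y + \<gamma> * X))"
    using radial_pull[OF R2 k2] by blast
  obtain l m where lm: "(l, m) \<noteq> (0, 0)" and nf: "m * eval2 A m (- l) + (- l) * eval2 B m (- l) \<noteq> 0"
    and dv: "line_poly l m ^ (d - 1) dvd D_poly A B" by (rule transverse_direction[OF T'])
  obtain l1 m1 where lm1: "(l1, m1) \<noteq> (0, 0)" and nf1: "m1 * eval2 A m1 (- l1) + (- l1) * eval2 B m1 (- l1) \<noteq> 0"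
    and dv1: "line_poly l1 m1 ^ 1 dvd D_poly A B" "\<not> line_poly l1 m1 ^ (1 + 1) dvd D_poly A B"
    by (rule transverse_direction[OF T])
  \<comment> \<open>The direction of a radial singularity is invariant, that of the inflection line is not.\<close>
  have \<Delta>: "m * y2 - (- l) * x2 \<noteq> 0"
  proof
    assume "m * y2 - (- l) * x2 = 0"
    then obtain k where k: "m = k * x2" "- l = k * y2" using parallel_multiple v2 by blast
    obtain e1 e2 where e: "e1 * y2 - e2 * x2 \<noteq> 0"
      using v2 that[of 1 0] that[of 0 1] by (cases "y2 = 0") auto
    obtain \<beta> \<gamma> where bg: "\<And>X Y. pullB e1 e2 x2 y2 X Y = X ^ (d - 1) * (\<beta> * Y + \<gamma> * X)"
      using p2[OF e] by blast
    have "(0::complex) ^ (d - 1) = 0" using d3 by simp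
    then have "pullB e1 e2 x2 y2 0 1 = 0" unfolding bg by simp
    then have "x2 * eval2 A x2 y2 + y2 * eval2 B x2 y2 = 0" by (simp add: pullB_def)
    moreover have "m * eval2 A m (- l) + (- l) * eval2 B m (- l) = k * k ^ d * (x2 * eval2 A x2 y2 + y2 * eval2 B x2 y2)"
      unfolding k binary_form_scale[OF a] binary_form_scale[OF b] by (simp add: algebra_simps)
    ultimately show False using nf by simp
  qed
  then have \<Delta>2: "m * y2 + l * x2 \<noteq> 0" by simp
  obtain \<beta> \<gamma> where bg: "\<beta> \<noteq> 0" and B: "\<And>X Y. pullB m (- l) x2 y2 X Y = X ^ (d - 1) * (\<beta> * Y + \<gamma> * X)"
    using p2[OF \<Delta>] by blast
  have a0: "pullA m (- l) x2 y2 1 0 \<noteq> 0" using nf by (simp add: pullA_def)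
  define \<rho>0 where "\<rho>0 = pullA m (- l) x2 y2 1 0 / \<gamma>"
  obtain c0 where \<gamma>: "\<gamma> \<noteq> 0" and A: "\<And>X Y. pullA m (- l) x2 y2 X Y = \<rho>0 * pullB m (- l) x2 y2 X Y + c0 * Y ^ d"
    using maximal_inflection_pull[OF \<Delta>2 dv B bg a0] unfolding \<rho>0_def by blast
  have \<rho>0: "\<rho>0 \<noteq> 0" using a0 \<gamma> by (simp add: \<rho>0_def)
  have c0: "c0 \<noteq> 0"
  proof
    assume "c0 = 0"
    then have z: "pullA m (- l) x2 y2 0 1 = 0" "pullB m (- l) x2 y2 0 1 = 0" using d3 by (simp_all add: A B)
    from pull_no_common_zero[OF \<Delta> z] show False by simp
  qed
  obtain s K c where s: "s \<noteq> 0" and K: "K \<noteq> 0" and c: "c \<noteq> 0"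
    and B': "\<And>X Y. pullB (s * m) (s * - l) x2 y2 X Y = K * famB d X Y"
    and A': "\<And>X Y. pullA (s * m) (s * - l) x2 y2 X Y = K * famA d (s * \<rho>0) c X Y"
    by (rule normalize_pull[OF d3 B A bg \<gamma> c0]) (rule that; assumption)
  have "(s * m) * y2 - (s * - l) * x2 = s * (m * y2 - (- l) * x2)" by (simp add: algebra_simps)
  then have \<Delta>': "(s * m) * y2 - (s * - l) * x2 \<noteq> 0" using s \<Delta> by simp
  have other: "(m1, - l1) \<noteq> (k * (s * m), k * (s * - l))" for k
  proof
    assume e: "(m1, - l1) = (k * (s * m), k * (s * - l))"
    define r where "r = k * s"
    have r: "m1 = r * m" "l1 = r * l" using e by (simp_all add: r_def mult.assoc)
    have r0: "r \<noteq> 0" using r lm1 by auto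
    \<comment> \<open>Otherwise the line of \<open>T\<^sub>1\<close> would divide \<open>D_poly A B\<close> with multiplicity \<open>d - 1 \<ge> 2\<close>.\<close>
    have lp: "line_poly l1 m1 = [:[:r:]:] * line_poly l m"
      by (simp add: r line_poly_def algebra_simps)
    have "line_poly l m ^ 2 dvd line_poly l m ^ (d - 1)" using d3 by (intro le_imp_power_dvd) simp
    then have "line_poly l m ^ 2 dvd D_poly A B" using dv dvd_trans by blast
    moreover have "is_unit ([:[:r:]:] ^ 2 :: poly2)" using r0 by (simp add: is_unit_power_iff is_unit_const_poly_iff dvd_field_iff)
    ultimately have "[:[:r:]:] ^ 2 * line_poly l m ^ 2 dvd D_poly A B" by (simp add: mult_unit_dvd_iff')
    then show False using dv1(2) unfolding lp one_add_one power_mult_distrib by simp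
  qed
  have "s * \<rho>0 + c + 1 \<noteq> 0"
    by (rule third_critical_direction[OF \<Delta>' K c B' A' transverse_zero[OF dv1(1)] nf1 other]) simp
  moreover have "s * \<rho>0 \<noteq> 0" using s \<rho>0 by simp
  ultimately show ?thesis using family_rep[OF \<Delta>' B' A'] that K c by blast
qed

end

section \<open>Flatness and linear conjugacy\<close>

text \<open>Conjugacy is restated as a change of coordinates that brings \<open>\<Omega>\<close> to a multiple of the cone form, the
  shape in which the normal forms are obtained and in which flatness is decided.\<close>

lemma lin_conj_homog_form:
  "lin_conj \<Omega> (homog_form A B) \<longleftrightarrow> (\<exists>M K. invertible M \<and> K \<noteq> 0 \<and>
     (\<forall>p w. form_at \<Omega> (M *v p) (M *v w) = K * cone_form (eval2 A) (eval2 B) p w))"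
proof
  assume "lin_conj \<Omega> (homog_form A B)"
  then obtain M c where M: "invertible M" "c \<noteq> 0"
    "\<And>p w. cone_form (eval2 A) (eval2 B) (M *v p) (M *v w) = c * form_at \<Omega> p w"
    unfolding lin_conj_def form_at_homog_form by blast
  obtain N where N: "M ** N = mat 1" "N ** M = mat 1" using M by (auto simp: invertible_def)
  have "invertible N" using N by (auto simp: invertible_def)
  moreover have "form_at \<Omega> (N *v p) (N *v w) = (1 / c) * cone_form (eval2 A) (eval2 B) p w" for p w
    using M(3)[of "N *v p" "N *v w"] M(2) by (simp add: matrix_vector_mul_assoc N)
  moreover have "1 / c \<noteq> 0" using M(2) by simp
  ultimately show "\<exists>M K. invertible M \<and> K \<noteq> 0 \<and>
     (\<forall>p w. form_at \<Omega> (M *v p) (M *v w) = K * cone_form (eval2 A) (eval2 B) p w)" by blast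
next
  assume "\<exists>M K. invertible M \<and> K \<noteq> 0 \<and>
     (\<forall>p w. form_at \<Omega> (M *v p) (M *v w) = K * cone_form (eval2 A) (eval2 B) p w)"
  then obtain M K where M: "invertible M" "K \<noteq> 0"
    "\<And>p w. form_at \<Omega> (M *v p) (M *v w) = K * cone_form (eval2 A) (eval2 B) p w" by blast
  obtain N where N: "M ** N = mat 1" "N ** M = mat 1" using M by (auto simp: invertible_def)
  have "invertible N" using N by (auto simp: invertible_def)
  moreover have "cone_form (eval2 A) (eval2 B) (N *v p) (N *v w) = (1 / K) * form_at \<Omega> p w" for p w
    using M(3)[of "N *v p" "N *v w"] M(2) by (simp add: matrix_vector_mul_assoc N)
  moreover have "1 / K \<noteq> 0" using M(2) by simp
  ultimately show "lin_conj \<Omega> (homog_form A B)" unfolding lin_conj_def form_at_homog_form by blast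
qed

lemma lin_conj_H5:
  "lin_conj \<Omega> (H5 d) \<longleftrightarrow> (\<exists>M K. invertible M \<and> K \<noteq> 0 \<and>
     (\<forall>p w. form_at \<Omega> (M *v p) (M *v w) = K * cone_form (famA d 0 2) (famB d) p w))"
proof -
  have "eval2 (2 * Y2 ^ d) = famA d 0 2"
    "eval2 (X2 ^ (d - 1) * (of_nat d * Y2 - of_nat (d - 1) * X2)) = famB d"
    unfolding fun_eq_iff eval2_simps famA_def famB_def by simp_all
  then show ?thesis unfolding H5_def lin_conj_homog_form by simp
qed

text \<open>Expanding \<open>\<rho> B + c y\<^bsup>d\<^esup>\<close> for \<open>\<rho> = 1 - d\<close> and \<open>c = d + 1\<close> gives the coefficient of \<open>dx\<close> in \<open>\<H>\<^sub>6\<close>.\<close>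

lemma lin_conj_H6:
  assumes "d \<ge> 1"
  shows "lin_conj \<Omega> (H6 d) \<longleftrightarrow> (\<exists>M K. invertible M \<and> K \<noteq> 0 \<and>
     (\<forall>p w. form_at \<Omega> (M *v p) (M *v w) =
        K * cone_form (famA d (- of_nat (d - 1)) (of_nat d + 1)) (famB d) p w))"
proof -
  have "eval2 (of_nat ((d - 1)\<^sup>2) * X2 ^ d - of_nat (d * (d - 1)) * X2 ^ (d - 1) * Y2
        + of_nat (d + 1) * Y2 ^ d) x y = famA d (- of_nat (d - 1)) (of_nat d + 1) x y" for x y
  proof -
    obtain n where "d = Suc n" using assms by (cases d) auto
    then show ?thesis
      unfolding eval2_simps famA_def famB_def by (simp add: algebra_simps power2_eq_square)
  qed
  then have "eval2 (of_nat ((d - 1)\<^sup>2) * X2 ^ d - of_nat (d * (d - 1)) * X2 ^ (d - 1) * Y2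
        + of_nat (d + 1) * Y2 ^ d) = famA d (- of_nat (d - 1)) (of_nat d + 1)"
    by (simp add: fun_eq_iff)
  moreover have "eval2 (X2 ^ (d - 1) * (of_nat d * Y2 - of_nat (d - 1) * X2)) = famB d"
    unfolding fun_eq_iff eval2_simps famB_def by simp
  ultimately show ?thesis unfolding H6_def lin_conj_homog_form by simp
qed

lemma has_type_lookup:
  assumes "has_type d \<Omega> \<T>"
  obtains M A B where "described_by d \<Omega> M A B"
    "\<And>k. 1 \<le> k \<Longrightarrow> k \<le> d - 1 \<Longrightarrow> Poly_Mapping.lookup \<T> (RVar k) = card {s. radial_of_order \<Omega> s k}"
    "\<And>k. 1 \<le> k \<Longrightarrow> k \<le> d - 1 \<Longrightarrow> Poly_Mapping.lookup \<T> (TVar k) = card {L. transverse_inflection_line A B k L}"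
proof -
  obtain M A B where desc: "described_by d \<Omega> M A B" and T: "\<T> = (\<Sum>k=1..d-1.
        Poly_Mapping.single (RVar k) (card {s. radial_of_order \<Omega> s k}) +
        Poly_Mapping.single (TVar k) (card {L. transverse_inflection_line A B k L}))"
    using assms unfolding has_type_def by blast
  show ?thesis
  proof (rule that[OF desc])
    fix k assume k: "1 \<le> k" "k \<le> d - 1"
    have "Poly_Mapping.lookup \<T> (RVar k) = (\<Sum>i=1..d-1. if i = k then card {s. radial_of_order \<Omega> s k} else 0)"
      unfolding T lookup_sum lookup_add lookup_single by (intro sum.cong) (auto simp: when_def)
    then show "Poly_Mapping.lookup \<T> (RVar k) = card {s. radial_of_order \<Omega> s k}" using k by simp
    have "Poly_Mapping.lookup \<T> (TVar k) = (\<Sum>i=1..d-1. if i = k then card {L. transverse_inflection_line A B k L} else 0)"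
      unfolding T lookup_sum lookup_add lookup_single by (intro sum.cong) (auto simp: when_def)
    then show "Poly_Mapping.lookup \<T> (TVar k) = card {L. transverse_inflection_line A B k L}" using k by simp
  qed
qed

lemma card_1_ex: "Suc 0 = card {x. P x} \<Longrightarrow> \<exists>x. P x"
  by (metis card.empty empty_Collect_eq nat.simps(3))

theorem proposition2p17:
  fixes d :: nat and \<H> :: form3
  assumes "d \<ge> 3"
    and "homogeneous_foliation d \<H>"
  shows "(has_type d \<H> (Poly_Mapping.single (RVar (d - 2)) 1 + Poly_Mapping.single (TVar 1) 1
              + Poly_Mapping.single (RVar (d - 1)) 1)
            \<longrightarrow> (flat_web d (leg_web \<H>) \<longleftrightarrow> lin_conj \<H> (H5 d)))
       \<and> (has_type d \<H> (Poly_Mapping.single (RVar (d - 2)) 1 + Poly_Mapping.single (TVar 1) 1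
              + Poly_Mapping.single (TVar (d - 1)) 1)
            \<longrightarrow> (flat_web d (leg_web \<H>) \<longleftrightarrow> lin_conj \<H> (H6 d)))"
proof (intro conjI impI)
  have d3: "d \<ge> 3" and fol: "foliation d \<H>" using assms by (auto simp: homogeneous_foliation_def)
  have k: "1 \<le> d - 2" "d - 2 \<le> d - 1" "1 \<le> d - 1" "d - 2 \<noteq> d - 1" "d - 1 \<noteq> 1" using d3 by auto
  {
    assume ty: "has_type d \<H> (Poly_Mapping.single (RVar (d - 2)) 1 + Poly_Mapping.single (TVar 1) 1
              + Poly_Mapping.single (RVar (d - 1)) 1)" (is "has_type d \<H> ?T")
    obtain M A B where desc: "described_by d \<H> M A B"
      and R: "\<And>k. 1 \<le> k \<Longrightarrow> k \<le> d - 1 \<Longrightarrow> Poly_Mapping.lookup ?T (RVar k) = card {s. radial_of_order \<H> s k}"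
      and T: "\<And>k. 1 \<le> k \<Longrightarrow> k \<le> d - 1 \<Longrightarrow> Poly_Mapping.lookup ?T (TVar k) = card {L. transverse_inflection_line A B k L}"
      using has_type_lookup[OF ty] by blast
    interpret polynomial_foliation d A B \<H> M using d3 fol desc by unfold_locales
    obtain s2 where s2: "radial_of_order \<H> s2 (d - 2)"
      using R[OF k(1,2)] k card_1_ex by (auto simp: lookup_add lookup_single when_def)
    obtain s1 where s1: "radial_of_order \<H> s1 (d - 1)"
      using R[OF k(3) order_refl] k card_1_ex by (auto simp: lookup_add lookup_single when_def)
    obtain L where L: "transverse_inflection_line A B 1 L"
      using T[OF order_refl k(3)] k card_1_ex by (auto simp: lookup_add lookup_single when_def)
    obtain M' K c where M': "invertible M'" "K \<noteq> 0" "c \<noteq> 0" "c + 1 \<noteq> 0" and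
      rep': "\<And>p w. form_at \<H> (M' *v p) (M' *v w) = K * cone_form (famA d 0 c) (famB d) p w"
      by (rule normal_form_two_radial[OF s2 s1 L]) (rule that; assumption)
    \<comment> \<open>Here \<open>\<rho> = 0\<close> and \<open>c + 1 \<noteq> 0\<close>, so the conditions of flatness reduce to \<open>c - 2 = 0\<close>.\<close>
    have "flat_web d (leg_web \<H>) \<longleftrightarrow> c = 2"
      using flat_leg_family[OF d3 M'(3,2,1) rep'] M'(4) by simp
    moreover have "lin_conj \<H> (H5 d)" if "c = 2"
      unfolding lin_conj_H5 using M' rep' that by blast
    moreover have "flat_web d (leg_web \<H>)" if "lin_conj \<H> (H5 d)"
    proof -
      obtain N C where "invertible N" "C \<noteq> 0"
        "\<And>p w. form_at \<H> (N *v p) (N *v w) = C * cone_form (famA d 0 2) (famB d) p w"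
        using \<open>lin_conj \<H> (H5 d)\<close> unfolding lin_conj_H5 by blast
      from flat_leg_family[OF d3 _ this(2,1,3)] show ?thesis by simp
    qed
    ultimately show "flat_web d (leg_web \<H>) \<longleftrightarrow> lin_conj \<H> (H5 d)" by blast
  next
    assume ty: "has_type d \<H> (Poly_Mapping.single (RVar (d - 2)) 1 + Poly_Mapping.single (TVar 1) 1
              + Poly_Mapping.single (TVar (d - 1)) 1)" (is "has_type d \<H> ?T")
    obtain M A B where desc: "described_by d \<H> M A B"
      and R: "\<And>k. 1 \<le> k \<Longrightarrow> k \<le> d - 1 \<Longrightarrow> Poly_Mapping.lookup ?T (RVar k) = card {s. radial_of_order \<H> s k}"
      and T: "\<And>k. 1 \<le> k \<Longrightarrow> k \<le> d - 1 \<Longrightarrow> Poly_Mapping.lookup ?T (TVar k) = card {L. transverse_inflection_line A B k L}"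
      using has_type_lookup[OF ty] by blast
    interpret polynomial_foliation d A B \<H> M using d3 fol desc by unfold_locales
    obtain s2 where s2: "radial_of_order \<H> s2 (d - 2)"
      using R[OF k(1,2)] k card_1_ex by (auto simp: lookup_add lookup_single when_def)
    obtain L' where L': "transverse_inflection_line A B (d - 1) L'"
      using T[OF k(3) order_refl] k card_1_ex by (auto simp: lookup_add lookup_single when_def)
    obtain L where L: "transverse_inflection_line A B 1 L"
      using T[OF order_refl k(3)] k card_1_ex by (auto simp: lookup_add lookup_single when_def)
    obtain M' K \<rho> c where M': "invertible M'" "K \<noteq> 0" "\<rho> \<noteq> 0" "c \<noteq> 0" "\<rho> + c + 1 \<noteq> 0" and
      rep': "\<And>p w. form_at \<H> (M' *v p) (M' *v w) = K * cone_form (famA d \<rho> c) (famB d) p w"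
      by (rule normal_form_two_transverse[OF s2 L' L]) (rule that; assumption)
    have n: "of_nat (d - 1) = (of_nat d :: complex) - 1" using d3 by (simp add: of_nat_diff)
    \<comment> \<open>The factors \<open>\<rho>\<close> and \<open>\<rho> + c + 1\<close> do not vanish, so in each condition the other factor must.\<close>
    have "flat_web d (leg_web \<H>) \<longleftrightarrow> \<rho> + of_nat (d - 1) = 0 \<and> \<rho> + c - 2 = 0"
      using flat_leg_family[OF d3 M'(4,2,1) rep'] M'(3,5) by simp
    also have "\<dots> \<longleftrightarrow> \<rho> = - of_nat (d - 1) \<and> c = of_nat d + 1"
    proof -
      have "\<rho> + of_nat (d - 1) = 0 \<longleftrightarrow> \<rho> = - of_nat (d - 1)" by (rule eq_neg_iff_add_eq_0[symmetric])
      moreover have "- of_nat (d - 1) + c - 2 = c - (of_nat d + 1)" unfolding n by simp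
      then have "- of_nat (d - 1) + c - 2 = 0 \<longleftrightarrow> c = of_nat d + 1" by (simp only: right_minus_eq)
      ultimately show ?thesis by blast
    qed
    finally have "flat_web d (leg_web \<H>) \<longleftrightarrow> \<rho> = - of_nat (d - 1) \<and> c = of_nat d + 1" .
    moreover have "lin_conj \<H> (H6 d)" if "\<rho> = - of_nat (d - 1) \<and> c = of_nat d + 1"
      unfolding lin_conj_H6[OF k(3)[THEN order_trans[OF _ diff_le_self]]] using M' rep' that by blast
    moreover have "flat_web d (leg_web \<H>)" if "lin_conj \<H> (H6 d)"
    proof -
      have d1: "d \<ge> 1" using d3 by simp
      obtain N C where N: "invertible N" "C \<noteq> 0"
        "\<And>p w. form_at \<H> (N *v p) (N *v w) = C * cone_form (famA d (- of_nat (d - 1)) (of_nat d + 1)) (famB d) p w"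
        using \<open>lin_conj \<H> (H6 d)\<close> unfolding lin_conj_H6[OF d1] by blast
      have "(of_nat d + 1 :: complex) \<noteq> 0"
        by (metis Suc_eq_plus1 nat.simps(3) of_nat_Suc of_nat_eq_0_iff add.commute)
      from flat_leg_family[OF d3 this N(2,1,3)] show ?thesis unfolding n by simp
    qed
    ultimately show "flat_web d (leg_web \<H>) \<longleftrightarrow> lin_conj \<H> (H6 d)" by blast
  }
qed

end
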